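(* Let $(X,R)$ be an infinite ultrahomogeneous cyclically ordered set with the discrete topology and let $G=(\mathrm{Aut}(X,R),\tau_\partial)$ be its automorphism group with the permutation topology. Then $$wG=b_XG,$$ i.e. the WAP compactification of $G$ and the graph compactification of $G$ corresponding to the action $G\curvearrowright X$ are equivalent compactifications of $G$.
   Context: Cyclic orders. A cyclically ordered (c.o.) set $(X,R)$, $|X|\ge 3$, is a set with a ternary relation $R=[\cdot,\cdot,\cdot]$ satisfying: cyclicity $[a,b,c]\Rightarrow[b,c,a]$; asymmetry $[a,b,c]\Rightarrow\neg[b,a,c]$; transitivity $[a,b,c]\wedge[a,c,d]\Rightarrow[a,b,d]$; completeness: for pairwise distinct $a,b,c$ either $[a,b,c]$ or $[a,c,b]$. A tuple $(x_1,\dots,x_n)$, $n\ge3$, is a cycle if $[x_i,x_j,x_k]$ for all $i<j<k$; a tuple of length 1 is a cycle; a pair $(x_1,x_2)$ is a cycle if $x_1\ne x_2$. $\mathrm{Aut}(X,R)$ is the group of bijections $f:X\to X$ with $[a,b,c]\iff[fa,fb,fc]$. $(X,R)$ is ultrahomogeneous if for every $n\in\mathbb N$ and any cycles $(x_1,\dots,x_n)$, $(y_1,\dots,y_n)$ in $X$ there is $g\in \mathrm{Aut}(X,R)$ with $gx_i=y_i$ for all $i$. The permutation topology $\tau_\partial$ is the topology of pointwise convergence for the action on the discrete space $X$ (pointwise stabilizers of finite subsets form a base at the identity); $G$ is a topological group. WAP compactification. Let $C_b(G)$ be the $C^*$-algebra of bounded continuous functions $G\to\mathbb C$. For $\varphi\in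 C_b(G)$ and $g\in G$ put $\varphi_g(h)=\varphi(gh)$. The function $\varphi$ is weakly almost periodic if its orbit $\{\varphi_g: g\in G\}$ is relatively compact in the weak topology of the Banach space $C_b(G)$. $WAP(G)$ is the $C^*$-algebra of all weakly almost periodic functions, and $wG$ is its Gelfand space with the canonical map $G\to wG$; it is the largest semitopological semigroup compactification of $G$ (a semitopological semigroup is a semigroup with a topology in which multiplication is separately continuous). Graph compactification. Let $2^{X\times X}$ be the set of all closed subsets of the discrete space $X\times X$ (i.e. all subsets, including $\varnothing$) with the Fell topology, whose base consists of the sets $\{F: F\cap V_i\neq\varnothing\ (i\le n),\ F\cap K_j=\varnothing\ (j\le m)\}$ with $V_i$ open and $K_j$ compact (here: finite). Let $i_X:G\to 2^{X\times X}$, $i_X(g)=\Gamma(g)=\{(x,gx):x\in X\}$. Then $b_XG=\left(\overline{i_X(G)},i_X\right)$, the closure being taken in $2^{X\times X}$. Two compactifications of $G$ are equivalent (written $=$) if there is a homeomorphism between them commuting with the maps from $G$. *)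

theory Defs
  imports "HOL-Analysis.Analysis" "HOL-Algebra.Group"
begin

section \<open>Cyclically ordered sets\<close>

text \<open>The underlying set is the whole type \<open>'a\<close>.\<close>

locale cyclic_order =
  fixes R :: "'a \<Rightarrow> 'a \<Rightarrow> 'a \<Rightarrow> bool"
  assumes three_points: "\<exists>a b c :: 'a. a \<noteq> b \<and> b \<noteq> c \<and> a \<noteq> c"
    and cyclicity: "R a b c \<Longrightarrow> R b c a"
    and asymmetry: "R a b c \<Longrightarrow> \<not> R b a c"
    and transitivity: "R a b c \<Longrightarrow> R a c d \<Longrightarrow> R a b d"
    and completeness: "a \<noteq> b \<Longrightarrow> b \<noteq> c \<Longrightarrow> a \<noteq> c \<Longrightarrow> R a b c \<or> R a c b"

definition is_cycle :: "('a \<Rightarrow> 'a \<Rightarrow> 'a \<Rightarrow> bool) \<Rightarrow> 'a list \<Rightarrow> bool" where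
  "is_cycle R xs \<longleftrightarrow>
     length xs = 1 \<or>
     length xs = 2 \<and> xs ! 0 \<noteq> xs ! 1 \<or>
     length xs \<ge> 3 \<and>
       (\<forall>i j k. i < j \<and> j < k \<and> k < length xs \<longrightarrow> R (xs ! i) (xs ! j) (xs ! k))"

definition aut_group :: "('a \<Rightarrow> 'a \<Rightarrow> 'a \<Rightarrow> bool) \<Rightarrow> ('a \<Rightarrow> 'a) monoid" where
  "aut_group R =
     \<lparr>carrier = {f. bij f \<and> (\<forall>a b c. R a b c \<longleftrightarrow> R (f a) (f b) (f c))},
      monoid.mult = (\<circ>), one = id\<rparr>"

definition ultrahomogeneous :: "('a \<Rightarrow> 'a \<Rightarrow> 'a \<Rightarrow> bool) \<Rightarrow> bool" where
  "ultrahomogeneous R \<longleftrightarrow>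
     (\<forall>xs ys. is_cycle R xs \<and> is_cycle R ys \<and> length xs = length ys \<longrightarrow>
        (\<exists>g \<in> carrier (aut_group R). map g xs = ys))"

definition permutation_topology :: "('a \<Rightarrow> 'a) monoid \<Rightarrow> ('a \<Rightarrow> 'a) topology" where
  "permutation_topology G =
     subtopology (product_topology (\<lambda>_. discrete_topology UNIV) UNIV) (carrier G)"


section \<open>Compactifications\<close>

text \<open>The map into a compactification need not be an embedding.\<close>

definition compactification :: "'g topology \<Rightarrow> 'y topology \<times> ('g \<Rightarrow> 'y) \<Rightarrow> bool" where
  "compactification T = (\<lambda>(Y, j).
     compact_space Y \<and> Hausdorff_space Y \<and> continuous_map T Y j \<and>
     Y closure_of (j ` topspace T) = topspace Y)"

definition equivalent_compactifications ::
    "'g topology \<Rightarrow> 'y topology \<times> ('g \<Rightarrow> 'y) \<Rightarrow> 'z topology \<times> ('g \<Rightarrow> 'z) \<Rightarrow> bool" where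
  "equivalent_compactifications T = (\<lambda>(Y, j) (Z, k).
     \<exists>h. homeomorphic_map Y Z h \<and> (\<forall>g \<in> topspace T. h (j g) = k g))"


section \<open>The weakly almost periodic compactification\<close>

text \<open>
  Complex functions on a set \<open>S\<close> are represented by functions in \<open>extensional S\<close>, so
  that equality is equality on \<open>S\<close>; the operations are pointwise, restricted to \<open>S\<close>.
\<close>

definition Cb :: "'g topology \<Rightarrow> ('g \<Rightarrow> complex) set" where
  "Cb T = {f \<in> extensional (topspace T).
             continuous_map T euclidean f \<and> bounded (f ` topspace T)}"

definition sup_norm :: "'g set \<Rightarrow> ('g \<Rightarrow> complex) \<Rightarrow> real" where
  "sup_norm S f = (SUP x\<in>S. norm (f x))"

definition linear_functional_on ::
    "'g set \<Rightarrow> ('g \<Rightarrow> complex) set \<Rightarrow> (('g \<Rightarrow> complex) \<Rightarrow> complex) \<Rightarrow> bool" where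
  "linear_functional_on S A L \<longleftrightarrow>
     (\<forall>f\<in>A. \<forall>g\<in>A. L (\<lambda>x\<in>S. f x + g x) = L f + L g) \<and>
     (\<forall>c. \<forall>f\<in>A. L (\<lambda>x\<in>S. c * f x) = c * L f)"

definition dual_Cb :: "'g topology \<Rightarrow> (('g \<Rightarrow> complex) \<Rightarrow> complex) set" where
  "dual_Cb T = {L. linear_functional_on (topspace T) (Cb T) L \<and>
                   (\<exists>K. \<forall>f\<in>Cb T. norm (L f) \<le> K * sup_norm (topspace T) f)}"

definition weak_topology_Cb :: "'g topology \<Rightarrow> ('g \<Rightarrow> complex) topology" where
  "weak_topology_Cb T =
     topology_generated_by {{f \<in> Cb T. L f \<in> U} | L U. L \<in> dual_Cb T \<and> open U}"

definition translate :: "('g, 'm) monoid_scheme \<Rightarrow> 'g \<Rightarrow> ('g \<Rightarrow> complex) \<Rightarrow> 'g \<Rightarrow> complex" where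
  "translate G g \<phi> = (\<lambda>h\<in>carrier G. \<phi> (g \<otimes>\<^bsub>G\<^esub> h))"

text \<open>In the following, \<open>T\<close> is a topology on \<open>carrier G\<close>.\<close>

definition WAP :: "('g, 'm) monoid_scheme \<Rightarrow> 'g topology \<Rightarrow> ('g \<Rightarrow> complex) set" where
  "WAP G T = {\<phi> \<in> Cb T.
     compactin (weak_topology_Cb T)
       (weak_topology_Cb T closure_of ((\<lambda>g. translate G g \<phi>) ` carrier G))}"

definition characters ::
    "'g set \<Rightarrow> ('g \<Rightarrow> complex) set \<Rightarrow> (('g \<Rightarrow> complex) \<Rightarrow> complex) set" where
  "characters S A = {\<xi> \<in> extensional A.
     linear_functional_on S A \<xi> \<and>
     (\<forall>f\<in>A. \<forall>g\<in>A. \<xi> (\<lambda>x\<in>S. f x * g x) = \<xi> f * \<xi> g) \<and>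
     (\<exists>f\<in>A. \<xi> f \<noteq> 0)}"

text \<open>The product topology over the index set \<open>A\<close> is the weak-star topology.\<close>

definition gelfand_space ::
    "'g set \<Rightarrow> ('g \<Rightarrow> complex) set \<Rightarrow> (('g \<Rightarrow> complex) \<Rightarrow> complex) topology" where
  "gelfand_space S A = subtopology (product_topology (\<lambda>_. euclidean) A) (characters S A)"

definition WAP_compactification ::
    "('g, 'm) monoid_scheme \<Rightarrow> 'g topology \<Rightarrow>
     (('g \<Rightarrow> complex) \<Rightarrow> complex) topology \<times> ('g \<Rightarrow> ('g \<Rightarrow> complex) \<Rightarrow> complex)" where
  "WAP_compactification G T =
     (gelfand_space (topspace T) (WAP G T), \<lambda>g. \<lambda>\<phi>\<in>WAP G T. \<phi> g)"


section \<open>The graph compactification\<close>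

definition fell_topology :: "'b topology \<Rightarrow> 'b set topology" where
  "fell_topology Y = topology_generated_by
     {{F. closedin Y F \<and> (\<forall>V\<in>\<V>. F \<inter> V \<noteq> {}) \<and> (\<forall>K\<in>\<K>. F \<inter> K = {})} | \<V> \<K>.
        finite \<V> \<and> (\<forall>V\<in>\<V>. openin Y V) \<and> finite \<K> \<and> (\<forall>K\<in>\<K>. compactin Y K)}"

definition function_graph :: "('a \<Rightarrow> 'a) \<Rightarrow> ('a \<times> 'a) set" where
  "function_graph g = {(x, g x) | x. True}"

definition graph_compactification ::
    "('a \<Rightarrow> 'a) monoid \<Rightarrow> ('a \<times> 'a) set topology \<times> (('a \<Rightarrow> 'a) \<Rightarrow> ('a \<times> 'a) set)" where
  "graph_compactification G =
     (let Z = fell_topology (discrete_topology UNIV)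
      in (subtopology Z (Z closure_of (function_graph ` carrier G)), function_graph))"

end

theory Submission
  imports Defs
begin

text \<open>
  Let \<open>G\<close> be the automorphism group and \<open>K\<close> the closure of the graphs of its elements; the elements
  of \<open>K\<close> are injective partial maps. The theorem holds because the weakly almost periodic functions on
  \<open>G\<close> are exactly the restrictions of continuous functions on \<open>K\<close>. Given this, every
  character of the algebra of weakly almost periodic functions is the evaluation at a unique point of
  \<open>K\<close> (\<open>character_is_evaluation\<close>), and this bijection is a homeomorphism that respects the
  maps from \<open>G\<close>.

  Continuous functions on \<open>K\<close> restrict to weakly almost periodic ones
  (\<open>limits_function_WAP\<close>). It suffices that for a continuous \<open>F\<close> the function
  \<open>h \<mapsto> F (p \<circ> h)\<close> depends weakly continuously on \<open>p\<close>, for then the orbit of the restriction lies in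
  a weakly compact set. If \<open>F\<close> is the indicator of the relations that contain a given finite set of
  pairs, these functions are, for different \<open>p\<close>, indicators with disjoint supports, and a bounded
  functional is bounded away from zero on finitely many of them only. The general case follows by
  uniform approximation.

  Conversely, let \<open>\<phi>\<close> be weakly almost periodic. Then limits of \<open>\<phi> (a \<circ> b)\<close> along
  ultrafilters of \<open>a\<close> and \<open>b\<close> can be exchanged. This implies that \<open>\<phi>\<close> is uniformly continuous
  on both sides (\<open>left_uniformly_continuous\<close>), and that ultrafilters on \<open>G\<close>, identified if no
  translate of \<open>\<phi>\<close> separates them, form a semigroup. For every finite nonempty set \<open>A\<close> of points
  there is a unique element \<open>e A\<close> of this semigroup that lives on the stabilizer of \<open>A\<close> and absorbs
  it; it is a limit of automorphisms that push all points within their gap of \<open>A\<close> towards the left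
  end, and equally of automorphisms that push to the right. Composing left pushes or right pushes,
  according to the relative position of \<open>a\<close> and \<open>b\<close>, gives
  \<open>e (insert a C) \<odot> e (insert b C) \<simeq> e C\<close> (\<open>exchange_absorbing\<close>), from which
  \<open>e A \<odot> e B \<simeq> e (A \<inter> B)\<close> follows by algebra if \<open>A\<close> and \<open>B\<close> meet; if they do not, the
  product is a zero of the semigroup. Therefore \<open>e A \<odot> g \<odot> e A\<close>, being equivalent to
  \<open>g \<odot> e (g\<^sup>-\<^sup>1 A) \<odot> e A\<close>, depends only on which points of \<open>A\<close> the automorphism \<open>g\<close>
  sends to which points of \<open>A\<close>. By uniform continuity \<open>\<phi> g\<close> is close to the limit of \<open>\<phi>\<close> along
  this element, and so \<open>\<phi>\<close> extends continuously to \<open>K\<close> (\<open>pattern_continuous\<close>).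
\<close>

section \<open>Ultrafilters and limits along them\<close>

definition ultrafilter :: "'b filter \<Rightarrow> bool" where
  "ultrafilter p \<longleftrightarrow> p \<noteq> bot \<and> (\<forall>P. eventually P p \<or> eventually (\<lambda>x. \<not> P x) p)"

lemma ultrafilter_not_bot: "ultrafilter p \<Longrightarrow> p \<noteq> bot"
  by (simp add: ultrafilter_def)

lemma ultrafilter_cases: "ultrafilter p \<Longrightarrow> eventually P p \<or> eventually (\<lambda>x. \<not> P x) p"
  by (simp add: ultrafilter_def)

lemma ultrafilter_not_iff:
  "ultrafilter p \<Longrightarrow> eventually (\<lambda>x. \<not> P x) p \<longleftrightarrow> \<not> eventually P p"
  using eventually_conj[of P p "\<lambda>x. \<not> P x"] unfolding ultrafilter_def trivial_limit_def by auto

lemma ultrafilter_principal: "ultrafilter (principal {x})"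
  by (simp add: ultrafilter_def eventually_principal principal_eq_bot_iff)

lemma ultrafilter_filtermap: "ultrafilter p \<Longrightarrow> ultrafilter (filtermap f p)"
  by (auto simp: ultrafilter_def eventually_filtermap filtermap_bot_iff)

text \<open>Ultrafilters are the minimal proper filters: if neither a property nor its negation were eventually
  true, intersecting with the property would give a smaller proper filter.\<close>

lemma ultrafilter_below:
  fixes F :: "'b filter"
  assumes "F \<noteq> bot"
  obtains p where "ultrafilter p" "p \<le> F"
proof -
  define A where "A = {p. p \<noteq> bot \<and> p \<le> F}"
  have "\<exists>m\<in>A. \<forall>a\<in>A. m \<ge> a \<longrightarrow> a = m"
  proof (rule predicate_Zorn)
    show "partial_order_on A (relation_of (\<ge>) A)"
      by (rule partial_order_on_relation_ofI) auto
    fix C assume "C \<in> Chains (relation_of (\<ge>) A)"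
    then have CA: "C \<subseteq> A" and ch: "\<And>a b. a \<in> C \<Longrightarrow> b \<in> C \<Longrightarrow> a \<le> b \<or> b \<le> a"
      by (auto simp: Chains_def relation_of_def)
    show "\<exists>u\<in>A. \<forall>a\<in>C. a \<ge> u"
    proof (cases "C = {}")
      case True then show ?thesis using assms by (auto simp: A_def)
    next
      case False
      have ev: "eventually P (Inf C) \<longleftrightarrow> (\<exists>b\<in>C. eventually P b)" for P
        using ch by (intro eventually_Inf_base False) (metis inf.absorb1 inf.absorb2 order_refl)
      have "Inf C \<noteq> bot"
        using CA ev[of "\<lambda>_. False"] by (auto simp: A_def trivial_limit_def)
      moreover have "Inf C \<le> F"
        using False CA by (auto simp: A_def intro: Inf_lower2)
      ultimately show ?thesis by (auto simp: A_def intro: Inf_lower)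
    qed
  qed
  then obtain m where m: "m \<in> A" and mn: "\<And>a. a \<in> A \<Longrightarrow> a \<le> m \<Longrightarrow> a = m" by auto
  have "eventually P m \<or> eventually (\<lambda>x. \<not> P x) m" for P
  proof (cases "inf m (principal {x. P x}) = bot")
    case True
    then have "eventually (\<lambda>x. False) (inf m (principal {x. P x}))" by simp
    then show ?thesis by (auto simp: eventually_inf_principal elim: eventually_mono)
  next
    case False
    then have "inf m (principal {x. P x}) \<in> A" using m by (auto simp: A_def intro: le_infI1)
    from mn[OF this] have "inf m (principal {x. P x}) = m" by simp
    moreover have "eventually P (inf m (principal {x. P x}))" by (simp add: eventually_inf_principal)
    ultimately show ?thesis by simp
  qed
  with m have "ultrafilter m" "m \<le> F" by (auto simp: ultrafilter_def A_def)
  then show thesis by (rule that)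
qed

text \<open>If every point of the compact set had a neighbourhood that is eventually avoided, finitely many of
  these neighbourhoods would cover the set. Because the whole ultrafilter converges, iterated limits
  can be formed without passing to subnets.\<close>

lemma compactin_ultrafilter_limit:
  assumes "compactin X K" "ultrafilter p" "eventually (\<lambda>x. h x \<in> K) p"
  obtains k where "k \<in> K" "\<And>U. openin X U \<Longrightarrow> k \<in> U \<Longrightarrow> eventually (\<lambda>x. h x \<in> U) p"
proof -
  have "\<exists>k\<in>K. \<forall>U. openin X U \<and> k \<in> U \<longrightarrow> eventually (\<lambda>x. h x \<in> U) p"
  proof (rule ccontr)
    assume "\<not> ?thesis"
    then have *: "\<forall>k\<in>K. \<exists>U. openin X U \<and> k \<in> U \<and> eventually (\<lambda>x. h x \<notin> U) p"
      using ultrafilter_not_iff[OF assms(2)] by metis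
    define \<U> where "\<U> = {U. openin X U \<and> eventually (\<lambda>x. h x \<notin> U) p}"
    have "K \<subseteq> \<Union>\<U>" using * by (auto simp: \<U>_def)
    then obtain \<F> where \<F>: "finite \<F>" "\<F> \<subseteq> \<U>" "K \<subseteq> \<Union>\<F>"
      using compactinD[OF assms(1), of \<U>] by (auto simp: \<U>_def)
    have "eventually (\<lambda>x. \<forall>U\<in>\<F>. h x \<notin> U) p"
      using \<F> by (intro eventually_ball_finite) (auto simp: \<U>_def)
    with assms(3) have "eventually (\<lambda>x. False) p"
      by eventually_elim (use \<F> in auto)
    then show False using assms(2) by (simp add: ultrafilter_def)
  qed
  then show thesis using that by blast
qed

lemma ultrafilter_tendsto_Lim:
  fixes f :: "'b \<Rightarrow> complex"
  assumes "ultrafilter p" "eventually (\<lambda>x. norm (f x) \<le> M) p"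
  shows "(f \<longlongrightarrow> Lim p f) p"
proof -
  have 1: "compactin euclidean (cball (0::complex) M)" by simp
  have 2: "eventually (\<lambda>x. f x \<in> cball 0 M) p" using assms(2) by simp
  obtain k where "\<And>U. openin euclidean U \<Longrightarrow> k \<in> U \<Longrightarrow> eventually (\<lambda>x. f x \<in> U) p"
    using compactin_ultrafilter_limit[OF 1 assms(1) 2] by metis
  then have "(f \<longlongrightarrow> k) p" by (auto simp: tendsto_def)
  moreover from this have "Lim p f = k"
    using assms(1) by (intro tendsto_Lim) (simp_all add: ultrafilter_def)
  ultimately show ?thesis by simp
qed

lemma Lim_eqI: "ultrafilter p \<Longrightarrow> (f \<longlongrightarrow> l) p \<Longrightarrow> Lim p f = (l :: complex)"
  by (rule tendsto_Lim[OF ultrafilter_not_bot])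

lemma Lim_const: "ultrafilter p \<Longrightarrow> Lim p (\<lambda>x. c) = (c :: complex)"
  by (rule Lim_eqI) auto

lemma Lim_eventually_cong:
  "eventually (\<lambda>x. f x = g x) p \<Longrightarrow> Lim p f = Lim p (g :: _ \<Rightarrow> complex)"
  by (rule Lim_cong) auto

lemma Lim_dist_le:
  assumes "ultrafilter p" "eventually (\<lambda>x. norm (f x) \<le> M) p"
    "eventually (\<lambda>x. norm (f x - c) \<le> (e::real)) p"
  shows "norm (Lim p f - (c::complex)) \<le> e"
proof -
  have "((\<lambda>x. norm (f x - c)) \<longlongrightarrow> norm (Lim p f - c)) p"
    by (intro tendsto_norm tendsto_diff tendsto_const ultrafilter_tendsto_Lim[OF assms(1,2)])
  from tendsto_upperbound[OF this assms(3)] show ?thesis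
    using ultrafilter_not_bot[OF assms(1)] by blast
qed

lemma Lim_dist_ge:
  assumes "ultrafilter p" "eventually (\<lambda>x. norm (f x) \<le> M) p"
    "eventually (\<lambda>x. (e::real) \<le> norm (f x - c)) p"
  shows "e \<le> norm (Lim p f - (c::complex))"
proof -
  have "((\<lambda>x. norm (f x - c)) \<longlongrightarrow> norm (Lim p f - c)) p"
    by (intro tendsto_norm tendsto_diff tendsto_const ultrafilter_tendsto_Lim[OF assms(1,2)])
  from tendsto_lowerbound[OF this assms(3)] show ?thesis
    using ultrafilter_not_bot[OF assms(1)] by blast
qed

lemma Lim_norm_le:
  assumes "ultrafilter p" "eventually (\<lambda>x. norm (f x) \<le> M) p"
  shows "norm (Lim p f :: complex) \<le> M"
  using Lim_dist_le[of p f M 0 M] assms by simp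

lemma Lim_filtermap: "Lim (filtermap h p) f = Lim p (\<lambda>x. f (h x))"
  by (simp add: t2_space_class.Lim_def filterlim_filtermap)

lemma Lim_principal: "Lim (principal {x}) f = (f x :: complex)"
  by (intro Lim_eqI ultrafilter_principal) (auto simp: tendsto_def eventually_principal)

abbreviation inv_map :: "('a \<Rightarrow> 'b) \<Rightarrow> 'b \<Rightarrow> 'a" where
  "inv_map \<equiv> inv_into UNIV"

section \<open>A colouring game\<close>

text \<open>In the game below, round \<open>n\<close> reveals a word of \<open>n\<close> colours, and the player
  answers with one colour. The word of round \<open>i\<close> is \<open>\<kappa> i\<close>, of which only the first
  \<open>i\<close> colours are meaningful; hence the bound on the common prefix length \<open>m\<close>. The predicate
  says that no earlier word has a longer common prefix with \<open>w\<close> than the word of round \<open>j\<close>.\<close>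

definition closest_word :: "nat \<Rightarrow> (nat \<Rightarrow> bool) \<Rightarrow> (nat \<Rightarrow> nat \<Rightarrow> bool) \<Rightarrow> nat \<Rightarrow> bool" where
  "closest_word n w \<kappa> j \<longleftrightarrow> j < n \<and>
     (\<forall>i<n. \<forall>m\<le>i. (\<forall>k<m. w k = \<kappa> i k) \<longrightarrow> m \<le> j \<and> (\<forall>k<m. w k = \<kappa> j k))"

lemma closest_wordD:
  assumes "closest_word n w \<kappa> j" "i < n" "m \<le> i" "\<forall>k<m. w k = \<kappa> i k"
  shows "m \<le> j \<and> (\<forall>k<m. w k = \<kappa> j k)"
  using assms(1)[unfolded closest_word_def, THEN conjunct2, rule_format, OF assms(2-3)] assms(4) by blast

lemma closest_word_exists:
  assumes "n > 0" shows "\<exists>j. closest_word n w \<kappa> j"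
proof -
  define S where "S = {m. \<exists>i<n. m \<le> i \<and> (\<forall>k<m. w k = \<kappa> i k)}"
  have "S \<subseteq> {..<n}" by (auto simp: S_def)
  then have fin: "finite S" by (rule finite_subset) simp
  have "0 \<in> S" using assms by (auto simp: S_def)
  then have "Max S \<in> S" using fin by (intro Max_in) auto
  then obtain j where j: "j < n" "Max S \<le> j" "\<forall>k<Max S. w k = \<kappa> j k" by (auto simp: S_def)
  have "m \<le> j \<and> (\<forall>k<m. w k = \<kappa> j k)" if "i < n" "m \<le> i" "\<forall>k<m. w k = \<kappa> i k" for i m
  proof -
    have "m \<in> S" using that by (auto simp: S_def)
    then have "m \<le> Max S" using fin by simp
    then show ?thesis using j by auto
  qed
  then show ?thesis using j(1) unfolding closest_word_def by blast
qed

lemma closest_word_cong: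
  assumes "\<And>i. i < n \<Longrightarrow> \<kappa> i = \<kappa>' i" shows "closest_word n w \<kappa> j = closest_word n w \<kappa>' j"
  using assms by (simp add: closest_word_def cong: conj_cong)

text \<open>The player can enforce a large constant rectangle: infinitely many positions and infinitely many
  rounds in which the colour at the position equals the answer. The strategy is to answer the
  opposite of what was answered to the closest earlier word.

  To see that it works, let \<open>c\<close> be a limit of the words along an ultrafilter, so that every
  prefix of \<open>c\<close> occurs infinitely often. Suppose that one of the two answers were never given to
  words with the prefix of length \<open>m\<close> from round \<open>m\<close> on. Take two such rounds \<open>i < n\<close>
  whose words have this prefix. Then the closest word to that of round \<open>n\<close> has the prefix too, so
  it comes from a round after \<open>m\<close> as well and received the same answer, against the strategy. Hence
  both answers occur with every prefix of \<open>c\<close>, in particular the colour that occurs infinitely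
  often in \<open>c\<close>.\<close>

lemma colouring_game:
  fixes \<kappa> :: "nat \<Rightarrow> nat \<Rightarrow> bool" and s :: "nat \<Rightarrow> bool"
  assumes play: "\<And>n. n > 0 \<Longrightarrow> \<exists>j. closest_word n (\<kappa> n) \<kappa> j \<and> s n \<noteq> s j"
  obtains I N where "infinite I" "\<And>m. m \<le> N m" "\<And>k m. k \<in> I \<Longrightarrow> k < m \<Longrightarrow> \<kappa> (N m) k = s (N m)"
proof -
  obtain U :: "nat filter" where U: "ultrafilter U" "U \<le> sequentially"
    using ultrafilter_below[OF sequentially_bot] .
  define c where "c k = eventually (\<lambda>n. \<kappa> n k) U" for k
  have "eventually (\<lambda>n. \<kappa> n k = c k) U" for k
    using ultrafilter_cases[OF U(1), of "\<lambda>n. \<kappa> n k"]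
    by (cases "c k") (auto simp: c_def elim: eventually_mono)
  then have ev: "eventually (\<lambda>n. \<forall>k\<in>{..<m}. \<kappa> n k = c k) U" for m :: nat
    by (intro eventually_ball_finite) auto
  have large: "eventually (\<lambda>n. r \<le> n) U" for r :: nat
    using U(2) eventually_ge_at_top filter_leD by blast
  have late: "\<exists>n\<ge>r. \<forall>k<m. \<kappa> n k = c k" for r m :: nat
    using eventually_happens'[OF ultrafilter_not_bot[OF U(1)] eventually_conj[OF large[of r] ev[of m]]]
    by auto
  have both: "\<exists>n\<ge>m. (\<forall>k<m. \<kappa> n k = c k) \<and> s n = b" for m b
  proof (rule ccontr)
    assume "\<not> ?thesis"
    then have no: "s n \<noteq> b" if "n \<ge> m" "\<forall>k<m. \<kappa> n k = c k" for n using that by blast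
    obtain i where i: "i \<ge> m" "\<forall>k<m. \<kappa> i k = c k" using late by blast
    obtain n where n: "n \<ge> Suc i" "\<forall>k<m. \<kappa> n k = c k" using late by blast
    have "n > 0" using n(1) by simp
    from play[OF this] obtain j where j: "closest_word n (\<kappa> n) \<kappa> j" "s n \<noteq> s j" by blast
    have "\<forall>k<m. \<kappa> n k = \<kappa> i k" using i n by simp
    then have "m \<le> j \<and> (\<forall>k<m. \<kappa> n k = \<kappa> j k)"
      using i(1) n(1) by (intro closest_wordD[OF j(1)]) auto
    then have "s j \<noteq> b" using n by (intro no) auto
    moreover have "s n \<noteq> b" using n i by (intro no) auto
    ultimately show False using j(2) by simp
  qed
  have "infinite {k. c k = b} \<or> infinite {k. c k = (\<not> b)}" for b
  proof -
    have "{k. c k = b} \<union> {k. c k = (\<not> b)} = UNIV" by auto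
    then show ?thesis using infinite_UNIV_nat by (metis finite_UnI)
  qed
  then obtain b where b: "infinite {k. c k = b}" by blast
  from both[of _ b] obtain N where "\<And>m. m \<le> N m" "\<And>m. \<forall>k<m. \<kappa> (N m) k = c k" "\<And>m. s (N m) = b"
    by metis
  with b show thesis by (intro that[of "{k. c k = b}" N]) auto
qed

section \<open>Uniform continuity from exchangeable limits\<close>

text \<open>The ultrafilter form of Grothendieck's double limit criterion for relative weak compactness of
  the orbit of \<open>\<phi>\<close>. It is invariant under inversion in \<open>G\<close>, which makes all its
  consequences two-sided.\<close>

definition double_limit :: "('a \<Rightarrow> 'a) set \<Rightarrow> (('a \<Rightarrow> 'a) \<Rightarrow> complex) \<Rightarrow> bool" where
  "double_limit G \<phi> \<longleftrightarrow> (\<forall>p q. ultrafilter p \<longrightarrow> ultrafilter q \<longrightarrow>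
     eventually (\<lambda>g. g \<in> G) p \<longrightarrow> eventually (\<lambda>g. g \<in> G) q \<longrightarrow>
     Lim p (\<lambda>a. Lim q (\<lambda>b. \<phi> (a \<circ> b))) = Lim q (\<lambda>b. Lim p (\<lambda>a. \<phi> (a \<circ> b))))"

locale permutation_group =
  fixes G :: "('a \<Rightarrow> 'a) set"
  assumes id_in [simp]: "id \<in> G"
    and comp_in: "g \<in> G \<Longrightarrow> h \<in> G \<Longrightarrow> g \<circ> h \<in> G"
    and inv_in: "g \<in> G \<Longrightarrow> inv_map g \<in> G"
    and bij: "g \<in> G \<Longrightarrow> bij g"
begin

definition fixing :: "'a set \<Rightarrow> ('a \<Rightarrow> 'a) set" where
  "fixing A = {u \<in> G. \<forall>a\<in>A. u a = a}"

lemma fixing_in: "u \<in> fixing A \<Longrightarrow> u \<in> G" by (simp add: fixing_def)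

lemma inv_comp: "g \<in> G \<Longrightarrow> inv_map g \<circ> g = id"  and comp_inv: "g \<in> G \<Longrightarrow> g \<circ> inv_map g = id"
  using bij by (auto simp: bij_def inj_iff surj_iff)

lemma inv_apply [simp]: "g \<in> G \<Longrightarrow> inv_map g (g x) = x" and apply_inv [simp]: "g \<in> G \<Longrightarrow> g (inv_map g x) = x"
  using inv_comp comp_inv by (auto simp: fun_eq_iff)

lemma inv_inv: "g \<in> G \<Longrightarrow> inv_map (inv_map g) = g"
  using bij inv_inv_eq by blast

lemma inv_comp_distrib: "g \<in> G \<Longrightarrow> h \<in> G \<Longrightarrow> inv_map (g \<circ> h) = inv_map h \<circ> inv_map g"
  using bij o_inv_distrib by blast

lemma fixing_comp: "u \<in> fixing A \<Longrightarrow> v \<in> fixing A \<Longrightarrow> u \<circ> v \<in> fixing A"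
  by (auto simp: fixing_def comp_in)

lemma fixing_inv: "u \<in> fixing A \<Longrightarrow> inv_map u \<in> fixing A"
proof -
  assume u: "u \<in> fixing A"
  have "inv_map u a = a" if "a \<in> A" for a
  proof -
    have "u a = a" "u \<in> G" using u that by (auto simp: fixing_def)
    then show ?thesis using inv_apply[of u a] by argo
  qed
  with u show ?thesis by (simp add: fixing_def inv_in)
qed

lemma fixing_id: "id \<in> fixing A" by (simp add: fixing_def)

lemma fixing_mono: "A \<subseteq> B \<Longrightarrow> fixing B \<subseteq> fixing A" by (auto simp: fixing_def)

primrec partial_product :: "(nat \<Rightarrow> 'a \<Rightarrow> 'a) \<Rightarrow> nat \<Rightarrow> 'a \<Rightarrow> 'a" where
  "partial_product w 0 = id"
| "partial_product w (Suc n) = w n \<circ> partial_product w n"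

lemma partial_product_in: "(\<And>i. i < n \<Longrightarrow> w i \<in> G) \<Longrightarrow> partial_product w n \<in> G"
  by (induction n) (auto simp: comp_in)

lemma partial_product_cong:
  "(\<And>i. i < n \<Longrightarrow> w i = w' i) \<Longrightarrow> partial_product w n = partial_product w' n"
  by (induction n) auto

end

text \<open>The hypothesis \<open>continuous\<close> is continuity for the topology of pointwise convergence on a discrete
  set.\<close>

locale stable_function = permutation_group +
  fixes \<phi> :: "('a \<Rightarrow> 'a) \<Rightarrow> complex" and M :: real
  assumes bounded: "g \<in> G \<Longrightarrow> norm (\<phi> g) \<le> M"
    and double_limit: "double_limit G \<phi>"
    and continuous: "g \<in> G \<Longrightarrow> e > 0 \<Longrightarrow>
      \<exists>F. finite F \<and> (\<forall>g'\<in>G. (\<forall>x\<in>F. g' x = g x) \<longrightarrow> norm (\<phi> g' - \<phi> g) < e)"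
begin

lemma continuous_left:
  assumes "h \<in> G" "e > 0"
  obtains F where "finite F" "\<And>u. u \<in> fixing F \<Longrightarrow> norm (\<phi> (u \<circ> h) - \<phi> h) < e"
proof -
  obtain F where F: "finite F" "\<forall>g'\<in>G. (\<forall>x\<in>F. g' x = h x) \<longrightarrow> norm (\<phi> g' - \<phi> h) < e"
    using continuous assms by blast
  show thesis
    using F assms(1) by (intro that[of "h ` F"]) (auto simp: fixing_def comp_in)
qed

end

text \<open>One step of the construction in the next proof. The product is extended by \<open>factor\<close>, which is
  \<open>shift\<close> or the identity according to \<open>bit\<close>; all later factors fix \<open>support\<close>.\<close>

datatype 'a move =
  Move (factor: "'a \<Rightarrow> 'a") (shift: "'a \<Rightarrow> 'a") (point: "'a \<Rightarrow> 'a")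
    (support: "'a set") (bit: bool) (word: "nat \<Rightarrow> bool")

context stable_function begin

text \<open>A violation of uniform continuity yields group elements \<open>v\<close>, as close to the identity as
  desired, and \<open>h\<close> with \<open>\<phi> (v \<circ> h)\<close> far from \<open>\<phi> h\<close>. From these, build products
  \<open>g n\<close> of factors, each of which is either the identity or such a \<open>v\<close>, and test points
  \<open>b n\<close>, such that the values \<open>\<phi> (g k \<circ> b n)\<close> violate the double limit property.

  For \<open>k > n\<close> the value is almost \<open>\<phi> (v \<circ> h)\<close> or \<open>\<phi> h\<close>, depending on the choice
  of the \<open>n\<close>-th factor, because later factors are very close to the identity. For \<open>k < n\<close>
  the value was fixed before that choice, and it is far from at least one of the two candidates. The
  colouring game chooses the factors so that, for infinitely many \<open>k\<close> and \<open>n\<close>, the early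
  values are far from the candidate that was chosen.\<close>

lemma left_uniformly_continuous:
  assumes "e > 0"
  obtains A where "finite A" "\<And>u h. u \<in> fixing A \<Longrightarrow> h \<in> G \<Longrightarrow> norm (\<phi> (u \<circ> h) - \<phi> h) \<le> e"
proof (rule ccontr)
  assume contra: "\<not> thesis"
  note witness = that
  have bad: "\<exists>v\<in>fixing A. \<exists>h\<in>G. norm (\<phi> (v \<circ> h) - \<phi> h) > e" if "finite A" for A
  proof (rule ccontr)
    assume *: "\<not> ?thesis"
    have "thesis"
      by (rule witness[OF that]) (use * in \<open>auto simp: not_less\<close>)
    with contra show False by simp
  qed
  \<comment> \<open>The colour of position \<open>k\<close> in round \<open>n\<close>: whether the \<open>k\<close>-th value at the new test
    point is far from \<open>\<phi> (v \<circ> h)\<close>; otherwise it is far from \<open>\<phi> h\<close>.\<close>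
  define K where "K w v h n k = (e / 2 \<le> norm (\<phi> (partial_product w k \<circ> (inv_map (partial_product w n) \<circ> h)) - \<phi> (v \<circ> h)))"
    for w :: "nat \<Rightarrow> 'a \<Rightarrow> 'a" and v h :: "'a \<Rightarrow> 'a" and n k :: nat
  define P where "P f n r \<longleftrightarrow>
      shift r \<in> fixing (\<Union>j<n. support (f j)) \<and> point r \<in> G \<and>
      norm (\<phi> (shift r \<circ> point r) - \<phi> (point r)) > e \<and>
      factor r = (if bit r then shift r else id) \<and> finite (support r) \<and>
      (\<forall>u\<in>fixing (support r). norm (\<phi> (u \<circ> (factor r \<circ> point r)) - \<phi> (factor r \<circ> point r)) < e / 8) \<and>
      (\<forall>k<n. word r k = K (\<lambda>j. factor (f j)) (shift r) (point r) n k) \<and>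
      (n > 0 \<longrightarrow> (\<exists>j. closest_word n (word r) (\<lambda>i. word (f i)) j \<and> bit r \<noteq> bit (f j)))"
    for f :: "nat \<Rightarrow> 'a move" and n r
  have "\<exists>f. \<forall>n. P f n (f n)"
  proof (rule dependent_wf_choice[OF wf_less])
    fix f g :: "nat \<Rightarrow> 'a move" and n r
    assume eq: "\<And>z. (z, n) \<in> {(x, y). x < y} \<Longrightarrow> f z = g z"
    then have eq': "\<And>z. z < n \<Longrightarrow> f z = g z" by simp
    have pp: "partial_product (\<lambda>j. factor (f j)) k = partial_product (\<lambda>j. factor (g j)) k" if "k \<le> n" for k
      using that by (intro partial_product_cong) (simp add: eq')
    have K: "(\<forall>k<n. word r k = K (\<lambda>j. factor (f j)) (shift r) (point r) n k) \<longleftrightarrow>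
        (\<forall>k<n. word r k = K (\<lambda>j. factor (g j)) (shift r) (point r) n k)"
      by (simp add: K_def pp)
    have S: "(\<Union>j<n. support (f j)) = (\<Union>j<n. support (g j))"
      using eq' by auto
    have B: "(\<exists>j. closest_word n (word r) (\<lambda>i. word (f i)) j \<and> bit r \<noteq> bit (f j)) \<longleftrightarrow>
        (\<exists>j. closest_word n (word r) (\<lambda>i. word (g i)) j \<and> bit r \<noteq> bit (g j))"
    proof (rule ex_cong1)
      fix j
      have "closest_word n (word r) (\<lambda>i. word (f i)) j = closest_word n (word r) (\<lambda>i. word (g i)) j"
        by (rule closest_word_cong) (simp add: eq')
      moreover have "f j = g j" if "closest_word n (word r) (\<lambda>i. word (g i)) j"
        using that by (intro eq') (simp add: closest_word_def)
      ultimately show "closest_word n (word r) (\<lambda>i. word (f i)) j \<and> bit r \<noteq> bit (f j) \<longleftrightarrow>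
          closest_word n (word r) (\<lambda>i. word (g i)) j \<and> bit r \<noteq> bit (g j)" by auto
    qed
    show "P f n r = P g n r"
      unfolding P_def K S B ..
  next
    fix n and f :: "nat \<Rightarrow> 'a move"
    assume IH: "\<And>y. (y, n) \<in> {(x, y). x < y} \<Longrightarrow> P f y (f y)"
    then have "finite (support (f j))" if "j < n" for j
      using that by (simp add: P_def)
    then have "finite (\<Union>j<n. support (f j))" by auto
    from bad[OF this] obtain v h where
      v: "v \<in> fixing (\<Union>j<n. support (f j))" and h: "h \<in> G" "norm (\<phi> (v \<circ> h) - \<phi> h) > e"
      by auto
    define \<kappa> where "\<kappa> = K (\<lambda>j. factor (f j)) v h n"
    obtain s where s: "n > 0 \<longrightarrow> (\<exists>j. closest_word n \<kappa> (\<lambda>i. word (f i)) j \<and> s \<noteq> bit (f j))"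
    proof (cases "n > 0")
      case True
      then obtain j where "closest_word n \<kappa> (\<lambda>i. word (f i)) j" using closest_word_exists by blast
      then show thesis by (intro that[of "\<not> bit (f j)"]) blast
    qed simp
    define w where "w = (if s then v else id)"
    have "w \<circ> h \<in> G" using v h by (auto simp: w_def fixing_def comp_in)
    then obtain F where F: "finite F" "\<And>u. u \<in> fixing F \<Longrightarrow> norm (\<phi> (u \<circ> (w \<circ> h)) - \<phi> (w \<circ> h)) < e / 8"
      using continuous_left[of "w \<circ> h" "e/8"] assms by auto
    have "P f n (Move w v h F s \<kappa>)"
      unfolding P_def move.sel
      by (intro conjI v h F(1) s) (use F(2) in \<open>simp_all add: w_def \<kappa>_def\<close>)
    then show "\<exists>r. P f n r" ..
  qed
  then obtain f where f: "\<And>n. P f n (f n)" by blast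
  define w v h F s \<kappa> where "w = (\<lambda>n. factor (f n))" and "v = (\<lambda>n. shift (f n))"
    and "h = (\<lambda>n. point (f n))" and "F = (\<lambda>n. support (f n))"
    and "s = (\<lambda>n. bit (f n))" and "\<kappa> = (\<lambda>n. word (f n))"
  note P' = f[unfolded P_def]
  have v: "v n \<in> fixing (\<Union>j<n. F j)" for n using P'[of n] unfolding v_def F_def by blast
  have h: "h n \<in> G" for n using P'[of n] unfolding h_def by blast
  have vh: "norm (\<phi> (v n \<circ> h n) - \<phi> (h n)) > e" for n using P'[of n] unfolding v_def h_def by blast
  have w: "w n = (if s n then v n else id)" for n using P'[of n] unfolding v_def w_def s_def by blast
  have F: "norm (\<phi> (u \<circ> (w n \<circ> h n)) - \<phi> (w n \<circ> h n)) < e / 8" if "u \<in> fixing (F n)" for n u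
    using P'[of n] that unfolding w_def h_def F_def by blast
  have \<kappa>: "\<kappa> n k = K w (v n) (h n) n k" if "k < n" for n k
    using P'[of n] that unfolding w_def h_def v_def \<kappa>_def by blast
  have s: "\<exists>j. closest_word n (\<kappa> n) \<kappa> j \<and> s n \<noteq> s j" if "n > 0" for n
    using P'[of n] that unfolding s_def \<kappa>_def by blast
  have w_in: "w n \<in> fixing (\<Union>j<n. F j)" for n using v[of n] by (auto simp: w fixing_id)
  define g where "g = partial_product w"
  define b where "b n = inv_map (g n) \<circ> h n" for n
  have g_in: "g n \<in> G" for n unfolding g_def by (intro partial_product_in) (use w_in fixing_in in blast)
  have b_in: "b n \<in> G" for n unfolding b_def by (intro comp_in inv_in g_in h)
  have tail: "\<exists>u\<in>fixing (F n). g (Suc n + d) = u \<circ> (w n \<circ> g n)" for n d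
  proof (induction d)
    case 0 then show ?case using fixing_id by (auto simp: g_def intro!: bexI[of _ id])
  next
    case (Suc d)
    then obtain u where u: "u \<in> fixing (F n)" "g (Suc n + d) = u \<circ> (w n \<circ> g n)" by blast
    have "w (Suc n + d) \<in> fixing (F n)"
      using w_in[of "Suc n + d"] by (auto simp: fixing_def)
    moreover have "g (Suc n + Suc d) = (w (Suc n + d) \<circ> u) \<circ> (w n \<circ> g n)"
      using u(2) by (simp add: g_def o_assoc)
    ultimately show ?case using u(1) fixing_comp by blast
  qed
  have late: "norm (\<phi> (g k \<circ> b n) - \<phi> (w n \<circ> h n)) \<le> e / 8" if "n < k" for k n
  proof -
    from that obtain d where d: "k = Suc n + d" using less_iff_Suc_add by auto
    from tail[of n d] obtain u where u: "u \<in> fixing (F n)" "g k = u \<circ> (w n \<circ> g n)" by (auto simp: d)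
    have "g k \<circ> b n = u \<circ> (w n \<circ> h n)"
      by (auto simp: u b_def fun_eq_iff g_in)
    then show ?thesis using F[OF u(1)] by simp
  qed
  have early: "e / 2 \<le> norm (\<phi> (g k \<circ> b n) - \<phi> (w n \<circ> h n))" if "k < n" "\<kappa> n k = s n" for k n
  proof -
    have K: "\<kappa> n k = (e / 2 \<le> norm (\<phi> (g k \<circ> b n) - \<phi> (v n \<circ> h n)))"
      using \<kappa>[OF that(1)] by (simp add: K_def g_def b_def)
    show ?thesis
    proof (cases "s n")
      case True then show ?thesis using that K by (simp add: w)
    next
      case False
      then have "norm (\<phi> (g k \<circ> b n) - \<phi> (v n \<circ> h n)) < e / 2" using that K by simp
      moreover have "norm (\<phi> (v n \<circ> h n) - \<phi> (h n)) \<le> norm (\<phi> (g k \<circ> b n) - \<phi> (v n \<circ> h n)) + norm (\<phi> (g k \<circ> b n) - \<phi> (h n))"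
        by norm
      ultimately show ?thesis using vh[of n] False by (simp add: w)
    qed
  qed
  obtain I N where I: "infinite I" and N: "\<And>m. m \<le> N m" "\<And>k m. k \<in> I \<Longrightarrow> k < m \<Longrightarrow> \<kappa> (N m) k = s (N m)"
    using colouring_game[of \<kappa> s, OF s] by blast
  obtain U :: "nat filter" where U: "ultrafilter U" "U \<le> sequentially"
    using ultrafilter_below[OF sequentially_bot] .
  have "inf sequentially (principal I) \<noteq> bot"
    using I by (auto simp: trivial_limit_def eventually_inf_principal eventually_sequentially infinite_nat_iff_unbounded_le)
  then obtain V where V: "ultrafilter V" "V \<le> inf sequentially (principal I)" by (rule ultrafilter_below)
  have largeU: "eventually (\<lambda>n. r < n) U" for r :: nat
    by (rule filter_leD[OF U(2) eventually_gt_at_top])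
  have V': "V \<le> sequentially" "V \<le> principal I" using V(2) by simp_all
  have largeV: "eventually (\<lambda>n. r < n) V" for r :: nat
    by (rule filter_leD[OF V'(1) eventually_gt_at_top])
  have VI: "eventually (\<lambda>k. k \<in> I) V"
    by (rule filter_leD[OF V'(2)]) (simp add: eventually_principal)
  \<comment> \<open>The two iterated limits are compared through the limit of the chosen candidates.\<close>
  define c where "c = Lim U (\<lambda>m. \<phi> (w (N m) \<circ> h (N m)))"
  have wh_in: "w n \<circ> h n \<in> G" for n
    by (intro comp_in h fixing_in[OF w_in])
  have c: "((\<lambda>m. \<phi> (w (N m) \<circ> h (N m))) \<longlongrightarrow> c) U"
    unfolding c_def by (rule ultrafilter_tendsto_Lim[OF U(1), of _ M]) (simp add: bounded wh_in)
  have swap: "Lim V (\<lambda>k. Lim U (\<lambda>m. \<phi> (g k \<circ> b (N m)))) = Lim U (\<lambda>m. Lim V (\<lambda>k. \<phi> (g k \<circ> b (N m))))"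
    using double_limit[unfolded double_limit_def, rule_format, of "filtermap g V" "filtermap (\<lambda>m. b (N m)) U"] U V
    by (simp add: ultrafilter_filtermap eventually_filtermap g_in b_in Lim_filtermap)
  have bd: "norm (\<phi> (g k \<circ> b n)) \<le> M" for k n by (simp add: bounded comp_in g_in b_in)
  have far: "e / 2 \<le> norm (Lim U (\<lambda>m. \<phi> (g k \<circ> b (N m))) - c)" if "k \<in> I" for k
  proof -
    have "((\<lambda>m. norm (\<phi> (g k \<circ> b (N m)) - \<phi> (w (N m) \<circ> h (N m)))) \<longlongrightarrow> norm (Lim U (\<lambda>m. \<phi> (g k \<circ> b (N m))) - c)) U"
      by (intro tendsto_norm tendsto_diff c ultrafilter_tendsto_Lim[OF U(1), of _ M]) (simp add: bd)
    moreover have "eventually (\<lambda>m. e / 2 \<le> norm (\<phi> (g k \<circ> b (N m)) - \<phi> (w (N m) \<circ> h (N m)))) U"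
      using largeU[of k]
    proof eventually_elim
      case (elim m)
      then show ?case using N(1)[of m] N(2)[OF that] by (intro early) auto
    qed
    ultimately show ?thesis using tendsto_lowerbound ultrafilter_not_bot[OF U(1)] by blast
  qed
  have near: "norm (Lim V (\<lambda>k. \<phi> (g k \<circ> b n)) - \<phi> (w n \<circ> h n)) \<le> e / 8" for n
  proof (rule Lim_dist_le[OF V(1)])
    show "eventually (\<lambda>k. norm (\<phi> (g k \<circ> b n)) \<le> M) V" by (simp add: bd)
    show "eventually (\<lambda>k. norm (\<phi> (g k \<circ> b n) - \<phi> (w n \<circ> h n)) \<le> e / 8) V"
      using largeV[of n] by eventually_elim (rule late)
  qed
  have "e / 2 \<le> norm (Lim V (\<lambda>k. Lim U (\<lambda>m. \<phi> (g k \<circ> b (N m)))) - c)"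
  proof (rule Lim_dist_ge[OF V(1)])
    show "eventually (\<lambda>k. norm (Lim U (\<lambda>m. \<phi> (g k \<circ> b (N m)))) \<le> M) V"
      using Lim_norm_le[OF U(1)] bd by (intro always_eventually allI) auto
    show "eventually (\<lambda>k. e / 2 \<le> norm (Lim U (\<lambda>m. \<phi> (g k \<circ> b (N m))) - c)) V"
      using VI by eventually_elim (rule far)
  qed
  moreover have "norm (Lim U (\<lambda>m. Lim V (\<lambda>k. \<phi> (g k \<circ> b (N m)))) - c) \<le> e / 8"
  proof -
    have "((\<lambda>m. norm (Lim V (\<lambda>k. \<phi> (g k \<circ> b (N m))) - \<phi> (w (N m) \<circ> h (N m)))) \<longlongrightarrow>
        norm (Lim U (\<lambda>m. Lim V (\<lambda>k. \<phi> (g k \<circ> b (N m)))) - c)) U"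
      using Lim_norm_le[OF V(1)] bd
      by (intro tendsto_norm tendsto_diff c ultrafilter_tendsto_Lim[OF U(1), of _ M] always_eventually allI) auto
    from tendsto_upperbound[OF this always_eventually[OF allI[OF near]] ultrafilter_not_bot[OF U(1)]]
    show ?thesis .
  qed
  ultimately show False using swap assms by simp
qed

end

section \<open>Products of ultrafilters\<close>

text \<open>The multiplication of the right topological semigroup of ultrafilters: in a limit along
  \<open>p \<odot> q\<close>, the left factor is the outer limit.\<close>

definition filter_product :: "('a \<Rightarrow> 'a) filter \<Rightarrow> ('a \<Rightarrow> 'a) filter \<Rightarrow> ('a \<Rightarrow> 'a) filter"
    (infixl "\<odot>" 70) where
  "p \<odot> q = Abs_filter (\<lambda>P. eventually (\<lambda>a. eventually (\<lambda>b. P (a \<circ> b)) q) p)"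

lemma eventually_filter_product:
  "eventually P (p \<odot> q) \<longleftrightarrow> eventually (\<lambda>a. eventually (\<lambda>b. P (a \<circ> b)) q) p"
  unfolding filter_product_def
proof (rule eventually_Abs_filter, rule is_filter.intro)
  fix P Q :: "('a \<Rightarrow> 'a) \<Rightarrow> bool"
  assume "eventually (\<lambda>a. eventually (\<lambda>b. P (a \<circ> b)) q) p" "eventually (\<lambda>a. eventually (\<lambda>b. Q (a \<circ> b)) q) p"
  then show "eventually (\<lambda>a. eventually (\<lambda>b. P (a \<circ> b) \<and> Q (a \<circ> b)) q) p"
    by eventually_elim (rule eventually_conj)
next
  fix P Q :: "('a \<Rightarrow> 'a) \<Rightarrow> bool"
  assume PQ: "\<forall>x. P x \<longrightarrow> Q x" and "eventually (\<lambda>a. eventually (\<lambda>b. P (a \<circ> b)) q) p"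
  from this(2) show "eventually (\<lambda>a. eventually (\<lambda>b. Q (a \<circ> b)) q) p"
    by eventually_elim (use PQ in \<open>auto elim: eventually_mono\<close>)
qed simp

lemma filter_product_assoc: "p \<odot> q \<odot> r = p \<odot> (q \<odot> r)"
  by (simp add: filter_eq_iff eventually_filter_product o_assoc)

lemma ultrafilter_filter_product:
  assumes "ultrafilter p" "ultrafilter q" shows "ultrafilter (p \<odot> q)"
  unfolding ultrafilter_def trivial_limit_def eventually_filter_product
  using assms by (simp add: ultrafilter_not_iff) (metis ultrafilter_cases ultrafilter_not_iff eventually_mono)

lemma Lim_filter_product:
  assumes p: "ultrafilter p" and q: "ultrafilter q"
    and bd: "eventually (\<lambda>a. eventually (\<lambda>b. norm (f (a \<circ> b)) \<le> M) q) p"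
  shows "Lim (p \<odot> q) f = Lim p (\<lambda>a. Lim q (\<lambda>b. f (a \<circ> b)) :: complex)"
proof (rule sym, rule Lim_eqI[OF p], rule tendstoI)
  have lim: "(f \<longlongrightarrow> Lim (p \<odot> q) f) (p \<odot> q)"
    by (rule ultrafilter_tendsto_Lim[of _ _ M])
       (use assms in \<open>simp_all add: ultrafilter_filter_product eventually_filter_product\<close>)
  fix e :: real assume "e > 0"
  then have "eventually (\<lambda>g. dist (f g) (Lim (p \<odot> q) f) < e / 2) (p \<odot> q)"
    using lim tendstoD[of f _ _ "e/2"] by simp
  then have "eventually (\<lambda>a. eventually (\<lambda>b. dist (f (a \<circ> b)) (Lim (p \<odot> q) f) < e / 2) q) p"
    by (simp add: eventually_filter_product)
  with bd show "eventually (\<lambda>a. dist (Lim q (\<lambda>b. f (a \<circ> b))) (Lim (p \<odot> q) f) < e) p"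
  proof eventually_elim
    case (elim a)
    have "norm (Lim q (\<lambda>b. f (a \<circ> b)) - Lim (p \<odot> q) f) \<le> e / 2"
      by (rule Lim_dist_le[OF q elim(1)])
         (use elim(2) in \<open>auto simp: dist_norm elim: eventually_mono\<close>)
    then show ?case using \<open>e > 0\<close> by (simp add: dist_norm)
  qed
qed

context permutation_group begin

definition on_group :: "('a \<Rightarrow> 'a) filter \<Rightarrow> bool" where
  "on_group p \<longleftrightarrow> ultrafilter p \<and> eventually (\<lambda>g. g \<in> G) p"

lemma on_groupD: "on_group p \<Longrightarrow> ultrafilter p" "on_group p \<Longrightarrow> eventually (\<lambda>g. g \<in> G) p"
  by (simp_all add: on_group_def)

lemma on_group_product:
  assumes "on_group p" "on_group q" shows "on_group (p \<odot> q)"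
  unfolding on_group_def eventually_filter_product
proof
  show "ultrafilter (p \<odot> q)" using assms by (simp add: on_group_def ultrafilter_filter_product)
  from on_groupD(2)[OF assms(1)] show "eventually (\<lambda>a. eventually (\<lambda>b. a \<circ> b \<in> G) q) p"
  proof eventually_elim
    case (elim a)
    from on_groupD(2)[OF assms(2)] show ?case by eventually_elim (rule comp_in[OF elim])
  qed
qed

abbreviation pt :: "('a \<Rightarrow> 'a) \<Rightarrow> ('a \<Rightarrow> 'a) filter" where
  "pt g \<equiv> principal {g}"

lemma on_group_pt: "g \<in> G \<Longrightarrow> on_group (pt g)"
  by (simp add: on_group_def ultrafilter_principal eventually_principal)

lemma pt_product: "pt g \<odot> pt h = pt (g \<circ> h)"
  by (simp add: filter_eq_iff eventually_filter_product eventually_principal)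

lemma pt_left: "pt g \<odot> p = filtermap (\<lambda>u. g \<circ> u) p" and pt_right: "p \<odot> pt g = filtermap (\<lambda>u. u \<circ> g) p"
  by (simp_all add: filter_eq_iff eventually_filter_product eventually_principal eventually_filtermap)

lemma pt_id: "pt id \<odot> p = p" "p \<odot> pt id = p"
  by (simp_all add: filter_eq_iff eventually_filter_product eventually_principal)

end

context stable_function begin

lemma right_uniformly_continuous:
  assumes "e > 0"
  obtains A where "finite A" "\<And>u h. u \<in> fixing A \<Longrightarrow> h \<in> G \<Longrightarrow> norm (\<phi> (h \<circ> u) - \<phi> h) \<le> e"
proof -
  interpret inverse: stable_function G "\<lambda>g. \<phi> (inv_map g)" M
  proof
    show "norm (\<phi> (inv_map g)) \<le> M" if "g \<in> G" for g using that by (simp add: bounded inv_in)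
    show "double_limit G (\<lambda>g. \<phi> (inv_map g))"
      unfolding double_limit_def
    proof (intro allI impI)
      fix p q assume pq: "ultrafilter p" "ultrafilter q" "eventually (\<lambda>g. g \<in> G) p" "eventually (\<lambda>g. g \<in> G) q"
      have ev: "eventually (\<lambda>g. inv_map g \<in> G) p" "eventually (\<lambda>g. inv_map g \<in> G) q"
        using pq(3,4) by (auto elim!: eventually_mono simp: inv_in)
      have "Lim p (\<lambda>a. Lim q (\<lambda>b. \<phi> (inv_map (a \<circ> b)))) = Lim p (\<lambda>a. Lim q (\<lambda>b. \<phi> (inv_map b \<circ> inv_map a)))"
        using pq(3,4) by (intro Lim_eventually_cong, elim eventually_mono, intro Lim_eventually_cong, elim eventually_mono)
          (simp add: inv_comp_distrib)
      also have "\<dots> = Lim q (\<lambda>b. Lim p (\<lambda>a. \<phi> (inv_map b \<circ> inv_map a)))"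
        using double_limit[unfolded double_limit_def, rule_format, of "filtermap inv_map q" "filtermap inv_map p"] pq ev
        by (simp add: ultrafilter_filtermap eventually_filtermap Lim_filtermap)
      also have "\<dots> = Lim q (\<lambda>b. Lim p (\<lambda>a. \<phi> (inv_map (a \<circ> b))))"
        using pq(3,4) by (intro Lim_eventually_cong, elim eventually_mono, intro Lim_eventually_cong, elim eventually_mono)
          (simp add: inv_comp_distrib)
      finally show "Lim p (\<lambda>a. Lim q (\<lambda>b. \<phi> (inv_map (a \<circ> b)))) = Lim q (\<lambda>b. Lim p (\<lambda>a. \<phi> (inv_map (a \<circ> b))))" .
    qed
    fix g and e :: real assume g: "g \<in> G" and "e > 0"
    then obtain F where F: "finite F" "\<forall>g'\<in>G. (\<forall>x\<in>F. g' x = inv_map g x) \<longrightarrow> norm (\<phi> g' - \<phi> (inv_map g)) < e"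
      using continuous[of "inv_map g" e] inv_in by blast
    have "norm (\<phi> (inv_map g') - \<phi> (inv_map g)) < e"
      if g': "g' \<in> G" "\<forall>x\<in>inv_map g ` F. g' x = g x" for g'
    proof (rule F(2)[rule_format])
      fix x assume "x \<in> F"
      then have "g' (inv_map g x) = x" using g' g by simp
      then show "inv_map g' x = inv_map g x" using inv_apply[OF g'(1), of "inv_map g x"] by simp
    qed (simp add: inv_in g')
    with F(1) show "\<exists>F. finite F \<and> (\<forall>g'\<in>G. (\<forall>x\<in>F. g' x = g x) \<longrightarrow> norm (\<phi> (inv_map g') - \<phi> (inv_map g)) < e)"
      by (intro exI[of _ "inv_map g ` F"]) blast
  qed
  obtain A where A: "finite A"
    "\<And>u h. u \<in> fixing A \<Longrightarrow> h \<in> G \<Longrightarrow> norm (\<phi> (inv_map (u \<circ> h)) - \<phi> (inv_map h)) \<le> e"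
    using inverse.left_uniformly_continuous[OF assms] by blast
  show thesis
  proof (rule that[OF A(1)])
    fix u h assume u: "u \<in> fixing A" and h: "h \<in> G"
    have "norm (\<phi> (inv_map (inv_map u \<circ> inv_map h)) - \<phi> (inv_map (inv_map h))) \<le> e"
      using u h by (intro A(2) fixing_inv inv_in)
    then show "norm (\<phi> (h \<circ> u) - \<phi> h) \<le> e"
      using u h fixing_in[OF u] by (simp add: inv_comp_distrib inv_inv inv_in)
  qed
qed

text \<open>Two ultrafilters are equivalent if no two-sided translate of \<open>\<phi>\<close> separates them. The classes play
  the part of the points of the semigroup compactification generated by \<open>\<phi>\<close>.\<close>

definition equiv (infix "\<simeq>" 50) where
  "p \<simeq> q \<longleftrightarrow> (\<forall>x\<in>G. \<forall>y\<in>G. Lim p (\<lambda>u. \<phi> (x \<circ> u \<circ> y)) = Lim q (\<lambda>u. \<phi> (x \<circ> u \<circ> y)))"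

lemma equiv_refl [simp]: "p \<simeq> p" by (simp add: equiv_def)
lemma equiv_sym: "p \<simeq> q \<Longrightarrow> q \<simeq> p" by (simp add: equiv_def)
lemma equiv_trans [trans]: "p \<simeq> q \<Longrightarrow> q \<simeq> r \<Longrightarrow> p \<simeq> r" by (simp add: equiv_def)

lemma equivD:
  assumes "p \<simeq> q" "x \<in> G"
  shows "Lim p (\<lambda>u. \<phi> (x \<circ> u)) = Lim q (\<lambda>u. \<phi> (x \<circ> u))"
  using assms(1)[unfolded equiv_def, rule_format, OF assms(2) id_in] by simp

lemma bounded_translate:
  assumes "on_group p" "x \<in> G" "y \<in> G"
  shows "eventually (\<lambda>u. norm (\<phi> (x \<circ> u \<circ> y)) \<le> M) p"
  using on_groupD(2)[OF assms(1)] by eventually_elim (simp add: bounded comp_in assms)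

lemma Lim_translate_product:
  assumes "on_group p" "on_group q" "x \<in> G" "y \<in> G"
  shows "Lim (p \<odot> q) (\<lambda>u. \<phi> (x \<circ> u \<circ> y)) = Lim p (\<lambda>a. Lim q (\<lambda>b. \<phi> (x \<circ> (a \<circ> b) \<circ> y)))"
proof (rule Lim_filter_product)
  show "eventually (\<lambda>a. eventually (\<lambda>b. norm (\<phi> (x \<circ> (a \<circ> b) \<circ> y)) \<le> M) q) p"
    using bounded_translate[OF on_group_product[OF assms(1,2)] assms(3,4)]
    by (simp add: eventually_filter_product)
qed (use assms in \<open>simp_all add: on_group_def\<close>)

lemma Lim_translate_swap:
  assumes "on_group p" "on_group q" "x \<in> G" "y \<in> G"
  shows "Lim p (\<lambda>a. Lim q (\<lambda>b. \<phi> (x \<circ> (a \<circ> b) \<circ> y))) = Lim q (\<lambda>b. Lim p (\<lambda>a. \<phi> (x \<circ> (a \<circ> b) \<circ> y)))"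
proof -
  have "eventually (\<lambda>a. x \<circ> a \<in> G) p" "eventually (\<lambda>b. b \<circ> y \<in> G) q"
    using assms by (auto simp: on_group_def comp_in elim!: eventually_mono)
  then show ?thesis
    using double_limit[unfolded double_limit_def, rule_format, of "filtermap (\<lambda>a. x \<circ> a) p" "filtermap (\<lambda>b. b \<circ> y) q"] assms
    by (simp add: on_group_def ultrafilter_filtermap eventually_filtermap Lim_filtermap o_assoc)
qed

lemma equiv_product_right:
  assumes "q \<simeq> q'" "on_group p" "on_group q" "on_group q'"
  shows "p \<odot> q \<simeq> p \<odot> q'"
  unfolding equiv_def
proof (intro ballI)
  fix x y assume xy: "x \<in> G" "y \<in> G"
  have "eventually (\<lambda>a. Lim q (\<lambda>b. \<phi> (x \<circ> (a \<circ> b) \<circ> y)) = Lim q' (\<lambda>b. \<phi> (x \<circ> (a \<circ> b) \<circ> y))) p"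
    using on_groupD(2)[OF assms(2)]
  proof eventually_elim
    case (elim a)
    then show ?case using assms(1) xy comp_in[OF xy(1) elim] by (simp add: equiv_def o_assoc)
  qed
  then show "Lim (p \<odot> q) (\<lambda>u. \<phi> (x \<circ> u \<circ> y)) = Lim (p \<odot> q') (\<lambda>u. \<phi> (x \<circ> u \<circ> y))"
    using assms xy by (simp add: Lim_translate_product) (rule Lim_eventually_cong)
qed

text \<open>The left factor is the outer limit; the double limit property moves it inside, where the hypothesis
  on it applies.\<close>

lemma equiv_product_left:
  assumes "p \<simeq> p'" "on_group q" "on_group p" "on_group p'"
  shows "p \<odot> q \<simeq> p' \<odot> q"
  unfolding equiv_def
proof (intro ballI)
  fix x y assume xy: "x \<in> G" "y \<in> G"
  have "eventually (\<lambda>b. Lim p (\<lambda>a. \<phi> (x \<circ> (a \<circ> b) \<circ> y)) = Lim p' (\<lambda>a. \<phi> (x \<circ> (a \<circ> b) \<circ> y))) q"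
    using on_groupD(2)[OF assms(2)]
  proof eventually_elim
    case (elim b)
    have "Lim p (\<lambda>a. \<phi> (x \<circ> a \<circ> (b \<circ> y))) = Lim p' (\<lambda>a. \<phi> (x \<circ> a \<circ> (b \<circ> y)))"
      using assms(1) xy comp_in[OF elim xy(2)] by (simp add: equiv_def)
    then show ?case by (simp add: o_assoc)
  qed
  then have "Lim q (\<lambda>b. Lim p (\<lambda>a. \<phi> (x \<circ> (a \<circ> b) \<circ> y))) = Lim q (\<lambda>b. Lim p' (\<lambda>a. \<phi> (x \<circ> (a \<circ> b) \<circ> y)))"
    by (rule Lim_eventually_cong)
  then show "Lim (p \<odot> q) (\<lambda>u. \<phi> (x \<circ> u \<circ> y)) = Lim (p' \<odot> q) (\<lambda>u. \<phi> (x \<circ> u \<circ> y))"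
    using assms xy by (simp add: Lim_translate_product Lim_translate_swap)
qed

lemma product_absorb_right:
  assumes "on_group p" "on_group q" "eventually (\<lambda>v. p \<odot> pt v \<simeq> p) q"
  shows "p \<odot> q \<simeq> p"
  unfolding equiv_def
proof (intro ballI)
  fix x y assume xy: "x \<in> G" "y \<in> G"
  have "eventually (\<lambda>b. Lim p (\<lambda>a. \<phi> (x \<circ> (a \<circ> b) \<circ> y)) = Lim p (\<lambda>a. \<phi> (x \<circ> a \<circ> y))) q"
    using assms(3) by eventually_elim (use xy in \<open>simp add: equiv_def pt_right Lim_filtermap\<close>)
  then have "Lim q (\<lambda>b. Lim p (\<lambda>a. \<phi> (x \<circ> (a \<circ> b) \<circ> y))) = Lim q (\<lambda>b. Lim p (\<lambda>a. \<phi> (x \<circ> a \<circ> y)))"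
    by (rule Lim_eventually_cong)
  then show "Lim (p \<odot> q) (\<lambda>u. \<phi> (x \<circ> u \<circ> y)) = Lim p (\<lambda>u. \<phi> (x \<circ> u \<circ> y))"
    using assms(1,2) xy by (simp add: Lim_translate_product Lim_translate_swap Lim_const on_groupD)
qed

lemma product_absorb_left:
  assumes "on_group p" "on_group q" "eventually (\<lambda>v. pt v \<odot> p \<simeq> p) q"
  shows "q \<odot> p \<simeq> p"
  unfolding equiv_def
proof (intro ballI)
  fix x y assume xy: "x \<in> G" "y \<in> G"
  have "eventually (\<lambda>b. Lim p (\<lambda>a. \<phi> (x \<circ> (b \<circ> a) \<circ> y)) = Lim p (\<lambda>a. \<phi> (x \<circ> a \<circ> y))) q"
    using assms(3) by eventually_elim (use xy in \<open>simp add: equiv_def pt_left Lim_filtermap\<close>)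
  then have "Lim q (\<lambda>b. Lim p (\<lambda>a. \<phi> (x \<circ> (b \<circ> a) \<circ> y))) = Lim q (\<lambda>b. Lim p (\<lambda>a. \<phi> (x \<circ> a \<circ> y)))"
    by (rule Lim_eventually_cong)
  then show "Lim (q \<odot> p) (\<lambda>u. \<phi> (x \<circ> u \<circ> y)) = Lim p (\<lambda>u. \<phi> (x \<circ> u \<circ> y))"
    using assms(1,2) xy by (simp add: Lim_translate_product Lim_const on_groupD)
qed

section \<open>Absorbing ultrafilters on pointwise stabilizers\<close>

text \<open>In the compactification of the pointwise stabilizer of \<open>A\<close>, an absorbing ultrafilter is a zero
  element. A zero element of a semigroup is unique and idempotent; in particular it does not depend
  on how it was constructed.\<close>

definition absorbing :: "'a set \<Rightarrow> ('a \<Rightarrow> 'a) filter \<Rightarrow> bool" where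
  "absorbing A p \<longleftrightarrow> ultrafilter p \<and> eventually (\<lambda>u. u \<in> fixing A) p \<and>
     (\<forall>v\<in>fixing A. pt v \<odot> p \<simeq> p \<and> p \<odot> pt v \<simeq> p)"

lemma absorbing_on_group: "absorbing A p \<Longrightarrow> on_group p"
  unfolding absorbing_def on_group_def by (auto simp: fixing_def elim: eventually_mono)

lemma absorbing_product:
  assumes "absorbing A p" "absorbing B q" "A \<subseteq> B"
  shows "p \<odot> q \<simeq> p" "q \<odot> p \<simeq> p"
proof -
  have "eventually (\<lambda>v. v \<in> fixing A) q"
    using assms(2) fixing_mono[OF assms(3)] by (auto simp: absorbing_def elim: eventually_mono)
  then have "eventually (\<lambda>v. p \<odot> pt v \<simeq> p) q" "eventually (\<lambda>v. pt v \<odot> p \<simeq> p) q"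
    using assms(1) by (auto simp: absorbing_def elim: eventually_mono)
  then show "p \<odot> q \<simeq> p" "q \<odot> p \<simeq> p"
    using assms absorbing_on_group by (blast intro: product_absorb_left product_absorb_right)+
qed

lemma absorbing_unique: "absorbing A p \<Longrightarrow> absorbing A q \<Longrightarrow> p \<simeq> q"
  using absorbing_product[of A p A q] absorbing_product[of A q A p] equiv_sym equiv_trans by blast

lemma absorbing_conjugate:
  assumes p: "absorbing A p" and g: "g \<in> G"
  shows "absorbing (g ` A) (pt g \<odot> p \<odot> pt (inv_map g))"
proof -
  note og = on_group_pt[OF g] on_group_pt[OF inv_in[OF g]] absorbing_on_group[OF p]
  let ?c = "pt g \<odot> p \<odot> pt (inv_map g)"
  have conj: "inv_map g \<circ> v \<circ> g \<in> fixing A" if "v \<in> fixing (g ` A)" for v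
    using that g by (auto simp: fixing_def comp_in inv_in)
  have "eventually (\<lambda>u. u \<in> fixing A) p" using p by (simp add: absorbing_def)
  then have "eventually (\<lambda>u. g \<circ> u \<circ> inv_map g \<in> fixing (g ` A)) p"
    by eventually_elim (use g in \<open>auto simp: fixing_def comp_in inv_in\<close>)
  then have "eventually (\<lambda>u. u \<in> fixing (g ` A)) ?c"
    by (simp add: eventually_filter_product eventually_principal)
  moreover have "pt v \<odot> ?c \<simeq> ?c" "?c \<odot> pt v \<simeq> ?c" if v: "v \<in> fixing (g ` A)" for v
  proof -
    have v': "v \<in> G" "inv_map g \<circ> v \<circ> g \<in> G" using v conj fixing_in by blast+
    have vg: "v \<circ> g = g \<circ> (inv_map g \<circ> v \<circ> g)" "inv_map g \<circ> v = (inv_map g \<circ> v \<circ> g) \<circ> inv_map g"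
      using g by (auto simp: fun_eq_iff)
    have "pt v \<odot> ?c = pt g \<odot> (pt (inv_map g \<circ> v \<circ> g) \<odot> p) \<odot> pt (inv_map g)"
      using pt_product[of v g] pt_product[of g "inv_map g \<circ> v \<circ> g"] vg(1)
      by (metis filter_product_assoc)
    also have "\<dots> \<simeq> ?c"
      using conj[OF v] p v' og g inv_in[OF g]
      by (intro equiv_product_left equiv_product_right on_group_product on_group_pt) (auto simp: absorbing_def)
    finally show "pt v \<odot> ?c \<simeq> ?c" .
    have "?c \<odot> pt v = pt g \<odot> (p \<odot> pt (inv_map g \<circ> v \<circ> g)) \<odot> pt (inv_map g)"
      using pt_product[of "inv_map g" v] pt_product[of "inv_map g \<circ> v \<circ> g" "inv_map g"] vg(2)
      by (metis filter_product_assoc)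
    also have "\<dots> \<simeq> ?c"
      using conj[OF v] p v' og g inv_in[OF g]
      by (intro equiv_product_left equiv_product_right on_group_product on_group_pt) (auto simp: absorbing_def)
    finally show "?c \<odot> pt v \<simeq> ?c" .
  qed
  ultimately show ?thesis
    using on_groupD(1)[OF on_group_product[OF on_group_product[OF og(1,3)] og(2)]]
    unfolding absorbing_def by blast
qed

end

section \<open>Calculus of absorbing ultrafilters\<close>

text \<open>The axiom \<open>exchange\<close> makes products of the \<open>e A\<close> correspond to intersections; the axiom
  \<open>factorization\<close> lets the zero of the compactification absorb all of \<open>G\<close>, because it absorbs
  the stabilizers of points.\<close>

locale absorbing_system = stable_function +
  fixes e :: "'a set \<Rightarrow> ('a \<Rightarrow> 'a) filter"
  assumes infinite: "infinite (UNIV :: 'a set)"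
    and absorbing_e: "finite A \<Longrightarrow> A \<noteq> {} \<Longrightarrow> absorbing A (e A)"
    and exchange: "finite C \<Longrightarrow> C \<noteq> {} \<Longrightarrow> a \<notin> C \<Longrightarrow> b \<notin> C \<Longrightarrow> a \<noteq> b \<Longrightarrow>
      e (insert a C) \<odot> e (insert b C) \<simeq> e C"
    and factorization: "g \<in> G \<Longrightarrow> \<exists>b c h k. h \<in> fixing {b} \<and> k \<in> fixing {c} \<and> g = h \<circ> k"
begin

lemma on_group_e: "finite A \<Longrightarrow> A \<noteq> {} \<Longrightarrow> on_group (e A)"
  by (rule absorbing_on_group[OF absorbing_e])

lemma absorb:
  assumes "A \<subseteq> B" "finite B" "A \<noteq> {}"
  shows "e A \<odot> e B \<simeq> e A" "e B \<odot> e A \<simeq> e A"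
  using absorbing_product[of A "e A" B "e B"] absorbing_e assms finite_subset by blast+

text \<open>The elements of \<open>B\<close> are removed one at a time: a factor \<open>e (insert a (A \<union> B))\<close> can be inserted
  for free, and it cancels the new point by \<open>exchange\<close>.\<close>

lemma product_exchange_many:
  assumes "finite A" "A \<noteq> {}" "a \<notin> A" "finite B" "B \<inter> insert a A = {}"
  shows "e (insert a A) \<odot> e (A \<union> B) \<simeq> e A"
  using assms(4,5)
proof (induction B)
  case empty
  then show ?case using absorb[of A "insert a A"] assms by auto
next
  case (insert b B)
  let ?E = "insert a (A \<union> B)"
  have og: "on_group (e (insert a A))" "on_group (e ?E)" "on_group (e (A \<union> insert b B))" "on_group (e (A \<union> B))"
    using assms insert by (auto intro!: on_group_e)
  have "e (insert a A) \<odot> e (A \<union> insert b B) \<simeq> e (insert a A) \<odot> e ?E \<odot> e (A \<union> insert b B)"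
    using og absorb(1)[of "insert a A" ?E] assms insert
    by (intro equiv_product_left equiv_sym[OF absorb(1)] on_group_product) auto
  also have "\<dots> = e (insert a A) \<odot> (e (insert a (A \<union> B)) \<odot> e (insert b (A \<union> B)))"
    by (simp add: filter_product_assoc)
  also have "\<dots> \<simeq> e (insert a A) \<odot> e (A \<union> B)"
    using og exchange[of "A \<union> B" a b] assms insert
    by (intro equiv_product_right on_group_product) auto
  also have "\<dots> \<simeq> e A" using insert by auto
  finally show ?case .
qed

text \<open>Insert the factor \<open>e\<close> of all points of \<open>A \<union> B\<close> except \<open>a\<close>, which the right
  factor absorbs; then the left factor loses \<open>a\<close>.\<close>

lemma product_remove_left:
  assumes "finite A" "finite B" "B \<noteq> {}" "a \<in> A" "a \<notin> B" "A - {a} \<noteq> {}"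
  shows "e A \<odot> e B \<simeq> e (A - {a}) \<odot> e B"
proof -
  let ?D = "(A - {a}) \<union> B"
  have og: "on_group (e A)" "on_group (e B)" "on_group (e ?D)" "on_group (e (A - {a}))"
    using assms by (auto intro!: on_group_e)
  have "e A \<odot> e B \<simeq> e A \<odot> (e ?D \<odot> e B)"
    using og assms by (intro equiv_product_right equiv_sym[OF absorb(2)] on_group_product) auto
  also have "\<dots> = (e A \<odot> e ?D) \<odot> e B" by (simp add: filter_product_assoc)
  also have "\<dots> \<simeq> e (A - {a}) \<odot> e B"
  proof (intro equiv_product_left og on_group_product)
    have "insert a (A - {a}) = A" "(A - {a}) \<union> (B - A) = ?D" using assms by auto
    then show "e A \<odot> e ?D \<simeq> e (A - {a})"
      using product_exchange_many[of "A - {a}" a "B - A"] assms by auto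
  qed
  finally show ?thesis .
qed

lemma product_remove_many:
  assumes "finite S" "finite A" "finite B" "A \<noteq> {}" "B \<noteq> {}" "S \<inter> A = {}" "S \<inter> B = {}"
  shows "e (A \<union> S) \<odot> e B \<simeq> e A \<odot> e B"
  using assms(1,6,7)
proof (induction S)
  case (insert s S)
  have "A \<union> insert s S - {s} = A \<union> S" using insert by auto
  then have "e (A \<union> insert s S) \<odot> e B \<simeq> e (A \<union> S) \<odot> e B"
    using product_remove_left[of "A \<union> insert s S" B s] insert assms by auto
  also have "\<dots> \<simeq> e A \<odot> e B" using insert by auto
  finally show ?case .
qed simp

lemma product_meet:
  assumes "finite A" "finite B" "A \<inter> B \<noteq> {}"
  shows "e A \<odot> e B \<simeq> e (A \<inter> B)"
proof -
  have "e ((A \<inter> B) \<union> (A - B)) \<odot> e B \<simeq> e (A \<inter> B) \<odot> e B"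
    using assms by (intro product_remove_many) auto
  also have "\<dots> \<simeq> e (A \<inter> B)" using assms by (intro absorb) auto
  finally show ?thesis by (simp add: Un_commute Un_Diff_Int Int_Diff_Un)
qed

text \<open>The left set shrinks to a point by removal. The right set shrinks because
  \<open>e {a, b}\<close> is absorbed by \<open>e {a}\<close> on its left, and its product with \<open>e B\<close> is \<open>e {b}\<close>.\<close>

lemma product_disjoint:
  assumes "finite A" "finite B" "A \<inter> B = {}" "a \<in> A" "b \<in> B"
  shows "e A \<odot> e B \<simeq> e {a} \<odot> e {b}"
proof -
  have og: "on_group (e {a})" "on_group (e {a,b})" "on_group (e {b})" "on_group (e B)"
    using assms by (auto intro!: on_group_e)
  have "{a} \<union> (A - {a}) = A" using assms by auto
  then have "e A \<odot> e B \<simeq> e {a} \<odot> e B"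
    using product_remove_many[of "A - {a}" "{a}" B] assms by auto
  also have "\<dots> \<simeq> (e {a} \<odot> e {a,b}) \<odot> e B"
    using og by (intro equiv_product_left equiv_sym[OF absorb(1)] on_group_product) auto
  also have "\<dots> = e {a} \<odot> (e {a,b} \<odot> e B)" by (simp add: filter_product_assoc)
  also have "\<dots> \<simeq> e {a} \<odot> e {b}"
  proof (intro equiv_product_right og on_group_product)
    have "{a,b} \<inter> B = {b}" using assms by auto
    then show "e {a,b} \<odot> e B \<simeq> e {b}" using product_meet[of "{a,b}" B] assms by auto
  qed
  finally show ?thesis .
qed

text \<open>The common value of these products is the zero of the whole compactification; it plays the part of
  an absorbing ultrafilter for the empty set. The step from one pair to another goes through a third
  point, changing one factor at a time.\<close>

lemma zero_unique:
  assumes "a \<noteq> b" "c \<noteq> d"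
  shows "e {a} \<odot> e {b} \<simeq> e {c} \<odot> e {d}"
proof -
  obtain x where x: "x \<notin> {a,b,c,d}" using infinite ex_new_if_finite by (metis finite.emptyI finite_insert)
  have right: "e {a} \<odot> e {b} \<simeq> e {a} \<odot> e {c}" if "a \<noteq> b" "a \<noteq> c" for a b c
    by (rule equiv_trans[OF equiv_sym[OF product_disjoint[of "{a}" "{b,c}"]] product_disjoint]) (use that in auto)
  have left: "e {a} \<odot> e {c} \<simeq> e {b} \<odot> e {c}" if "a \<noteq> c" "b \<noteq> c" for a b c
    by (rule equiv_trans[OF equiv_sym[OF product_disjoint[of "{a,b}" "{c}"]] product_disjoint]) (use that in auto)
  have "e {a} \<odot> e {b} \<simeq> e {a} \<odot> e {x}" using right assms x by auto
  also have "\<dots> \<simeq> e {c} \<odot> e {x}" using left x by auto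
  also have "\<dots> \<simeq> e {c} \<odot> e {d}" using right assms x by auto
  finally show ?thesis .
qed

lemma zero_invariant:
  assumes "a \<noteq> b" "g \<in> G"
  shows "pt g \<odot> (e {a} \<odot> e {b}) \<simeq> e {a} \<odot> e {b}"
proof -
  have og: "on_group (e {x})" for x by (intro on_group_e) auto
  have stab: "pt h \<odot> (e {a} \<odot> e {b}) \<simeq> e {a} \<odot> e {b}" if h: "h \<in> fixing {c}" for h c
  proof -
    note oh = on_group_pt[OF fixing_in[OF h]]
    obtain d where d: "d \<noteq> c" using assms(1) by metis
    have "pt h \<odot> (e {a} \<odot> e {b}) \<simeq> pt h \<odot> (e {c} \<odot> e {d})"
      using zero_unique[of a b c d] assms d by (intro equiv_product_right oh on_group_product og) auto
    also have "\<dots> = (pt h \<odot> e {c}) \<odot> e {d}" by (simp add: filter_product_assoc)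
    also have "\<dots> \<simeq> e {c} \<odot> e {d}"
      using absorbing_e[of "{c}"] h by (intro equiv_product_left og oh on_group_product) (auto simp: absorbing_def)
    also have "\<dots> \<simeq> e {a} \<odot> e {b}" using zero_unique assms d by auto
    finally show ?thesis .
  qed
  obtain x y h k where hk: "h \<in> fixing {x}" "k \<in> fixing {y}" "g = h \<circ> k"
    using factorization[OF assms(2)] by blast
  note o = on_group_pt[OF fixing_in[OF hk(1)]] on_group_pt[OF fixing_in[OF hk(2)]]
  have "pt g \<odot> (e {a} \<odot> e {b}) = pt h \<odot> (pt k \<odot> (e {a} \<odot> e {b}))"
    by (simp add: hk(3) pt_product[symmetric] filter_product_assoc)
  also have "\<dots> \<simeq> pt h \<odot> (e {a} \<odot> e {b})"
    using stab[OF hk(2)] by (intro equiv_product_right o on_group_product og)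
  also have "\<dots> \<simeq> e {a} \<odot> e {b}" using stab[OF hk(1)] .
  finally show ?thesis .
qed

text \<open>Conjugating \<open>e A\<close> by \<open>g\<close> gives an absorbing ultrafilter for the translated set.\<close>

lemma compress:
  assumes "finite A" "A \<noteq> {}" "g \<in> G"
  shows "e A \<odot> pt g \<odot> e A \<simeq> pt g \<odot> (e (inv_map g ` A) \<odot> e A)"
proof -
  define c where "c = pt (inv_map g) \<odot> e A \<odot> pt g"
  have "absorbing (inv_map g ` A) (pt (inv_map g) \<odot> e A \<odot> pt (inv_map (inv_map g)))"
    using assms by (intro absorbing_conjugate absorbing_e inv_in)
  then have k: "absorbing (inv_map g ` A) c" using inv_inv[OF assms(3)] by (simp add: c_def)
  have "absorbing (inv_map g ` A) (e (inv_map g ` A))" using assms by (intro absorbing_e) auto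
  then have c: "c \<simeq> e (inv_map g ` A)" "on_group c" "on_group (e (inv_map g ` A))"
    using k absorbing_unique absorbing_on_group by blast+
  have "pt g \<odot> c = (pt g \<odot> pt (inv_map g)) \<odot> (e A \<odot> pt g)"
    unfolding c_def filter_product_assoc ..
  also have "\<dots> = e A \<odot> pt g"
    using assms by (simp add: pt_product comp_inv pt_id)
  finally have "e A \<odot> pt g \<odot> e A = pt g \<odot> (c \<odot> e A)"
    by (metis filter_product_assoc)
  also have "\<dots> \<simeq> pt g \<odot> (e (inv_map g ` A) \<odot> e A)"
    using c assms
    by (intro equiv_product_left equiv_product_right on_group_product on_group_pt on_group_e) auto
  finally show ?thesis .
qed

text \<open>By \<open>compress\<close> and \<open>product_meet\<close>, the compression is \<open>g\<close> times \<open>e D\<close>, where \<open>D\<close> consists of the points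
  of \<open>A\<close> that \<open>g\<close> sends into \<open>A\<close>. On \<open>D\<close> the two group elements agree, so they differ by
  an element of the stabilizer of \<open>D\<close>, which \<open>e D\<close> absorbs. If \<open>D\<close> is empty, the zero
  takes the place of \<open>e D\<close>.\<close>

lemma compress_pattern:
  assumes A: "finite A" "A \<noteq> {}" and g: "g \<in> G" "g' \<in> G"
    and same: "\<forall>x\<in>A. \<forall>y\<in>A. g x = y \<longleftrightarrow> g' x = y"
  shows "e A \<odot> pt g \<odot> e A \<simeq> e A \<odot> pt g' \<odot> e A"
proof -
  have dom: "inv_map h ` A \<inter> A = {x \<in> A. h x \<in> A}" if "h \<in> G" for h
  proof
    show "inv_map h ` A \<inter> A \<subseteq> {x \<in> A. h x \<in> A}" using that by auto
    show "{x \<in> A. h x \<in> A} \<subseteq> inv_map h ` A \<inter> A"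
      using inv_apply[OF that, symmetric] by blast
  qed
  define D where "D = {x \<in> A. g x \<in> A}"
  have "g x \<in> A \<longleftrightarrow> g' x \<in> A" if "x \<in> A" for x using same that by metis
  then have "{x \<in> A. g x \<in> A} = {x \<in> A. g' x \<in> A}" by blast
  then have D: "inv_map g ` A \<inter> A = D" "inv_map g' ` A \<inter> A = D"
    using dom[OF g(1)] dom[OF g(2)] by (simp_all add: D_def)
  show ?thesis
  proof (cases "D = {}")
    case False
    have fin: "finite D" using A by (simp add: D_def)
    note og = on_group_e[OF fin False]
    have 1: "e A \<odot> pt h \<odot> e A \<simeq> pt h \<odot> e D" if "h \<in> G" "inv_map h ` A \<inter> A = D" for h
    proof -
      have "e A \<odot> pt h \<odot> e A \<simeq> pt h \<odot> (e (inv_map h ` A) \<odot> e A)" using compress A that by blast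
      also have "\<dots> \<simeq> pt h \<odot> e D"
        using product_meet[of "inv_map h ` A" A] A that False og
        by (intro equiv_product_right on_group_product on_group_pt on_group_e) auto
      finally show ?thesis .
    qed
    define v where "v = inv_map g \<circ> g'"
    have v: "v \<in> fixing D"
    proof -
      have "inv_map g (g' x) = x" if "x \<in> D" for x
      proof -
        have "g' x = g x" using that same by (auto simp: D_def)
        then show ?thesis using g by simp
      qed
      then show ?thesis using g by (simp add: v_def fixing_def comp_in inv_in)
    qed
    have gv: "g \<circ> v = g'" using g by (simp add: v_def fun_eq_iff)
    have "e A \<odot> pt g' \<odot> e A \<simeq> pt g' \<odot> e D" using 1 g D by auto
    also have "\<dots> = pt g \<odot> (pt v \<odot> e D)"
      by (simp add: gv[symmetric] pt_product[symmetric] filter_product_assoc)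
    also have "\<dots> \<simeq> pt g \<odot> e D"
      using absorbing_e[OF fin False] v fixing_in[OF v] g og
      by (intro equiv_product_right on_group_product on_group_pt) (auto simp: absorbing_def)
    also have "\<dots> \<simeq> e A \<odot> pt g \<odot> e A" using 1[of g] g D equiv_sym by blast
    finally show ?thesis by (rule equiv_sym)
  next
    case True
    obtain a b :: 'a where ab: "a \<noteq> b"
      using ex_new_if_finite[OF infinite, of "{undefined}"] by auto
    have 1: "e A \<odot> pt h \<odot> e A \<simeq> e {a} \<odot> e {b}" if h: "h \<in> G" "inv_map h ` A \<inter> A = {}" for h
    proof -
      obtain x where x: "x \<in> A" using A by blast
      have ne: "inv_map h x \<noteq> x"
      proof
        assume "inv_map h x = x"
        then have "x \<in> inv_map h ` A" using x image_eqI[of x "inv_map h" x A] by simp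
        with x h(2) show False by blast
      qed
      have og: "on_group (e {y})" for y by (intro on_group_e) auto
      have "e A \<odot> pt h \<odot> e A \<simeq> pt h \<odot> (e (inv_map h ` A) \<odot> e A)" using compress A h by blast
      also have "\<dots> \<simeq> pt h \<odot> (e {inv_map h x} \<odot> e {x})"
        using A x h og by (intro equiv_product_right product_disjoint on_group_product on_group_pt on_group_e) auto
      also have "\<dots> \<simeq> e {inv_map h x} \<odot> e {x}" using zero_invariant ne h by blast
      also have "\<dots> \<simeq> e {a} \<odot> e {b}" using zero_unique ne ab by blast
      finally show ?thesis .
    qed
    from g D True show ?thesis by (intro equiv_trans[OF 1 equiv_sym[OF 1]]) auto
  qed
qed

text \<open>The limit of \<open>\<phi>\<close> along \<open>e A \<odot> pt g \<odot> e A\<close> is uniformly close to \<open>\<phi> g\<close>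
  once \<open>A\<close> is large, because \<open>\<phi>\<close> is uniformly continuous on both sides and \<open>e A\<close> lives on
  the stabilizer of \<open>A\<close>. By \<open>compress_pattern\<close> the limit depends only on the pattern.\<close>

theorem pattern_continuous:
  assumes "\<epsilon> > 0"
  obtains A where "finite A"
    "\<And>g g'. g \<in> G \<Longrightarrow> g' \<in> G \<Longrightarrow> \<forall>x\<in>A. \<forall>y\<in>A. g x = y \<longleftrightarrow> g' x = y \<Longrightarrow> norm (\<phi> g - \<phi> g') \<le> \<epsilon>"
proof -
  obtain L where L: "finite L" "\<And>u h. u \<in> fixing L \<Longrightarrow> h \<in> G \<Longrightarrow> norm (\<phi> (u \<circ> h) - \<phi> h) \<le> \<epsilon> / 4"
    using left_uniformly_continuous[of "\<epsilon>/4"] assms by auto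
  obtain R where R: "finite R" "\<And>u h. u \<in> fixing R \<Longrightarrow> h \<in> G \<Longrightarrow> norm (\<phi> (h \<circ> u) - \<phi> h) \<le> \<epsilon> / 4"
    using right_uniformly_continuous[of "\<epsilon>/4"] assms by auto
  define A where "A = insert undefined (L \<union> R)"
  have A: "finite A" "A \<noteq> {}" using L R by (auto simp: A_def)
  have close: "norm (Lim (e A \<odot> pt g \<odot> e A) \<phi> - \<phi> g) \<le> \<epsilon> / 2" if g: "g \<in> G" for g
  proof (rule Lim_dist_le)
    have og: "on_group (e A \<odot> pt g \<odot> e A)"
      using A g by (intro on_group_product on_group_e on_group_pt)
    then show "ultrafilter (e A \<odot> pt g \<odot> e A)" by (rule on_groupD)
    show "eventually (\<lambda>h. norm (\<phi> h) \<le> M) (e A \<odot> pt g \<odot> e A)"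
      using on_groupD(2)[OF og] by eventually_elim (rule bounded)
    have ev: "eventually (\<lambda>u. u \<in> fixing A) (e A)" using absorbing_e[OF A] by (simp add: absorbing_def)
    have est: "norm (\<phi> (u \<circ> g \<circ> v) - \<phi> g) \<le> \<epsilon> / 2" if uv: "u \<in> fixing A" "v \<in> fixing A" for u v
    proof -
      have "norm (\<phi> (u \<circ> (g \<circ> v)) - \<phi> (g \<circ> v)) \<le> \<epsilon> / 4"
        using uv g by (intro L) (auto simp: fixing_def A_def comp_in)
      moreover have "norm (\<phi> (g \<circ> v) - \<phi> g) \<le> \<epsilon> / 4"
        using uv g by (intro R) (auto simp: fixing_def A_def comp_in)
      ultimately show ?thesis
        using norm_diff_triangle_le[of "\<phi> (u \<circ> (g \<circ> v))" "\<phi> (g \<circ> v)" "\<epsilon>/4" "\<phi> g" "\<epsilon>/4"] by (simp add: o_assoc)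
    qed
    have "eventually (\<lambda>u. eventually (\<lambda>v. norm (\<phi> (u \<circ> g \<circ> v) - \<phi> g) \<le> \<epsilon> / 2) (e A)) (e A)"
      using ev
    proof eventually_elim
      case (elim u)
      from ev show ?case by eventually_elim (rule est[OF elim])
    qed
    then show "eventually (\<lambda>h. norm (\<phi> h - \<phi> g) \<le> \<epsilon> / 2) (e A \<odot> pt g \<odot> e A)"
      by (simp add: eventually_filter_product eventually_principal)
  qed
  show thesis
  proof (rule that[OF A(1)])
    fix g g' assume g: "g \<in> G" "g' \<in> G" and "\<forall>x\<in>A. \<forall>y\<in>A. g x = y \<longleftrightarrow> g' x = y"
    from compress_pattern[OF A this] have "Lim (e A \<odot> pt g \<odot> e A) \<phi> = Lim (e A \<odot> pt g' \<odot> e A) \<phi>"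
      using equivD[of _ _ id] by simp
    then show "norm (\<phi> g - \<phi> g') \<le> \<epsilon>"
      using close[OF g(1)] close[OF g(2)]
        norm_diff_triangle_le[of "\<phi> g" "Lim (e A \<odot> pt g \<odot> e A) \<phi>" "\<epsilon>/2" "\<phi> g'" "\<epsilon>/2"]
      by (simp add: norm_minus_commute)
  qed
qed

end

section \<open>Ultrahomogeneous cyclic orders\<close>

locale homogeneous_cyclic_order = cyclic_order R
  for R :: "'a \<Rightarrow> 'a \<Rightarrow> 'a \<Rightarrow> bool" +
  assumes infinite_points: "infinite (UNIV :: 'a set)"
    and homogeneous: "ultrahomogeneous R"
begin

abbreviation Aut :: "('a \<Rightarrow> 'a) set" where
  "Aut \<equiv> carrier (aut_group R)"

lemma Aut_iff: "g \<in> Aut \<longleftrightarrow> bij g \<and> (\<forall>a b c. R a b c \<longleftrightarrow> R (g a) (g b) (g c))"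
  by (simp add: aut_group_def)

lemma R_distinct: assumes "R a b c" shows "a \<noteq> b" "b \<noteq> c" "a \<noteq> c"
proof -
  have no: "\<not> R x x y" for x y using asymmetry by blast
  show "a \<noteq> b" using assms no by blast
  show "b \<noteq> c" using assms cyclicity no by blast
  show "a \<noteq> c" using assms cyclicity no by blast
qed

text \<open>Cutting the cycle at \<open>c\<close> gives a linear order with least element \<open>c\<close>. The stabilizer of
  \<open>c\<close> acts by automorphisms of this order, so that arguments about stabilizers of nonempty sets
  are arguments about linear orders.\<close>

definition lt :: "'a \<Rightarrow> 'a \<Rightarrow> 'a \<Rightarrow> bool" where
  "lt c x y \<longleftrightarrow> x \<noteq> y \<and> (x = c \<or> R c x y)"

lemma lt_irrefl [simp]: "\<not> lt c x x" by (simp add: lt_def)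

lemma not_lt_min [simp]: "\<not> lt c x c" using R_distinct(3)[of c x c] by (auto simp: lt_def)

lemma lt_min: "x \<noteq> c \<Longrightarrow> lt c c x" by (simp add: lt_def)

lemma lt_total: "x \<noteq> y \<Longrightarrow> lt c x y \<or> lt c y x"
  using completeness[of c x y] by (auto simp: lt_def)

lemma lt_trans: assumes "lt c x y" "lt c y z" shows "lt c x z"
proof -
  have y: "y \<noteq> c" using assms(1) not_lt_min by blast
  then have yz: "R c y z" using assms(2) by (simp add: lt_def)
  show ?thesis
  proof (cases "x = c")
    case True then show ?thesis using R_distinct(3)[OF yz] by (simp add: lt_def)
  next
    case False
    then have "R c x y" using assms(1) by (simp add: lt_def)
    from transitivity[OF this yz] show ?thesis using R_distinct by (auto simp: lt_def)
  qed
qed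

lemma lt_asym: "lt c x y \<Longrightarrow> \<not> lt c y x" using lt_trans lt_irrefl by blast

lemma lt_R: assumes "lt c x y" "lt c y z" shows "R x y z"
proof -
  have y: "y \<noteq> c" using assms(1) not_lt_min by blast
  then have yz: "R c y z" using assms(2) by (simp add: lt_def)
  show ?thesis
  proof (cases "x = c")
    case True then show ?thesis using yz by simp
  next
    case False
    then have "R c x y" using assms(1) by (simp add: lt_def)
    then have "R y c x" using cyclicity by blast
    with cyclicity[OF yz] have "R y z x" by (rule transitivity)
    then show ?thesis using cyclicity by blast
  qed
qed

lemma R_lt:
  assumes "R x y z" shows "lt c x y \<and> lt c y z \<or> lt c y z \<and> lt c z x \<or> lt c z x \<and> lt c x y"
proof -
  have no: "\<not> R y x z" "\<not> R z y x" "\<not> R x z y" using assms asymmetry cyclicity by blast+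
  have "x \<noteq> y" "y \<noteq> z" "x \<noteq> z" using R_distinct[OF assms] .
  then show ?thesis using no lt_R lt_total by metis
qed

lemma lt_Aut: "g \<in> Aut \<Longrightarrow> lt (g c) (g x) (g y) \<longleftrightarrow> lt c x y"
  by (auto simp: lt_def Aut_iff bij_def inj_eq)

lemma sorted_list_exists:
  assumes "finite F" obtains xs where "set xs = F" "sorted_wrt (lt c) xs"
proof -
  have "\<exists>xs. set xs = F \<and> sorted_wrt (lt c) xs"
    using assms
  proof (induction F)
    case empty then show ?case by (intro exI[of _ "[]"]) simp
  next
    case (insert x F)
    then obtain xs where xs: "set xs = F" "sorted_wrt (lt c) xs" by blast
    let ?ys = "filter (\<lambda>y. lt c y x) xs @ x # filter (\<lambda>y. lt c x y) xs"
    have "set ?ys = insert x F" using xs(1) insert(2) lt_total by auto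
    moreover have "sorted_wrt (lt c) ?ys"
      using xs(2) by (auto simp: sorted_wrt_append intro: sorted_wrt_filter lt_trans)
    ultimately show ?case by blast
  qed
  then show thesis using that by blast
qed

lemma sorted_is_cycle:
  assumes "sorted_wrt (lt c) xs" "xs \<noteq> []" shows "is_cycle R xs"
proof -
  have nth: "lt c (xs ! i) (xs ! j)" if "i < j" "j < length xs" for i j
    using assms(1) that by (simp add: sorted_wrt_iff_nth_less)
  consider "length xs = 1" | "length xs = 2" | "length xs \<ge> 3"
    using assms(2) by (cases xs rule: remdups_adj.cases) (auto simp: Suc_le_eq)
  then show ?thesis
  proof cases
    case 2
    then show ?thesis using nth[of 0 1] lt_irrefl by (auto simp: is_cycle_def)
  next
    case 3
    then show ?thesis unfolding is_cycle_def using nth lt_R by (meson less_trans)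
  qed (simp add: is_cycle_def)
qed

text \<open>Ultrahomogeneity in linear terms. Sorted lists are cycles, so that a monotone map between finite sets,
  possibly cut at different points, maps a cycle to a cycle.\<close>

lemma extend_monotone:
  assumes "finite F" "F \<noteq> {}" "\<And>x y. x \<in> F \<Longrightarrow> y \<in> F \<Longrightarrow> lt c x y \<Longrightarrow> lt c' (f x) (f y)"
  obtains g where "g \<in> Aut" "\<And>x. x \<in> F \<Longrightarrow> g x = f x"
proof -
  obtain xs where xs: "set xs = F" "sorted_wrt (lt c) xs" using sorted_list_exists[OF assms(1)] .
  have "sorted_wrt (lt c') (map f xs)"
    unfolding sorted_wrt_map by (rule sorted_wrt_mono_rel[OF _ xs(2)]) (use xs(1) assms(3) in auto)
  moreover have "xs \<noteq> []" using xs(1) assms(2) by auto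
  ultimately have "is_cycle R xs" "is_cycle R (map f xs)" using xs(2) by (auto intro: sorted_is_cycle)
  then obtain g where "g \<in> Aut" "map g xs = map f xs"
    using homogeneous unfolding ultrahomogeneous_def by (metis length_map)
  then show thesis using that xs(1) by (metis map_eq_conv)
qed

lemma move_pair:
  assumes "a \<noteq> b" "x \<noteq> y" obtains g where "g \<in> Aut" "g a = x" "g b = y"
proof -
  have "is_cycle R [a, b]" "is_cycle R [x, y]" using assms by (simp_all add: is_cycle_def)
  then obtain g where "g \<in> Aut" "map g [a, b] = [x, y]"
    using homogeneous unfolding ultrahomogeneous_def by (metis length_Cons list.size(3))
  then show thesis using that by simp
qed

text \<open>Some triple is in cyclic order, and its outer points can be moved to any two given points.\<close>

lemma R_between: assumes "x \<noteq> y" obtains z where "R x z y"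
proof -
  obtain p q r where "R p q r" using three_points completeness by metis
  then obtain g where "g \<in> Aut" "g p = x" "g r = y" using move_pair[of p r x y] assms R_distinct by blast
  with \<open>R p q r\<close> show thesis using that[of "g q"] by (auto simp: Aut_iff)
qed

lemma lt_dense: assumes "lt c x y" obtains z where "lt c x z" "lt c z y"
proof -
  obtain z where "R x z y" using R_between[of x y] assms lt_irrefl by blast
  from R_lt[OF this, of c] have "lt c x z \<and> lt c z y" using assms lt_asym lt_trans by blast
  then show thesis using that by blast
qed

lemma lt_unbounded: obtains z where "lt c x z"
proof (cases "x = c")
  case True
  obtain z where "z \<noteq> c" using three_points by metis
  then show thesis using that[of z] True lt_min by blast
next
  case False
  then obtain z where "R x z c" using R_between by blast
  then have "R c x z" using cyclicity by blast
  then show thesis using that[of z] R_distinct by (auto simp: lt_def)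
qed

lemma finite_greatest:
  assumes "finite S" "S \<noteq> {}" obtains m where "m \<in> S" "\<And>x. x \<in> S \<Longrightarrow> x = m \<or> lt c x m"
proof -
  have "\<exists>m\<in>S. \<forall>x\<in>S. x = m \<or> lt c x m" using assms
  proof (induction S rule: finite_ne_induct)
    case (insert y S)
    then obtain m where m: "m \<in> S" "\<forall>x\<in>S. x = m \<or> lt c x m" by blast
    show ?case
    proof (cases "lt c m y")
      case True
      have "\<forall>x\<in>S. lt c x y" using m True by (metis lt_trans)
      then show ?thesis by blast
    next
      case False
      then have "y = m \<or> lt c y m" using lt_total by blast
      then show ?thesis using m by blast
    qed
  qed simp
  then show thesis using that by blast
qed

lemma finite_least:
  assumes "finite S" "S \<noteq> {}" obtains m where "m \<in> S" "\<And>x. x \<in> S \<Longrightarrow> x = m \<or> lt c m x"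
proof -
  have "\<exists>m\<in>S. \<forall>x\<in>S. x = m \<or> lt c m x" using assms
  proof (induction S rule: finite_ne_induct)
    case (insert y S)
    then obtain m where m: "m \<in> S" "\<forall>x\<in>S. x = m \<or> lt c m x" by blast
    show ?case
    proof (cases "lt c y m")
      case True
      have "\<forall>x\<in>S. lt c y x" using m True by (metis lt_trans)
      then show ?thesis by blast
    next
      case False
      then have "y = m \<or> lt c m y" using lt_total by blast
      then show ?thesis using m by blast
    qed
  qed simp
  then show thesis using that by blast
qed

lemma finite_between:
  assumes "finite A" "A \<noteq> {}" "finite B" "\<And>x y. x \<in> A \<Longrightarrow> y \<in> B \<Longrightarrow> lt c x y"
  obtains z where "\<And>x. x \<in> A \<Longrightarrow> lt c x z" "\<And>y. y \<in> B \<Longrightarrow> lt c z y"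
proof -
  obtain m where m: "m \<in> A" "\<And>x. x \<in> A \<Longrightarrow> x = m \<or> lt c x m" using finite_greatest[OF assms(1,2), of c] by blast
  show thesis
  proof (cases "B = {}")
    case True
    obtain z where "lt c m z" by (rule lt_unbounded)
    then show thesis using that[of z] m(2) lt_trans True by blast
  next
    case False
    obtain n where n: "n \<in> B" "\<And>x. x \<in> B \<Longrightarrow> x = n \<or> lt c n x" using finite_least[OF assms(3) False, of c] by blast
    obtain z where "lt c m z" "lt c z n" using lt_dense assms(4) m(1) n(1) by blast
    then show thesis using that[of z] m(2) n(2) lt_trans by blast
  qed
qed

text \<open>The point \<open>y\<close> lies in the gap of \<open>A\<close> that contains \<open>x\<close> or to the right of this gap.\<close>

definition gap_le :: "'a \<Rightarrow> 'a set \<Rightarrow> 'a \<Rightarrow> 'a \<Rightarrow> bool" where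
  "gap_le c A x y \<longleftrightarrow> (\<forall>d\<in>A. lt c d x \<longrightarrow> lt c d y)"

text \<open>For growing \<open>E\<close> these automorphisms move all points outside \<open>A\<close> towards the left ends of the
  gaps of \<open>A\<close>.\<close>

definition push :: "'a \<Rightarrow> 'a set \<Rightarrow> 'a set \<Rightarrow> ('a \<Rightarrow> 'a) set" where
  "push c A E = {u \<in> Aut. (\<forall>a\<in>A. u a = a) \<and> (\<forall>x\<in>E - A. \<forall>y\<in>E. gap_le c A x y \<longrightarrow> lt c (u x) y)}"

text \<open>The images are chosen for one point after the other. The conditions on a new image are finitely many
  lower and upper bounds, and they are consistent because the map so far is monotone and pushes below
  \<open>E\<close>.\<close>

lemma push_map_exists:
  assumes "finite A" "c \<in> A" "finite E" "finite S" "S \<inter> A = {}"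
  shows "\<exists>f. (\<forall>a\<in>A. f a = a) \<and> (\<forall>x\<in>A \<union> S. \<forall>y\<in>A \<union> S. lt c x y \<longrightarrow> lt c (f x) (f y)) \<and>
    (\<forall>x\<in>S. \<forall>y\<in>E. gap_le c A x y \<longrightarrow> lt c (f x) y)"
  using assms(4,5)
proof (induction S)
  case empty
  show ?case by (rule exI[of _ id]) simp
next
  case (insert x S)
  have "S \<inter> A = {}" using insert.prems by auto
  from insert.IH[OF this] obtain f where f0: "(\<forall>a\<in>A. f a = a) \<and>
    (\<forall>x\<in>A \<union> S. \<forall>y\<in>A \<union> S. lt c x y \<longrightarrow> lt c (f x) (f y)) \<and>
    (\<forall>x\<in>S. \<forall>y\<in>E. gap_le c A x y \<longrightarrow> lt c (f x) y)" ..
  have f: "\<And>a. a \<in> A \<Longrightarrow> f a = a"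
    "\<And>s t. s \<in> A \<union> S \<Longrightarrow> t \<in> A \<union> S \<Longrightarrow> lt c s t \<Longrightarrow> lt c (f s) (f t)"
    "\<And>s y. s \<in> S \<Longrightarrow> y \<in> E \<Longrightarrow> gap_le c A s y \<Longrightarrow> lt c (f s) y"
    using f0 by simp_all
  have x: "x \<notin> A" "x \<notin> S" using insert by auto
  define lo where "lo = f ` {s \<in> A \<union> S. lt c s x}"
  define hi where "hi = f ` {s \<in> A \<union> S. lt c x s} \<union> {y \<in> E. gap_le c A x y}"
  have "x \<noteq> c" using x assms by blast
  then have ne: "lo \<noteq> {}" using assms lt_min by (auto simp: lo_def)
  have fin: "finite lo" "finite hi" using assms insert by (auto simp: lo_def hi_def)
  have "lt c l h" if "l \<in> lo" "h \<in> hi" for l h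
  proof -
    from that(1) obtain s where s: "l = f s" "s \<in> A \<union> S" "lt c s x" by (auto simp: lo_def)
    from that(2) consider t where "h = f t" "t \<in> A \<union> S" "lt c x t" | "h \<in> E" "gap_le c A x h"
      by (auto simp: hi_def)
    then show ?thesis
    proof cases
      case 1 then show ?thesis using s f(2) lt_trans by blast
    next
      case 2
      show ?thesis
      proof (cases "s \<in> A")
        case True then show ?thesis using s 2 f(1) by (auto simp: gap_le_def)
      next
        case False
        have "gap_le c A s h" using 2 s(3) lt_trans unfolding gap_le_def by blast
        then show ?thesis using f(3)[of s h] s 2 False by auto
      qed
    qed
  qed
  from finite_between[OF fin(1) ne fin(2) this] obtain z where
    z: "\<And>l. l \<in> lo \<Longrightarrow> lt c l z" "\<And>h. h \<in> hi \<Longrightarrow> lt c z h" by blast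
  show ?case
  proof (intro exI[of _ "f(x := z)"] conjI ballI impI)
    show "(f(x := z)) a = a" if "a \<in> A" for a using that x f(1) by auto
    fix s t assume st: "s \<in> A \<union> insert x S" "t \<in> A \<union> insert x S" "lt c s t"
    have "s \<noteq> t" using st(3) by auto
    then consider "s = x" "t \<noteq> x" | "s \<noteq> x" "t = x" | "s \<noteq> x" "t \<noteq> x" by blast
    then show "lt c ((f(x := z)) s) ((f(x := z)) t)"
      using st f(2) z by cases (auto simp: lo_def hi_def)
  next
    fix s y assume "s \<in> insert x S" "y \<in> E" "gap_le c A s y"
    then show "lt c ((f(x := z)) s) y" using f(3) z(2) x by (auto simp: hi_def)
  qed
qed

lemma push_nonempty:
  assumes "finite A" "c \<in> A" "finite E" shows "push c A E \<noteq> {}"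
proof -
  have "finite (E - A)" "(E - A) \<inter> A = {}" using assms by auto
  from push_map_exists[OF assms this] obtain f where f0: "(\<forall>a\<in>A. f a = a) \<and>
    (\<forall>x\<in>A \<union> (E - A). \<forall>y\<in>A \<union> (E - A). lt c x y \<longrightarrow> lt c (f x) (f y)) \<and>
    (\<forall>x\<in>E - A. \<forall>y\<in>E. gap_le c A x y \<longrightarrow> lt c (f x) y)" ..
  have f: "\<forall>a\<in>A. f a = a"
    "\<And>x y. x \<in> A \<union> (E - A) \<Longrightarrow> y \<in> A \<union> (E - A) \<Longrightarrow> lt c x y \<Longrightarrow> lt c (f x) (f y)"
    "\<forall>x\<in>E - A. \<forall>y\<in>E. gap_le c A x y \<longrightarrow> lt c (f x) y"
    using f0 by simp_all
  obtain u where "u \<in> Aut" "\<And>x. x \<in> A \<union> (E - A) \<Longrightarrow> u x = f x"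
    using extend_monotone[of "A \<union> (E - A)" c c f] assms f(2) by auto
  then have "u \<in> push c A E" using f by (simp add: push_def)
  then show ?thesis by blast
qed

lemma push_mono: assumes "E \<subseteq> E'" shows "push c A E' \<subseteq> push c A E"
proof -
  have "u \<in> push c A E" if "u \<in> push c A E'" for u using that assms unfolding push_def by auto
  then show ?thesis by blast
qed

definition push_filter :: "'a \<Rightarrow> 'a set \<Rightarrow> ('a \<Rightarrow> 'a) filter" where
  "push_filter c A = (INF E\<in>{E. finite E}. principal (push c A E))"

lemma eventually_push_filter:
  "eventually P (push_filter c A) \<longleftrightarrow> (\<exists>E. finite E \<and> (\<forall>u\<in>push c A E. P u))"
proof -
  have "eventually P (push_filter c A) \<longleftrightarrow> (\<exists>E\<in>{E. finite E}. eventually P (principal (push c A E)))"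
    unfolding push_filter_def
  proof (rule eventually_INF_base)
    fix E E' :: "'a set" assume "E \<in> {E. finite E}" "E' \<in> {E. finite E}"
    then show "\<exists>x\<in>{E. finite E}. principal (push c A x) \<le> inf (principal (push c A E)) (principal (push c A E'))"
      using push_mono[of E "E \<union> E'"] push_mono[of E' "E \<union> E'"]
      by (intro bexI[of _ "E \<union> E'"]) auto
  qed auto
  then show ?thesis by (simp add: eventually_principal)
qed

lemma eventually_push: "finite E \<Longrightarrow> eventually (\<lambda>u. u \<in> push c A E) (push_filter c A)"
  by (auto simp: eventually_push_filter)

lemma push_filter_not_bot: "finite A \<Longrightarrow> c \<in> A \<Longrightarrow> push_filter c A \<noteq> bot"
  using push_nonempty by (auto simp: trivial_limit_def eventually_push_filter)

lemma le_push_filterI: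
  "(\<And>E. finite E \<Longrightarrow> eventually (\<lambda>u. u \<in> push c A E) p) \<Longrightarrow> p \<le> push_filter c A"
  unfolding le_filter_def eventually_push_filter by (blast intro: eventually_mono)

lemma push_Aut: "u \<in> push c A E \<Longrightarrow> u \<in> Aut" and push_fixes: "u \<in> push c A E \<Longrightarrow> a \<in> A \<Longrightarrow> u a = a"
  by (simp_all add: push_def)

lemma pushD:
  "u \<in> push c A E \<Longrightarrow> x \<in> E \<Longrightarrow> x \<notin> A \<Longrightarrow> y \<in> E \<Longrightarrow> gap_le c A x y \<Longrightarrow> lt c (u x) y"
  by (simp add: push_def)

lemma push_lt_iff: "u \<in> push c A E \<Longrightarrow> c \<in> A \<Longrightarrow> lt c (u x) (u y) \<longleftrightarrow> lt c x y"
  using lt_Aut[of u c x y] push_Aut push_fixes by metis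

text \<open>The position of \<open>u x\<close> relative to \<open>E\<close> is the same for all pushes \<open>u\<close>. This is what
  makes pushing lead to a limit.\<close>

lemma push_position:
  assumes u: "u \<in> push c A E" and c: "c \<in> A" and x: "x \<in> E" "x \<notin> A" and y: "y \<in> E"
  shows "lt c (u x) y \<longleftrightarrow> gap_le c A x y" "lt c y (u x) \<longleftrightarrow> \<not> gap_le c A x y"
proof -
  have 1: "lt c (u x) y" if "gap_le c A x y" using pushD[OF u x y that] .
  have 2: "lt c y (u x)" if ng: "\<not> gap_le c A x y"
  proof -
    obtain d where d: "d \<in> A" "lt c d x" "\<not> lt c d y" using ng by (auto simp: gap_le_def)
    have "lt c d (u x)" using push_lt_iff[OF u c, of d x] push_fixes[OF u d(1)] d(2) by simp
    moreover have "y = d \<or> lt c y d" using lt_total d(3) by blast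
    ultimately show ?thesis using lt_trans by blast
  qed
  show "lt c (u x) y \<longleftrightarrow> gap_le c A x y" "lt c y (u x) \<longleftrightarrow> \<not> gap_le c A x y"
    using 1 2 lt_asym by blast+
qed

end

section \<open>Pushing towards the ends of gaps\<close>

text \<open>The group \<open>G\<close> is a parameter because an order and its reverse have the same automorphisms: the
  locale is interpreted for both orders with one notion of equivalence.\<close>

locale cyclic_stable_function = homogeneous_cyclic_order R + stable_function G \<phi> M
  for R :: "'a \<Rightarrow> 'a \<Rightarrow> 'a \<Rightarrow> bool" and G :: "('a \<Rightarrow> 'a) set" and \<phi> M +
  assumes G_eq: "G = carrier (aut_group R)"
begin

lemma in_G_iff: "u \<in> G \<longleftrightarrow> u \<in> Aut" by (simp add: G_eq)

lemma push_G: "u \<in> push c A E \<Longrightarrow> u \<in> G" by (simp add: push_def in_G_iff)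

lemma push_fixing: "u \<in> push c A E \<Longrightarrow> u \<in> fixing A" by (simp add: push_def fixing_def in_G_iff)

lemma fixing_lt_iff: "v \<in> fixing A \<Longrightarrow> c \<in> A \<Longrightarrow> lt c (v x) (v y) \<longleftrightarrow> lt c x y"
  using lt_Aut[of v c x y] by (simp add: fixing_def in_G_iff)

text \<open>Any two pushes lie in the same double coset of the stabilizer of \<open>E\<close>: the map that is the identity
  on \<open>E\<close> and sends \<open>u z\<close> to \<open>u' z\<close> for \<open>z\<close> in \<open>E\<close> is monotone, hence it
  extends to an automorphism.\<close>

lemma push_double_coset:
  assumes c: "c \<in> A" and E: "finite E" "A \<subseteq> E"
    and u: "u \<in> push c A E" and u': "u' \<in> push c A E"
  obtains w w' where "w \<in> fixing E" "w' \<in> fixing E" "u' = w \<circ> u \<circ> w'"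
proof -
  define f where "f z = (if z \<in> E then z else u' (inv_map u z))" for z
  have fE: "f z = z" if "z \<in> E" for z using that by (simp add: f_def)
  have fu: "f (u z) = u' z" if z: "z \<in> E" for z
  proof (cases "u z \<in> E")
    case True
    have "z \<in> A"
    proof (rule ccontr)
      assume zA: "z \<notin> A"
      have "gap_le c A z (u z)"
        unfolding gap_le_def using push_lt_iff[OF u c] push_fixes[OF u] by metis
      with pushD[OF u z zA True] show False by simp
    qed
    then show ?thesis using True push_fixes[OF u] push_fixes[OF u'] by (simp add: f_def)
  next
    case False
    then show ?thesis using push_G[OF u] by (simp add: f_def)
  qed
  have mono: "lt c (f x) (f y)" if xy: "x \<in> E \<union> u ` E" "y \<in> E \<union> u ` E" "lt c x y" for x y
  proof -
    have mixed: "lt c (u s) t \<longleftrightarrow> lt c (u' s) t" "lt c t (u s) \<longleftrightarrow> lt c t (u' s)" if "s \<in> E" "t \<in> E" for s t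
    proof -
      have "(lt c (u s) t \<longleftrightarrow> lt c (u' s) t) \<and> (lt c t (u s) \<longleftrightarrow> lt c t (u' s))"
      proof (cases "s \<in> A")
        case True
        then show ?thesis using push_fixes[OF u True] push_fixes[OF u' True] by simp
      next
        case False
        then show ?thesis using push_position[OF u c that(1) False that(2)] push_position[OF u' c that(1) False that(2)]
          by simp
      qed
      then show "lt c (u s) t \<longleftrightarrow> lt c (u' s) t" "lt c t (u s) \<longleftrightarrow> lt c t (u' s)" by auto
    qed
    consider "x \<in> E" "y \<in> E" | t where "x \<in> E" "t \<in> E" "y = u t" | s where "s \<in> E" "x = u s" "y \<in> E"
      | s t where "s \<in> E" "x = u s" "t \<in> E" "y = u t" using xy by blast
    then show ?thesis
    proof cases
      case 1 then show ?thesis using xy fE by simp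
    next
      case 2 then show ?thesis using xy fE fu mixed by simp
    next
      case 3 then show ?thesis using xy fE fu mixed by simp
    next
      case 4 then show ?thesis using xy fu push_lt_iff[OF u c] push_lt_iff[OF u' c] by simp
    qed
  qed
  obtain w where w: "w \<in> Aut" "\<And>x. x \<in> E \<union> u ` E \<Longrightarrow> w x = f x"
    using extend_monotone[of "E \<union> u ` E" c c f] E c mono by auto
  then have wE: "w \<in> fixing E" using fE by (simp add: fixing_def in_G_iff)
  define w' where "w' = inv_map (w \<circ> u) \<circ> u'"
  have wu: "w \<circ> u \<in> G" using w push_G[OF u] comp_in by (simp add: in_G_iff)
  have "w' \<in> fixing E"
  proof -
    have "w' z = z" if z: "z \<in> E" for z
    proof -
      have "u' z = (w \<circ> u) z" using w(2)[of "u z"] fu[OF z] z by simp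
      then show ?thesis using inv_apply[OF wu, of z] by (simp add: w'_def)
    qed
    then show ?thesis using wu push_G[OF u'] by (simp add: fixing_def w'_def comp_in inv_in)
  qed
  moreover have "u' = w \<circ> u \<circ> w'"
    using apply_inv[OF wu] by (auto simp: w'_def fun_eq_iff)
  ultimately show thesis using that wE by blast
qed

text \<open>By uniform continuity on both sides, \<open>\<phi>\<close> is almost constant on double cosets of stabilizers of
  large finite sets, and so are its translates. Hence they converge along pushes.\<close>

lemma push_equiv:
  assumes c: "finite A" "c \<in> A" and p: "ultrafilter p" "p \<le> push_filter c A"
    and q: "ultrafilter q" "q \<le> push_filter c A"
  shows "p \<simeq> q"
  unfolding equiv_def
proof (intro ballI)
  fix x y assume x: "x \<in> G" and y: "y \<in> G"
  let ?f = "\<lambda>u. \<phi> (x \<circ> u \<circ> y)"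
  have ev: "eventually (\<lambda>u. u \<in> push c A E) p" "eventually (\<lambda>u. u \<in> push c A E) q" if "finite E" for E
    using eventually_push[OF that] filter_leD p q by blast+
  have bd: "eventually (\<lambda>u. norm (?f u) \<le> M) r"
    if "eventually (\<lambda>u. u \<in> push c A {}) r" for r
    using that by eventually_elim (use x y push_G in \<open>auto intro!: bounded comp_in\<close>)
  have "norm (Lim p ?f - Lim q ?f) \<le> \<epsilon>" if "\<epsilon> > 0" for \<epsilon> :: real
  proof -
    have e: "\<epsilon> / 4 > 0" using that by simp
    obtain L where L: "finite L" "\<And>u h. u \<in> fixing L \<Longrightarrow> h \<in> G \<Longrightarrow> norm (\<phi> (u \<circ> h) - \<phi> h) \<le> \<epsilon> / 4"
      using left_uniformly_continuous[OF e] by blast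
    obtain K where K: "finite K" "\<And>u h. u \<in> fixing K \<Longrightarrow> h \<in> G \<Longrightarrow> norm (\<phi> (h \<circ> u) - \<phi> h) \<le> \<epsilon> / 4"
      using right_uniformly_continuous[OF e] by blast
    define E where "E = A \<union> inv_map x ` L \<union> y ` K"
    have E: "finite E" "A \<subseteq> E" using c L K by (auto simp: E_def)
    have close: "norm (?f u' - ?f u) \<le> \<epsilon> / 2" if u: "u \<in> push c A E" and u': "u' \<in> push c A E" for u u'
    proof -
      obtain w w' where w: "w \<in> fixing E" "w' \<in> fixing E" "u' = w \<circ> u \<circ> w'"
        using push_double_coset[OF c(2) E u u'] .
      have wx: "x \<circ> w \<circ> inv_map x \<in> fixing L"
        using w(1) x by (auto simp: fixing_def E_def comp_in inv_in)
      have wy: "inv_map y \<circ> w' \<circ> y \<in> fixing K"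
        using w(2) y by (auto simp: fixing_def E_def comp_in inv_in)
      have h: "x \<circ> u \<circ> y \<in> G" using x y push_G[OF u] by (simp add: comp_in)
      have "x \<circ> u' \<circ> y = (x \<circ> w \<circ> inv_map x) \<circ> ((x \<circ> u \<circ> y) \<circ> (inv_map y \<circ> w' \<circ> y))"
        using x y by (simp add: w(3) fun_eq_iff)
      moreover have "norm (\<phi> ((x \<circ> w \<circ> inv_map x) \<circ> ((x \<circ> u \<circ> y) \<circ> (inv_map y \<circ> w' \<circ> y)))
          - \<phi> ((x \<circ> u \<circ> y) \<circ> (inv_map y \<circ> w' \<circ> y))) \<le> \<epsilon> / 4"
        using L(2) wx comp_in[OF h fixing_in[OF wy]] by blast
      moreover have "norm (\<phi> ((x \<circ> u \<circ> y) \<circ> (inv_map y \<circ> w' \<circ> y)) - ?f u) \<le> \<epsilon> / 4"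
        using K(2) wy h by blast
      ultimately show ?thesis
        using norm_diff_triangle_le[of "\<phi> (x \<circ> u' \<circ> y)" _ "\<epsilon>/4" "?f u" "\<epsilon>/4"] by simp
    qed
    obtain u where u: "u \<in> push c A E" using push_nonempty[OF c E(1)] by blast
    have near: "norm (Lim r ?f - ?f u) \<le> \<epsilon> / 2"
      if "ultrafilter r" "\<And>E. finite E \<Longrightarrow> eventually (\<lambda>u. u \<in> push c A E) r" for r
    proof (rule Lim_dist_le[OF that(1) bd[OF that(2)]])
      show "eventually (\<lambda>v. norm (?f v - ?f u) \<le> \<epsilon> / 2) r"
        using that(2)[OF E(1)] by eventually_elim (rule close[OF u])
    qed simp
    show ?thesis
      using near[OF p(1) ev(1)] near[OF q(1) ev(2)]
        norm_diff_triangle_le[of "Lim p ?f" "?f u" "\<epsilon>/2" "Lim q ?f" "\<epsilon>/2"]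
      by (simp add: norm_minus_commute)
  qed
  then have "norm (Lim p ?f - Lim q ?f) \<le> 0" by (rule field_le_epsilon[of _ 0, simplified])
  then show "Lim p ?f = Lim q ?f" by simp
qed

lemma gap_le_fixing:
  "v \<in> fixing A \<Longrightarrow> c \<in> A \<Longrightarrow> gap_le c A (v x) y \<longleftrightarrow> gap_le c A x y"
  "v \<in> fixing A \<Longrightarrow> c \<in> A \<Longrightarrow> gap_le c A x (v y) \<longleftrightarrow> gap_le c A x y"
proof -
  assume v: "v \<in> fixing A" "c \<in> A"
  have "lt c d (v z) \<longleftrightarrow> lt c d z" if "d \<in> A" for d z
    using fixing_lt_iff[OF v, of d z] v that by (simp add: fixing_def)
  then show "gap_le c A (v x) y \<longleftrightarrow> gap_le c A x y" "gap_le c A x (v y) \<longleftrightarrow> gap_le c A x y"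
    by (auto simp: gap_le_def)
qed

text \<open>Composing a push with an element of the stabilizer of \<open>A\<close>, on either side, gives a push again, for
  a slightly smaller set \<open>E\<close>.\<close>

lemma absorbing_push:
  assumes c: "finite A" "c \<in> A" and p: "ultrafilter p" "p \<le> push_filter c A"
  shows "absorbing A p"
proof -
  have ev: "eventually (\<lambda>u. u \<in> push c A E) p" if "finite E" for E
    using eventually_push[OF that] filter_leD p by blast
  have "pt v \<odot> p \<simeq> p" "p \<odot> pt v \<simeq> p" if v: "v \<in> fixing A" for v
  proof -
    note v' = fixing_inv[OF v]
    have vA: "v a = a" "inv_map v a = a" if "a \<in> A" for a using v v' that by (auto simp: fixing_def)
    have vx: "v x \<in> A \<longleftrightarrow> x \<in> A" for x
      using vA inv_apply[OF fixing_in[OF v]] by metis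
    have "pt v \<odot> p \<le> push_filter c A"
      unfolding pt_left
    proof (rule le_push_filterI)
      fix E :: "'a set" assume E: "finite E"
      then have "finite (E \<union> inv_map v ` E)" by simp
      from ev[OF this] have "eventually (\<lambda>u. v \<circ> u \<in> push c A E) p"
      proof eventually_elim
        case (elim u)
        have "lt c (v (u x)) y" if "x \<in> E - A" "y \<in> E" "gap_le c A x y" for x y
        proof -
          have "lt c (u x) (inv_map v y)"
            using that gap_le_fixing(2)[OF v' c(2)] by (intro pushD[OF elim]) auto
          then show ?thesis using fixing_lt_iff[OF v c(2), of "u x" "inv_map v y"] fixing_in[OF v] by simp
        qed
        then show ?case using elim v vA comp_in[OF fixing_in[OF v] push_G[OF elim]]
          by (auto simp: push_def in_G_iff)
      qed
      then show "eventually (\<lambda>u. u \<in> push c A E) (filtermap (\<lambda>u. v \<circ> u) p)" by (simp add: eventually_filtermap)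
    qed
    moreover have "p \<odot> pt v \<le> push_filter c A"
      unfolding pt_right
    proof (rule le_push_filterI)
      fix E :: "'a set" assume E: "finite E"
      then have "finite (E \<union> v ` E)" by simp
      from ev[OF this] have "eventually (\<lambda>u. u \<circ> v \<in> push c A E) p"
      proof eventually_elim
        case (elim u)
        have "lt c (u (v x)) y" if "x \<in> E - A" "y \<in> E" "gap_le c A x y" for x y
          using that gap_le_fixing(1)[OF v c(2)] vx by (intro pushD[OF elim]) auto
        then show ?case using elim v vA comp_in[OF push_G[OF elim] fixing_in[OF v]]
          by (auto simp: push_def in_G_iff)
      qed
      then show "eventually (\<lambda>u. u \<in> push c A E) (filtermap (\<lambda>u. u \<circ> v) p)" by (simp add: eventually_filtermap)
    qed
    moreover have "ultrafilter (pt v \<odot> p)" "ultrafilter (p \<odot> pt v)"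
      by (intro ultrafilter_filter_product p ultrafilter_principal)+
    ultimately show "pt v \<odot> p \<simeq> p" "p \<odot> pt v \<simeq> p" using push_equiv[OF c] p by blast+
  qed
  moreover have "eventually (\<lambda>u. u \<in> fixing A) p"
    using ev[of "{}"] by (auto elim: eventually_mono dest: push_fixing)
  ultimately show ?thesis using p(1) unfolding absorbing_def by blast
qed

lemma push_ultrafilter:
  assumes "finite A" "c \<in> A" obtains p where "ultrafilter p" "p \<le> push_filter c A" "absorbing A p"
  using ultrafilter_below[OF push_filter_not_bot[OF assms]] absorbing_push[OF assms] by metis

lemma absorbing_exists: assumes "finite A" "A \<noteq> {}" obtains p where "absorbing A p"
  using push_ultrafilter[OF assms(1)] assms(2) by blast

text \<open>A push \<open>v\<close> that fixes \<open>b\<close> leaves the points to the right of \<open>b\<close> stuck there, but they land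
  to the left of a given \<open>z\<close> between \<open>b\<close> and \<open>a\<close>. If \<open>b < a\<close>, nothing prevents \<open>u\<close> from
  pushing \<open>z\<close>, and thus all of them, across \<open>b\<close>.\<close>

lemma push_compose:
  assumes c: "finite C" "c \<in> C" and ab: "a \<notin> C" "b \<notin> C" "lt c b a" and E: "finite E"
  obtains E' where "finite E'"
    "\<And>u v. u \<in> push c (insert a C) E' \<Longrightarrow> v \<in> push c (insert b C) E' \<Longrightarrow> u \<circ> v \<in> push c C E"
proof -
  have fin: "finite {b}" "{b} \<noteq> {}" "finite (insert a {d \<in> C. lt c b d})" using c by simp_all
  have "lt c x y" if "x \<in> {b}" "y \<in> insert a {d \<in> C. lt c b d}" for x y using that ab by auto
  from finite_between[OF fin this] obtain z where
    z0: "\<And>x. x \<in> {b} \<Longrightarrow> lt c x z" "\<And>y. y \<in> insert a {d \<in> C. lt c b d} \<Longrightarrow> lt c z y" by blast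
  then have z: "lt c b z" "lt c z a" "\<And>d. d \<in> C \<Longrightarrow> lt c b d \<Longrightarrow> lt c z d" by auto
  have zC: "z \<notin> C" using z(1,3) lt_irrefl by blast
  have za: "z \<noteq> a" using z(2) by auto
  have dz: "lt c d b" if "d \<in> C" "lt c d z" for d
  proof -
    have "d \<noteq> b" using that ab by auto
    moreover have "\<not> lt c b d" using z(3)[OF that(1)] that(2) lt_asym by blast
    ultimately show ?thesis using lt_total by blast
  qed
  show thesis
  proof (rule that[of "insert z E"])
    fix u v assume u: "u \<in> push c (insert a C) (insert z E)" and v: "v \<in> push c (insert b C) (insert z E)"
    have mono: "lt c (u x) (u y) \<longleftrightarrow> lt c x y" for x y using push_lt_iff[OF u] c by simp
    \<comment> \<open>Either \<open>x\<close> lies in the gap of \<open>C\<close> that contains \<open>b\<close>, and the push goes through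
      \<open>z\<close>, or \<open>b\<close> lies in another gap of \<open>C\<close>, and \<open>v\<close> alone pushes far enough.\<close>
    have "lt c (u (v x)) y" if x: "x \<in> E - C" and y: "y \<in> E" and gap: "gap_le c C x y" for x y
    proof (cases "\<forall>d\<in>C. lt c d x \<longleftrightarrow> lt c d b")
      case True
      have "lt c (v x) z"
      proof (cases "lt c b x")
        case False
        then have "x = b \<or> lt c x b" using lt_total by blast
        then have "v x = b \<or> lt c (v x) b"
          using push_lt_iff[OF v, of x b] push_fixes[OF v, of b] c by auto
        then show ?thesis using z(1) lt_trans by blast
      next
        case bx: True
        have "gap_le c (insert b C) x z"
          unfolding gap_le_def using True z(1) lt_trans by blast
        moreover have "x \<notin> insert b C" using x bx by auto
        ultimately show ?thesis using x by (intro pushD[OF v]) auto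
      qed
      then have "lt c (u (v x)) (u z)" using mono by simp
      moreover have "lt c (u z) y"
      proof (rule pushD[OF u])
        show "gap_le c (insert a C) z y"
          unfolding gap_le_def
        proof (intro ballI impI)
          fix d assume d: "d \<in> insert a C" "lt c d z"
          then have "d \<in> C" using z(2) lt_asym by blast
          then show "lt c d y" using dz[OF _ d(2)] True gap by (auto simp: gap_le_def)
        qed
      qed (use y zC za in auto)
      ultimately show ?thesis by (rule lt_trans)
    next
      case False
      have xb: "x \<noteq> b" using False by auto
      have "gap_le c (insert b C) x y"
        unfolding gap_le_def
      proof (intro ballI impI)
        fix d assume d: "d \<in> insert b C" "lt c d x"
        show "lt c d y"
        proof (cases "d \<in> C")
          case True then show ?thesis using gap d by (auto simp: gap_le_def)
        next
          case dC: False
          then have db: "d = b" using d by simp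
          obtain d' where d': "d' \<in> C" "\<not> (lt c d' x \<longleftrightarrow> lt c d' b)" using False by blast
          have "lt c d' x" "\<not> lt c d' b" using d' d(2) db lt_trans by blast+
          moreover have "d' \<noteq> b" using d' ab by auto
          ultimately have "lt c b d'" "lt c d' y" using lt_total[of d' b c] gap d' by (auto simp: gap_le_def)
          then show ?thesis using db lt_trans by blast
        qed
      qed
      then have "lt c (v x) y" using x y xb by (intro pushD[OF v]) auto
      then have "lt c (u (v x)) (u y)" using mono by simp
      moreover have "u y = y \<or> lt c (u y) y"
      proof (cases "y \<in> insert a C")
        case True then show ?thesis using push_fixes[OF u] by blast
      next
        case False
        then have "lt c (u y) y" using y by (intro pushD[OF u]) (auto simp: gap_le_def)
        then show ?thesis ..
      qed
      ultimately show ?thesis using lt_trans by auto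
    qed
    then show "u \<circ> v \<in> push c C E"
      using comp_in[OF push_G[OF u] push_G[OF v]] push_fixes[OF u] push_fixes[OF v]
      by (auto simp: push_def in_G_iff)
  qed (simp add: E)
qed

lemma exchange_less:
  assumes c: "finite C" "c \<in> C" and ab: "a \<notin> C" "b \<notin> C" "lt c b a"
    and k: "absorbing (insert a C) p" "absorbing (insert b C) q" "absorbing C r"
  shows "p \<odot> q \<simeq> r"
proof -
  obtain p' where p': "ultrafilter p'" "p' \<le> push_filter c (insert a C)" "absorbing (insert a C) p'"
    using push_ultrafilter[of "insert a C" c] c by auto
  obtain q' where q': "ultrafilter q'" "q' \<le> push_filter c (insert b C)" "absorbing (insert b C) q'"
    using push_ultrafilter[of "insert b C" c] c by auto
  note og = k[THEN absorbing_on_group] p'(3)[THEN absorbing_on_group] q'(3)[THEN absorbing_on_group]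
  have "p' \<odot> q' \<le> push_filter c C"
  proof (rule le_push_filterI)
    fix E :: "'a set" assume "finite E"
    from push_compose[OF c ab this] obtain E' where E': "finite E'"
      "\<And>u v. u \<in> push c (insert a C) E' \<Longrightarrow> v \<in> push c (insert b C) E' \<Longrightarrow> u \<circ> v \<in> push c C E" by blast
    have "eventually (\<lambda>u. u \<in> push c (insert a C) E') p'" "eventually (\<lambda>u. u \<in> push c (insert b C) E') q'"
      using eventually_push[OF E'(1)] filter_leD p'(2) q'(2) by blast+
    then show "eventually (\<lambda>u. u \<in> push c C E) (p' \<odot> q')"
      unfolding eventually_filter_product
      by (elim eventually_mono) (use E'(2) in \<open>auto elim: eventually_mono\<close>)
  qed
  then have "absorbing C (p' \<odot> q')"
    using p' q' c by (intro absorbing_push ultrafilter_filter_product)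
  then have "p' \<odot> q' \<simeq> r" using k(3) by (rule absorbing_unique)
  moreover have "p \<odot> q \<simeq> p' \<odot> q"
    using absorbing_unique[OF k(1) p'(3)] og by (intro equiv_product_left)
  moreover have "p' \<odot> q \<simeq> p' \<odot> q'"
    using absorbing_unique[OF k(2) q'(3)] og by (intro equiv_product_right)
  ultimately show ?thesis using equiv_trans by blast
qed

end

text \<open>Pushing to the left for the reversed order is pushing to the right.\<close>

lemma (in homogeneous_cyclic_order) reversed: "homogeneous_cyclic_order (\<lambda>x y z. R z y x)"
proof
  show "\<exists>a b c :: 'a. a \<noteq> b \<and> b \<noteq> c \<and> a \<noteq> c" by (rule three_points)
  fix a b c d
  show "R c b a \<Longrightarrow> R a c b" using cyclicity by blast
  show "R c b a \<Longrightarrow> \<not> R c a b" using asymmetry cyclicity by blast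
  show "R c b a \<Longrightarrow> R d c a \<Longrightarrow> R d b a"
    using transitivity[of a d c b] cyclicity by blast
  show "a \<noteq> b \<Longrightarrow> b \<noteq> c \<Longrightarrow> a \<noteq> c \<Longrightarrow> R c b a \<or> R b c a"
    using completeness[of a b c] cyclicity by blast
next
  show "infinite (UNIV :: 'a set)" by (rule infinite_points)
  have G: "carrier (aut_group (\<lambda>x y z. R z y x)) = Aut" by (auto simp: aut_group_def)
  have cyc: "is_cycle R (rev xs)" if "is_cycle (\<lambda>x y z. R z y x) xs" for xs
  proof -
    consider "length xs = 1" | "length xs = 2" "xs ! 0 \<noteq> xs ! 1"
      | "length xs \<ge> 3" "\<And>i j k. i < j \<Longrightarrow> j < k \<Longrightarrow> k < length xs \<Longrightarrow> R (xs ! k) (xs ! j) (xs ! i)"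
      using \<open>is_cycle _ xs\<close> unfolding is_cycle_def by blast
    then show ?thesis
    proof cases
      case 3
      have "R (rev xs ! i) (rev xs ! j) (rev xs ! k)" if "i < j" "j < k" "k < length xs" for i j k
        using 3(2)[of "length xs - Suc k" "length xs - Suc j" "length xs - Suc i"] that by (simp add: rev_nth)
      then show ?thesis using 3(1) by (simp add: is_cycle_def)
    qed (auto simp: is_cycle_def rev_nth)
  qed
  show "ultrahomogeneous (\<lambda>x y z. R z y x)"
    unfolding ultrahomogeneous_def G
  proof (intro allI impI)
    fix xs ys :: "'a list"
    assume "is_cycle (\<lambda>x y z. R z y x) xs \<and> is_cycle (\<lambda>x y z. R z y x) ys \<and> length xs = length ys"
    then have "is_cycle R (rev xs)" "is_cycle R (rev ys)" "length (rev xs) = length (rev ys)" using cyc by auto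
    then obtain g where "g \<in> Aut" "map g (rev xs) = rev ys"
      using homogeneous unfolding ultrahomogeneous_def by blast
    then show "\<exists>g\<in>Aut. map g xs = ys" by (metis rev_map rev_rev_ident)
  qed
qed

context cyclic_stable_function begin

text \<open>For \<open>b < a\<close> left pushes compose; for \<open>a < b\<close> right pushes do. By uniqueness of absorbing
  ultrafilters, both kinds of pushes compute the same product.\<close>

lemma exchange_absorbing:
  assumes C: "finite C" "C \<noteq> {}" and ab: "a \<notin> C" "b \<notin> C" "a \<noteq> b"
    and k: "absorbing (insert a C) p" "absorbing (insert b C) q" "absorbing C r"
  shows "p \<odot> q \<simeq> r"
proof -
  obtain c where c: "c \<in> C" using C by blast
  show ?thesis
  proof (cases "lt c b a")
    case True
    then show ?thesis using exchange_less C c ab k by blast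
  next
    case False
    interpret reverse: cyclic_stable_function "\<lambda>x y z. R z y x" G \<phi> M
    proof (intro cyclic_stable_function.intro reversed cyclic_stable_function_axioms.intro)
      show "stable_function G \<phi> M" by (rule stable_function_axioms)
      show "G = carrier (aut_group (\<lambda>x y z. R z y x))" by (auto simp: G_eq aut_group_def)
    qed
    have "lt c a b" using False lt_total ab by blast
    moreover have "a \<noteq> c" "b \<noteq> c" using ab c by auto
    ultimately have "R a b c" using cyclicity by (auto simp: lt_def)
    then have "reverse.lt c b a" using ab by (simp add: reverse.lt_def)
    then show ?thesis using reverse.exchange_less C c ab k by blast
  qed
qed

definition absorber :: "'a set \<Rightarrow> ('a \<Rightarrow> 'a) filter" where
  "absorber A = (SOME p. absorbing A p)"

lemma absorbing_absorber: "finite A \<Longrightarrow> A \<noteq> {} \<Longrightarrow> absorbing A (absorber A)"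
  unfolding absorber_def using absorbing_exists by (metis someI)

lemma factorization: assumes g: "g \<in> G" shows "\<exists>b c h k. h \<in> fixing {b} \<and> k \<in> fixing {c} \<and> g = h \<circ> k"
proof -
  fix c :: 'a
  obtain b where b: "b \<notin> {c, g c}"
    using ex_new_if_finite[OF infinite_points, of "{c, g c}"] by auto
  then obtain h where h: "h \<in> Aut" "h b = b" "h c = g c" using move_pair[of b c b "g c"] by auto
  then have hG: "h \<in> G" by (simp add: in_G_iff)
  have "inv_map h (g c) = c" using inv_apply[OF hG, of c] h by simp
  then have "inv_map h \<circ> g \<in> fixing {c}" using g hG by (simp add: fixing_def comp_in inv_in)
  moreover have "h \<in> fixing {b}" using h hG by (simp add: fixing_def)
  moreover have "g = h \<circ> (inv_map h \<circ> g)" using hG by (simp add: fun_eq_iff)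
  ultimately show ?thesis by blast
qed

sublocale absorbers: absorbing_system G \<phi> M absorber
proof
  show "infinite (UNIV :: 'a set)" by (rule infinite_points)
  show "absorbing A (absorber A)" if "finite A" "A \<noteq> {}" for A using that by (rule absorbing_absorber)
  show "absorber (insert a C) \<odot> absorber (insert b C) \<simeq> absorber C"
    if "finite C" "C \<noteq> {}" "a \<notin> C" "b \<notin> C" "a \<noteq> b" for C a b
    using that by (intro exchange_absorbing[of C a b] absorbing_absorber) auto
  show "\<exists>b c h k. h \<in> fixing {b} \<and> k \<in> fixing {c} \<and> g = h \<circ> k" if "g \<in> G" for g
    by (rule factorization[OF that])
qed

end

section \<open>The graph compactification\<close>

abbreviation fell :: "'b set topology" where
  "fell \<equiv> fell_topology (discrete_topology UNIV)"

lemma topspace_fell [simp]: "topspace (fell :: 'b set topology) = UNIV"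
proof -
  have "(UNIV :: 'b set set) \<in> {{F. closedin (discrete_topology UNIV) F \<and> (\<forall>V\<in>\<V>. F \<inter> V \<noteq> {}) \<and> (\<forall>K\<in>\<K>. F \<inter> K = {})} | \<V> \<K>.
        finite \<V> \<and> (\<forall>V\<in>\<V>. openin (discrete_topology UNIV) V) \<and> finite \<K> \<and> (\<forall>K\<in>\<K>. compactin (discrete_topology UNIV) K)}"
    by (auto intro!: exI[of _ "{}"])
  from Union_upper[OF this] show ?thesis
    unfolding fell_topology_def topology_generated_by_topspace by (rule top_le)
qed

text \<open>On a discrete space the Fell topology is the topology of the Cantor cube of all subsets.\<close>

lemma fell_neighbourhood:
  fixes p :: "'b set"
  assumes "openin fell W" "p \<in> W"
  shows "\<exists>S. finite S \<and> (\<forall>q. q \<inter> S = p \<inter> S \<longrightarrow> q \<in> W)"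
proof -
  have "\<forall>p\<in>W. \<exists>S. finite S \<and> (\<forall>q. q \<inter> S = p \<inter> S \<longrightarrow> q \<in> W)"
    using openin_topology_generated_by[OF assms(1)[unfolded fell_topology_def]]
  proof (induction rule: generate_topology_on.induct)
    case (Int a b)
    show ?case
    proof
      fix p assume p: "p \<in> a \<inter> b"
      have pa: "p \<in> a" "p \<in> b" using p by simp_all
      from bspec[OF Int.IH(1) pa(1)] obtain S where
        S: "finite S \<and> (\<forall>q. q \<inter> S = p \<inter> S \<longrightarrow> q \<in> a)" ..
      from bspec[OF Int.IH(2) pa(2)] obtain S' where
        S': "finite S' \<and> (\<forall>q. q \<inter> S' = p \<inter> S' \<longrightarrow> q \<in> b)" ..
      have "q \<in> a \<inter> b" if q: "q \<inter> (S \<union> S') = p \<inter> (S \<union> S')" for q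
      proof -
        have "q \<inter> S = p \<inter> S" "q \<inter> S' = p \<inter> S'" using q by auto
        then show ?thesis using S S' by simp
      qed
      with S S' show "\<exists>S. finite S \<and> (\<forall>q. q \<inter> S = p \<inter> S \<longrightarrow> q \<in> a \<inter> b)" by (intro exI[of _ "S \<union> S'"]) simp
    qed
  next
    case (UN \<C>)
    show ?case
    proof
      fix p assume "p \<in> \<Union>\<C>"
      then obtain k where k: "k \<in> \<C>" "p \<in> k" by blast
      from bspec[OF UN.IH[OF k(1)] k(2)] obtain S where
        "finite S \<and> (\<forall>q. q \<inter> S = p \<inter> S \<longrightarrow> q \<in> k)" ..
      then show "\<exists>S. finite S \<and> (\<forall>q. q \<inter> S = p \<inter> S \<longrightarrow> q \<in> \<Union>\<C>)"
        using k(1) by (intro exI[of _ S]) auto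
    qed
  next
    case (Basis s)
    then obtain \<V> \<K> where s: "s = {F. closedin (discrete_topology UNIV) F \<and> (\<forall>V\<in>\<V>. F \<inter> V \<noteq> {}) \<and> (\<forall>K\<in>\<K>. F \<inter> K = {})}"
      and fin: "finite \<V>" "finite \<K>" "\<forall>K\<in>\<K>. compactin (discrete_topology UNIV) K" by auto
    show ?case
    proof
      fix p assume p: "p \<in> s"
      then have "\<forall>V\<in>\<V>. \<exists>x. x \<in> p \<inter> V" by (auto simp: s)
      then obtain f where f: "\<forall>V\<in>\<V>. f V \<in> p \<inter> V" by metis
      define S where "S = f ` \<V> \<union> \<Union>\<K>"
      have "finite S" using fin by (auto simp: S_def compactin_discrete_topology)
      moreover have "q \<in> s" if "q \<inter> S = p \<inter> S" for q
      proof -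
        have "q \<inter> V \<noteq> {}" if V: "V \<in> \<V>" for V
        proof -
          have "f V \<in> p \<inter> S" "f V \<in> V" using f V by (auto simp: S_def)
          then show ?thesis using \<open>q \<inter> S = p \<inter> S\<close> by blast
        qed
        moreover have "q \<inter> K = {}" if K: "K \<in> \<K>" for K
        proof -
          have "p \<inter> K = {}" "K \<subseteq> S" using p K by (auto simp: s S_def)
          then show ?thesis using \<open>q \<inter> S = p \<inter> S\<close> by blast
        qed
        ultimately show ?thesis by (simp add: s)
      qed
      ultimately show "\<exists>S. finite S \<and> (\<forall>q. q \<inter> S = p \<inter> S \<longrightarrow> q \<in> s)" by blast
    qed
  qed simp
  from bspec[OF this assms(2)] show ?thesis .
qed

lemma openin_fell_pattern:
  fixes S :: "'b set" assumes "finite S" shows "openin fell {q. q \<inter> S = p \<inter> S}"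
proof -
  have "{q. q \<inter> S = p \<inter> S} \<in> {{F. closedin (discrete_topology UNIV) F \<and> (\<forall>V\<in>\<V>. F \<inter> V \<noteq> {}) \<and> (\<forall>K\<in>\<K>. F \<inter> K = {})} | \<V> \<K>.
        finite \<V> \<and> (\<forall>V\<in>\<V>. openin (discrete_topology UNIV) V) \<and> finite \<K> \<and> (\<forall>K\<in>\<K>. compactin (discrete_topology UNIV) K)}"
    by (rule CollectI, rule exI[of _ "(\<lambda>x. {x}) ` (p \<inter> S)"], rule exI[of _ "{S - p}"])
      (use assms in \<open>auto simp: compactin_discrete_topology\<close>)
  then show ?thesis unfolding fell_topology_def by (rule topology_generated_by_Basis)
qed

lemma compact_space_fell: "compact_space (fell :: 'b set topology)"
proof -
  let ?P = "product_topology (\<lambda>_::'b. discrete_topology (UNIV::bool set)) UNIV"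
  have "continuous_map ?P fell Collect"
    unfolding continuous_map_def
  proof (intro conjI allI impI)
    fix W :: "'b set set" assume W: "openin fell W"
    show "openin ?P {P \<in> topspace ?P. Collect P \<in> W}"
    proof (subst openin_subopen, rule ballI)
      fix P assume "P \<in> {P \<in> topspace ?P. Collect P \<in> W}"
      then obtain S where S: "finite S" "\<forall>q. q \<inter> S = Collect P \<inter> S \<longrightarrow> q \<in> W"
        using fell_neighbourhood[OF W] by blast
      define N where "N = {Q \<in> topspace ?P. \<forall>x\<in>S. Q x = P x}"
      have N: "N = topspace ?P \<inter> (\<Inter>x\<in>S. {Q \<in> topspace ?P. Q x \<in> {P x}})" by (auto simp: N_def)
      have "openin ?P {Q \<in> topspace ?P. Q x \<in> {P x}}" for x
        by (rule openin_continuous_map_preimage[OF continuous_map_product_projection]) auto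
      then have "openin ?P N"
        unfolding N using S(1) openin_topspace[of ?P] by (cases "S = {}") auto
      moreover have "P \<in> N" by (simp add: N_def)
      moreover have "N \<subseteq> {P \<in> topspace ?P. Collect P \<in> W}"       proof
        fix Q assume Q: "Q \<in> N"
        then have "Collect Q \<inter> S = Collect P \<inter> S" by (auto simp: N_def)
        with S(2) have "Collect Q \<in> W" by blast
        with Q show "Q \<in> {P \<in> topspace ?P. Collect P \<in> W}" by (simp add: N_def)
      qed
      ultimately show "\<exists>T. openin ?P T \<and> P \<in> T \<and> T \<subseteq> {P \<in> topspace ?P. Collect P \<in> W}" by blast
    qed
  qed simp
  moreover have "compact_space ?P"
    by (simp add: compact_space_product_topology compact_space_discrete_topology)
  ultimately have "compactin fell (Collect ` topspace ?P)"
    using image_compactin compact_space_def by blast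
  moreover have "Collect ` topspace ?P = (UNIV :: 'b set set)"
    using surjI[of Collect "\<lambda>A x. x \<in> A"] by simp
  ultimately show ?thesis by (simp add: compact_space_def)
qed

lemma Hausdorff_space_fell: "Hausdorff_space (fell :: 'b set topology)"
  unfolding Hausdorff_space_def
proof (intro allI impI)
  fix p q :: "'b set" assume "p \<in> topspace fell \<and> q \<in> topspace fell \<and> p \<noteq> q"
  then obtain x where x: "x \<in> p \<longleftrightarrow> x \<notin> q" by blast
  have "openin fell {r. r \<inter> {x} = p \<inter> {x}}" "openin fell {r. r \<inter> {x} = q \<inter> {x}}"
    by (simp_all add: openin_fell_pattern)
  moreover have "disjnt {r. r \<inter> {x} = p \<inter> {x}} {r. r \<inter> {x} = q \<inter> {x}}" using x by (auto simp: disjnt_def)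
  ultimately show "\<exists>U V. openin fell U \<and> openin fell V \<and> p \<in> U \<and> q \<in> V \<and> disjnt U V" by blast
qed

locale permutation_monoid = permutation_group "carrier H" for H :: "('a \<Rightarrow> 'a) monoid" +
  assumes mult_H: "monoid.mult H = (\<circ>)"
begin

abbreviation T where "T \<equiv> permutation_topology H"

lemma topspace_T [simp]: "topspace T = carrier H" by (simp add: permutation_topology_def)

lemma openin_T_fixed_value: "openin T {g \<in> carrier H. g x = y}"
proof -
  let ?P = "product_topology (\<lambda>_::'a. discrete_topology (UNIV::'a set)) UNIV"
  have "openin ?P {g \<in> topspace ?P. g x \<in> {y}}"
    by (rule openin_continuous_map_preimage[OF continuous_map_product_projection]) auto
  then have "openin T (carrier H \<inter> {g \<in> topspace ?P. g x \<in> {y}})"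
    unfolding permutation_topology_def by (rule openin_subtopology_Int2)
  then show ?thesis by (simp add: Int_def)
qed

lemma openin_T_iff:
  "openin T W \<longleftrightarrow> W \<subseteq> carrier H \<and>
    (\<forall>g\<in>W. \<exists>F. finite F \<and> (\<forall>g'\<in>carrier H. (\<forall>x\<in>F. g' x = g x) \<longrightarrow> g' \<in> W))" (is "_ \<longleftrightarrow> ?R")
proof
  assume W: "openin T W"
  then obtain V where V: "openin (product_topology (\<lambda>_::'a. discrete_topology (UNIV::'a set)) UNIV) V"
    "W = V \<inter> carrier H" by (auto simp: permutation_topology_def openin_subtopology)
  show ?R
  proof (intro conjI ballI)
    show "W \<subseteq> carrier H" using V by auto
    fix g assume "g \<in> W"
    then have "g \<in> V" using V by auto
    then obtain U where U: "finite {i. U i \<noteq> (UNIV :: 'a set)}" "g \<in> Pi\<^sub>E UNIV U" "Pi\<^sub>E UNIV U \<subseteq> V"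
      using V(1)[unfolded openin_product_topology_alt] by auto
    have "g' \<in> W" if "g' \<in> carrier H" "\<forall>x\<in>{i. U i \<noteq> (UNIV :: 'a set)}. g' x = g x" for g'
    proof -
      have "g' x \<in> U x" for x
        using that(2) U(2) by (cases "U x = UNIV") (auto simp: PiE_iff)
      then have "g' \<in> Pi\<^sub>E UNIV U" by auto
      then show ?thesis using U V that by auto
    qed
    with U(1) show "\<exists>F. finite F \<and> (\<forall>g'\<in>carrier H. (\<forall>x\<in>F. g' x = g x) \<longrightarrow> g' \<in> W)" by blast
  qed
next
  assume R: ?R
  show "openin T W"
  proof (subst openin_subopen, rule ballI)
    fix g assume g: "g \<in> W"
    then obtain F where F: "finite F" "\<forall>g'\<in>carrier H. (\<forall>x\<in>F. g' x = g x) \<longrightarrow> g' \<in> W" using R by blast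
    let ?N = "carrier H \<inter> (\<Inter>x\<in>F. {h \<in> carrier H. h x = g x})"
    have top: "openin T (carrier H)" using openin_topspace[of T] by simp
    have "openin T ?N"
    proof (cases "F = {}")
      case True then show ?thesis using top by simp
    next
      case False
      then show ?thesis using F(1) openin_T_fixed_value by (intro openin_Int top openin_INT2) auto
    qed
    moreover have "g \<in> ?N" using g R by auto
    moreover have "?N \<subseteq> W" using F(2) by auto
    ultimately show "\<exists>U. openin T U \<and> g \<in> U \<and> U \<subseteq> W" by blast
  qed
qed

text \<open>The elements are the binary relations that agree with graphs of group elements on all finite sets; as
  group elements are bijections, these relations are graphs of injective partial maps.\<close>

definition limits :: "('a \<times> 'a) set set" where
  "limits = Abstract_Topology.closure_of fell (function_graph ` carrier H)"

abbreviation KT where "KT \<equiv> subtopology fell limits"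

lemma graph_compactification_eq: "graph_compactification H = (KT, function_graph)"
  by (simp add: graph_compactification_def limits_def Let_def)

lemma topspace_KT [simp]: "topspace KT = limits" by simp

lemma mem_function_graph [simp]: "(x, y) \<in> function_graph g \<longleftrightarrow> g x = y"
  by (auto simp: function_graph_def)

lemma limits_iff:
  "p \<in> limits \<longleftrightarrow> (\<forall>S. finite S \<longrightarrow> (\<exists>g\<in>carrier H. function_graph g \<inter> S = p \<inter> S))"
proof
  assume p: "p \<in> limits"
  show "\<forall>S. finite S \<longrightarrow> (\<exists>g\<in>carrier H. function_graph g \<inter> S = p \<inter> S)"
  proof (intro allI impI)
    fix S :: "('a \<times> 'a) set" assume "finite S"
    then have "p \<in> {q. q \<inter> S = p \<inter> S} \<and> openin fell {q. q \<inter> S = p \<inter> S}"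
      by (simp add: openin_fell_pattern)
    with p obtain q where "q \<in> function_graph ` carrier H" "q \<in> {q. q \<inter> S = p \<inter> S}"
      unfolding limits_def in_closure_of by meson
    then show "\<exists>g\<in>carrier H. function_graph g \<inter> S = p \<inter> S" by auto
  qed
next
  assume *: "\<forall>S. finite S \<longrightarrow> (\<exists>g\<in>carrier H. function_graph g \<inter> S = p \<inter> S)"
  show "p \<in> limits"
    unfolding limits_def in_closure_of
  proof (intro conjI allI impI)
    fix W assume "p \<in> W \<and> openin fell W"
    then obtain S where S: "finite S" "\<forall>q. q \<inter> S = p \<inter> S \<longrightarrow> q \<in> W" using fell_neighbourhood[of W p] by blast
    from * S(1) obtain g where g: "g \<in> carrier H" "function_graph g \<inter> S = p \<inter> S" by blast
    with S(2) have "function_graph g \<in> W" by simp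
    with g(1) show "\<exists>y. y \<in> function_graph ` carrier H \<and> y \<in> W" by blast
  qed simp
qed

lemma graph_agreeing:
  assumes "p \<in> limits" "finite S" obtains g where "g \<in> carrier H" "function_graph g \<inter> S = p \<inter> S"
  using assms limits_iff by blast

lemma graph_in_limits: "g \<in> carrier H \<Longrightarrow> function_graph g \<in> limits"
  unfolding limits_iff by blast

lemma limits_injective:
  assumes "p \<in> limits" "(x, y) \<in> p" "(x', y) \<in> p" shows "x = x'"
proof -
  obtain g where g: "g \<in> carrier H" "function_graph g \<inter> {(x,y),(x',y)} = p \<inter> {(x,y),(x',y)}"
    using graph_agreeing[OF assms(1), of "{(x,y),(x',y)}"] by auto
  then have "(x,y) \<in> function_graph g" "(x',y) \<in> function_graph g" using assms by blast+
  then have "g x = g x'" by simp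
  then show ?thesis using inv_apply[OF g(1), of x] inv_apply[OF g(1), of x'] by metis
qed

lemma openin_KT_iff:
  "openin KT W \<longleftrightarrow> W \<subseteq> limits \<and>
    (\<forall>p\<in>W. \<exists>S. finite S \<and> (\<forall>q\<in>limits. q \<inter> S = p \<inter> S \<longrightarrow> q \<in> W))" (is "_ \<longleftrightarrow> ?R")
proof
  assume "openin KT W"
  then obtain V where V: "openin fell V" "W = V \<inter> limits" by (auto simp: openin_subtopology)
  show ?R
  proof (intro conjI ballI)
    show "W \<subseteq> limits" using V(2) by simp
    fix p assume "p \<in> W"
    then obtain S where "finite S" "\<forall>q. q \<inter> S = p \<inter> S \<longrightarrow> q \<in> V"
      using fell_neighbourhood[OF V(1), of p] V(2) by auto
    then show "\<exists>S. finite S \<and> (\<forall>q\<in>limits. q \<inter> S = p \<inter> S \<longrightarrow> q \<in> W)"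
      using V(2) by (intro exI[of _ S]) simp
  qed
next
  assume R: ?R
  then have "\<forall>p. \<exists>S. p \<in> W \<longrightarrow> finite S \<and> (\<forall>q\<in>limits. q \<inter> S = p \<inter> S \<longrightarrow> q \<in> W)" by blast
  then obtain S where S: "\<And>p. p \<in> W \<Longrightarrow> finite (S p)"
    "\<And>p q. p \<in> W \<Longrightarrow> q \<in> limits \<Longrightarrow> q \<inter> S p = p \<inter> S p \<Longrightarrow> q \<in> W"
    by metis
  define V where "V = (\<Union>p\<in>W. {q. q \<inter> S p = p \<inter> S p})"
  have "openin fell V" unfolding V_def by (intro openin_Union) (auto intro: openin_fell_pattern S(1))
  moreover have "W = V \<inter> limits"
  proof
    show "W \<subseteq> V \<inter> limits" using R unfolding V_def by auto
    show "V \<inter> limits \<subseteq> W" unfolding V_def using S(2) by auto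
  qed
  ultimately show "openin KT W" by (auto simp: openin_subtopology)
qed

lemma continuous_KT_iff:
  fixes F :: "('a \<times> 'a) set \<Rightarrow> complex"
  shows "continuous_map KT euclidean F \<longleftrightarrow>
    (\<forall>p\<in>limits. \<forall>e>0. \<exists>S. finite S \<and> (\<forall>q\<in>limits. q \<inter> S = p \<inter> S \<longrightarrow> norm (F q - F p) < e))" (is "_ \<longleftrightarrow> ?R")
proof
  assume c: "continuous_map KT euclidean F"
  show ?R
  proof (intro ballI allI impI)
    fix p and e :: real assume p: "p \<in> limits" and e: "e > 0"
    have "openin KT {q \<in> topspace KT. F q \<in> ball (F p) e}"
      by (rule openin_continuous_map_preimage[OF c]) simp
    moreover have "p \<in> {q \<in> topspace KT. F q \<in> ball (F p) e}" using p e by simp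
    ultimately obtain S where "finite S" "\<forall>q\<in>limits. q \<inter> S = p \<inter> S \<longrightarrow> q \<in> {q \<in> topspace KT. F q \<in> ball (F p) e}"
      unfolding openin_KT_iff by blast
    then show "\<exists>S. finite S \<and> (\<forall>q\<in>limits. q \<inter> S = p \<inter> S \<longrightarrow> norm (F q - F p) < e)"
      by (intro exI[of _ S]) (auto simp: dist_norm norm_minus_commute)
  qed
next
  assume R: ?R
  show "continuous_map KT euclidean F"
    unfolding continuous_map_def
  proof (intro conjI allI impI)
    fix U :: "complex set" assume "openin euclidean U"
    then have U: "open U" by simp
    show "openin KT {p \<in> topspace KT. F p \<in> U}"
      unfolding openin_KT_iff
    proof (intro conjI ballI)
      fix p assume p: "p \<in> {p \<in> topspace KT. F p \<in> U}"
      then obtain e where e: "e > 0" "ball (F p) e \<subseteq> U" using U open_contains_ball by blast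
      have "p \<in> limits" using p by simp
      from R[rule_format, OF this e(1)] obtain S where
        S: "finite S" "\<forall>q\<in>limits. q \<inter> S = p \<inter> S \<longrightarrow> norm (F q - F p) < e" by blast
      then have "\<forall>q\<in>limits. q \<inter> S = p \<inter> S \<longrightarrow> F q \<in> U"
        using e(2) by (auto simp: subset_iff dist_norm norm_minus_commute)
      with S(1) show "\<exists>S. finite S \<and> (\<forall>q\<in>limits. q \<inter> S = p \<inter> S \<longrightarrow> q \<in> {p \<in> topspace KT. F p \<in> U})"
        by auto
    qed auto
  qed simp
qed

lemma compact_KT: "compact_space KT"
  unfolding limits_def
  by (intro compact_space_subtopology closedin_compact_space compact_space_fell closedin_closure_of)

lemma Hausdorff_KT: "Hausdorff_space KT"
  using Hausdorff_space_fell by (rule Hausdorff_space_subtopology)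

text \<open>The composition of the relation \<open>p\<close> with the map \<open>h\<close>, applied first.\<close>

definition act :: "('a \<times> 'a) set \<Rightarrow> ('a \<Rightarrow> 'a) \<Rightarrow> ('a \<times> 'a) set" where
  "act p h = {(x, y). (h x, y) \<in> p}"

lemma act_graph: "act (function_graph g) h = function_graph (g \<circ> h)"
  by (auto simp: act_def)

lemma act_inter_cong:
  assumes "q \<inter> (\<lambda>(x, y). (h x, y)) ` S = p \<inter> (\<lambda>(x, y). (h x, y)) ` S"
  shows "act q h \<inter> S = act p h \<inter> S"
proof -
  have "(x, y) \<in> act q h \<longleftrightarrow> (x, y) \<in> act p h" if "(x, y) \<in> S" for x y
  proof -
    have "(h x, y) \<in> (\<lambda>(x, y). (h x, y)) ` S" using that by force
    then show ?thesis using assms by (auto simp: act_def)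
  qed
  then show ?thesis by auto
qed

lemma act_in_limits:
  assumes p: "p \<in> limits" and h: "h \<in> carrier H" shows "act p h \<in> limits"
  unfolding limits_iff
proof (intro allI impI)
  fix S :: "('a \<times> 'a) set" assume S: "finite S"
  have "finite ((\<lambda>(x, y). (h x, y)) ` S)" using S by simp
  then obtain g where g: "g \<in> carrier H"
    "function_graph g \<inter> (\<lambda>(x, y). (h x, y)) ` S = p \<inter> (\<lambda>(x, y). (h x, y)) ` S"
    using graph_agreeing[OF p] by blast
  have "function_graph (g \<circ> h) \<inter> S = act p h \<inter> S"
    using act_inter_cong[OF g(2)] by (simp add: act_graph)
  then show "\<exists>g\<in>carrier H. function_graph g \<inter> S = act p h \<inter> S" using comp_in[OF g(1) h] by blast
qed

lemma continuous_act:
  assumes p: "p \<in> limits" shows "continuous_map T KT (act p)"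
  unfolding continuous_map_def
proof (intro conjI allI impI)
  show "act p \<in> topspace T \<rightarrow> topspace KT" using act_in_limits[OF p] by simp
  fix W assume W: "openin KT W"
  show "openin T {h \<in> topspace T. act p h \<in> W}"
    unfolding openin_T_iff
  proof (intro conjI ballI)
    fix h assume "h \<in> {h \<in> topspace T. act p h \<in> W}"
    then obtain S where S: "finite S" "\<forall>q\<in>limits. q \<inter> S = act p h \<inter> S \<longrightarrow> q \<in> W"
      using W unfolding openin_KT_iff by blast
    have "act p h' \<in> W" if "h' \<in> carrier H" "\<forall>x\<in>fst ` S. h' x = h x" for h'
    proof -
      have "act p h' \<inter> S = act p h \<inter> S" using that(2) by (force simp: act_def)
      then show ?thesis using S(2) act_in_limits[OF p that(1)] by blast
    qed
    with S(1) show "\<exists>F. finite F \<and> (\<forall>g'\<in>carrier H. (\<forall>x\<in>F. g' x = h x) \<longrightarrow> g' \<in> {h \<in> topspace T. act p h \<in> W})"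
      by (intro exI[of _ "fst ` S"]) auto
  qed auto
qed

lemma act_graph_id: "act (function_graph id) h = function_graph h"
  by (simp add: act_graph)

lemma continuous_graph: "continuous_map T KT function_graph"
  using continuous_act[OF graph_in_limits[OF id_in]] by (simp add: act_graph_id[abs_def])

lemma compactification_graph: "compactification T (graph_compactification H)"
proof -
  have "Abstract_Topology.closure_of KT (function_graph ` carrier H) = limits"
    using closure_of_subset[of "function_graph ` carrier H" fell]
    by (simp add: closure_of_subtopology limits_def Int_absorb1 Int_absorb2)
  then show ?thesis
    using compact_KT Hausdorff_KT continuous_graph
    by (simp add: compactification_def graph_compactification_eq)
qed

text \<open>The extension is the limit of \<open>\<phi>\<close> along group elements whose graphs converge to the given
  relation. The hypothesis says that \<open>\<phi>\<close> is uniformly continuous for the uniformity induced by the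
  compactification.\<close>

lemma extend_to_limits:
  fixes \<phi> :: "('a \<Rightarrow> 'a) \<Rightarrow> complex"
  assumes bd: "\<And>g. g \<in> carrier H \<Longrightarrow> norm (\<phi> g) \<le> M"
    and pat: "\<And>e. e > 0 \<Longrightarrow> \<exists>S. finite S \<and> (\<forall>g\<in>carrier H. \<forall>g'\<in>carrier H.
      function_graph g \<inter> S = function_graph g' \<inter> S \<longrightarrow> norm (\<phi> g - \<phi> g') \<le> e)"
  obtains F where "continuous_map KT euclidean F" "\<And>g. g \<in> carrier H \<Longrightarrow> F (function_graph g) = \<phi> g"
proof -
  have "\<exists>U. ultrafilter U \<and> eventually (\<lambda>g. g \<in> carrier H) U \<and>
      (\<forall>S. finite S \<longrightarrow> eventually (\<lambda>g. function_graph g \<inter> S = p \<inter> S) U)" if p: "p \<in> limits" for p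
  proof -
    define B where "B S = {g \<in> carrier H. function_graph g \<inter> S = p \<inter> S}" for S
    have ev: "eventually P (INF S\<in>{S. finite S}. principal (B S)) \<longleftrightarrow> (\<exists>S\<in>{S. finite S}. eventually P (principal (B S)))" for P
    proof (rule eventually_INF_base)
      fix S S' :: "('a \<times> 'a) set" assume "S \<in> {S. finite S}" "S' \<in> {S. finite S}"
      moreover have "B (S \<union> S') \<subseteq> B S \<inter> B S'" unfolding B_def by blast
      ultimately show "\<exists>x\<in>{S. finite S}. principal (B x) \<le> inf (principal (B S)) (principal (B S'))"
        by (intro bexI[of _ "S \<union> S'"]) auto
    qed auto
    have ne: "B S \<noteq> {}" if S: "finite S" for S
    proof -
      obtain g where "g \<in> carrier H" "function_graph g \<inter> S = p \<inter> S" using graph_agreeing[OF p S] .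
      then have "g \<in> B S" by (simp add: B_def)
      then show ?thesis by blast
    qed
    have "(INF S\<in>{S. finite S}. principal (B S)) \<noteq> bot"
      using ne by (auto simp: trivial_limit_def ev eventually_principal)
    then obtain U where U: "ultrafilter U" "U \<le> (INF S\<in>{S. finite S}. principal (B S))" by (rule ultrafilter_below)
    have B: "eventually (\<lambda>g. g \<in> B S) U" if "finite S" for S
      by (rule filter_leD[OF U(2)]) (use that in \<open>auto simp: ev eventually_principal\<close>)
    have "eventually (\<lambda>g. g \<in> carrier H) U" using B[of "{}"] by (auto simp: B_def elim: eventually_mono)
    moreover have "eventually (\<lambda>g. function_graph g \<inter> S = p \<inter> S) U" if "finite S" for S
      using B[OF that] by (auto simp: B_def elim: eventually_mono)
    ultimately show ?thesis using U(1) by blast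
  qed
  then obtain U where U: "\<And>p. p \<in> limits \<Longrightarrow> ultrafilter (U p)"
    "\<And>p. p \<in> limits \<Longrightarrow> eventually (\<lambda>g. g \<in> carrier H) (U p)"
    "\<And>p S. p \<in> limits \<Longrightarrow> finite S \<Longrightarrow> eventually (\<lambda>g. function_graph g \<inter> S = p \<inter> S) (U p)"
    by metis
  define F where "F p = Lim (U p) \<phi>" for p
  have key: "\<exists>S. finite S \<and> (\<forall>p\<in>limits. \<forall>g\<in>carrier H. function_graph g \<inter> S = p \<inter> S \<longrightarrow> norm (F p - \<phi> g) \<le> e)"
    if e: "e > 0" for e :: real
  proof -
    obtain S where S: "finite S" "\<forall>g\<in>carrier H. \<forall>g'\<in>carrier H.
      function_graph g \<inter> S = function_graph g' \<inter> S \<longrightarrow> norm (\<phi> g - \<phi> g') \<le> e" using pat[OF e] by blast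
    have "norm (F p - \<phi> g) \<le> e" if p: "p \<in> limits" and g: "g \<in> carrier H" "function_graph g \<inter> S = p \<inter> S" for p g
      unfolding F_def
    proof (rule Lim_dist_le[OF U(1)[OF p]])
      show "eventually (\<lambda>g. norm (\<phi> g) \<le> M) (U p)" using U(2)[OF p] by eventually_elim (rule bd)
      show "eventually (\<lambda>h. norm (\<phi> h - \<phi> g) \<le> e) (U p)"
        using U(2)[OF p] U(3)[OF p S(1)] by eventually_elim (use S(2) g in auto)
    qed
    then show ?thesis using S(1) by blast
  qed
  show thesis
  proof (rule that)
    show "F (function_graph g) = \<phi> g" if g: "g \<in> carrier H" for g
    proof -
      have "norm (F (function_graph g) - \<phi> g) \<le> e" if "e > 0" for e
        using key[OF that] graph_in_limits[OF g] g by blast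
      then have "norm (F (function_graph g) - \<phi> g) \<le> 0" by (rule field_le_epsilon[of _ 0, simplified])
      then show ?thesis by simp
    qed
    show "continuous_map KT euclidean F"
      unfolding continuous_KT_iff
    proof (intro ballI allI impI)
      fix p and e :: real assume p: "p \<in> limits" and "e > 0"
      then have "e / 3 > 0" by simp
      from key[OF this] obtain S where S: "finite S"
        "\<And>p g. p \<in> limits \<Longrightarrow> g \<in> carrier H \<Longrightarrow> function_graph g \<inter> S = p \<inter> S \<Longrightarrow> norm (F p - \<phi> g) \<le> e / 3" by blast
      obtain g where g: "g \<in> carrier H" "function_graph g \<inter> S = p \<inter> S" using graph_agreeing[OF p S(1)] .
      have "norm (F q - F p) < e" if q: "q \<in> limits" "q \<inter> S = p \<inter> S" for q
      proof -
        have "norm (F q - F p) \<le> e / 3 + e / 3"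
          using S(2)[OF q(1) g(1)] S(2)[OF p g] g(2) q(2)
          by (intro norm_diff_triangle_le[of _ "\<phi> g"]) (auto simp: norm_minus_commute)
        then show ?thesis using \<open>e > 0\<close> by simp
      qed
      with S(1) show "\<exists>S. finite S \<and> (\<forall>q\<in>limits. q \<inter> S = p \<inter> S \<longrightarrow> norm (F q - F p) < e)" by blast
    qed
  qed
qed

end

section \<open>Weakly almost periodic functions have the double limit property\<close>

context permutation_monoid begin

lemma Cb_iff: "f \<in> Cb T \<longleftrightarrow> f \<in> extensional (carrier H) \<and> continuous_map T euclidean f \<and>
    (\<exists>C. \<forall>g\<in>carrier H. norm (f g) \<le> C)"
  by (auto simp: Cb_def bounded_iff)

lemma continuous_map_restrict_T:
  "continuous_map T euclidean f \<Longrightarrow> continuous_map T euclidean (\<lambda>x\<in>carrier H. f x)"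
  by (rule continuous_map_eq) auto

lemma Cb_add: assumes "f \<in> Cb T" "g \<in> Cb T" shows "(\<lambda>x\<in>carrier H. f x + g x) \<in> Cb T"
proof -
  obtain C D where "\<forall>x\<in>carrier H. norm (f x) \<le> C" "\<forall>x\<in>carrier H. norm (g x) \<le> D"
    using assms unfolding Cb_iff by blast
  then have "\<forall>x\<in>carrier H. norm (f x + g x) \<le> C + D" using norm_triangle_mono by blast
  moreover have "continuous_map T euclidean (\<lambda>x. f x + g x)"
    using assms by (intro continuous_map_add) (auto simp: Cb_iff)
  ultimately show ?thesis using continuous_map_restrict_T unfolding Cb_iff by auto
qed

lemma Cb_scale: assumes "f \<in> Cb T" shows "(\<lambda>x\<in>carrier H. c * f x) \<in> Cb T"
proof -
  obtain C where "\<forall>x\<in>carrier H. norm (f x) \<le> C" using assms unfolding Cb_iff by blast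
  then have "\<forall>x\<in>carrier H. norm (c * f x) \<le> norm c * C" by (simp add: norm_mult mult_left_mono)
  moreover have "continuous_map T euclidean (\<lambda>x. c * f x)"
    using assms by (simp add: Cb_iff continuous_map_atin tendsto_mult)
  ultimately show ?thesis using continuous_map_restrict_T unfolding Cb_iff by auto
qed

lemma Cb_zero: "(\<lambda>x\<in>carrier H. 0) \<in> Cb T"
  unfolding Cb_iff
  by (intro conjI restrict_extensional continuous_map_restrict_T exI[of _ 0]) simp_all

lemma Cb_sum:
  assumes "finite I" "\<And>i. i \<in> I \<Longrightarrow> f i \<in> Cb T"
  shows "(\<lambda>x\<in>carrier H. \<Sum>i\<in>I. c i * f i x) \<in> Cb T"
  using assms
proof (induction I)
  case empty
  show ?case unfolding sum.empty by (rule Cb_zero)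
next
  case (insert i I)
  have 1: "(\<lambda>x\<in>carrier H. c i * f i x) \<in> Cb T" by (intro Cb_scale insert.prems) simp
  have 2: "(\<lambda>x\<in>carrier H. \<Sum>i\<in>I. c i * f i x) \<in> Cb T" by (rule insert.IH) (simp add: insert.prems)
  have "(\<lambda>x\<in>carrier H. \<Sum>i\<in>insert i I. c i * f i x) =
      (\<lambda>x\<in>carrier H. (\<lambda>x\<in>carrier H. c i * f i x) x + (\<lambda>x\<in>carrier H. \<Sum>i\<in>I. c i * f i x) x)"
    using insert.hyps by (intro restrict_ext) simp
  then show ?case using Cb_add[OF 1 2] by (simp only:)
qed

lemma dual_add: "L \<in> dual_Cb T \<Longrightarrow> f \<in> Cb T \<Longrightarrow> g \<in> Cb T \<Longrightarrow> L (\<lambda>x\<in>carrier H. f x + g x) = L f + L g"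
  and dual_scale: "L \<in> dual_Cb T \<Longrightarrow> f \<in> Cb T \<Longrightarrow> L (\<lambda>x\<in>carrier H. c * f x) = c * L f"
  by (auto simp: dual_Cb_def linear_functional_on_def)

lemma dual_zero: assumes L: "L \<in> dual_Cb T" shows "L (\<lambda>x\<in>carrier H. 0) = 0"
proof -
  have "(\<lambda>x\<in>carrier H. 0 * (\<lambda>x\<in>carrier H. 0) x) = (\<lambda>x\<in>carrier H. 0 :: complex)"
    by (rule restrict_ext) simp
  then show ?thesis using dual_scale[OF L Cb_zero, of 0] by (simp only: mult_zero_left)
qed

lemma dual_sum:
  assumes L: "L \<in> dual_Cb T" and "finite I" "\<And>i. i \<in> I \<Longrightarrow> f i \<in> Cb T"
  shows "L (\<lambda>x\<in>carrier H. \<Sum>i\<in>I. c i * f i x) = (\<Sum>i\<in>I. c i * L (f i))"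
  using assms(2,3)
proof (induction I)
  case empty
  show ?case unfolding sum.empty by (rule dual_zero[OF L])
next
  case (insert i I)
  have i: "f i \<in> Cb T" "(\<lambda>x\<in>carrier H. c i * f i x) \<in> Cb T" by (intro Cb_scale insert.prems; simp)+
  have I: "(\<lambda>x\<in>carrier H. \<Sum>i\<in>I. c i * f i x) \<in> Cb T" using insert by (intro Cb_sum) auto
  have "(\<lambda>x\<in>carrier H. \<Sum>i\<in>insert i I. c i * f i x) =
      (\<lambda>x\<in>carrier H. (\<lambda>x\<in>carrier H. c i * f i x) x + (\<lambda>x\<in>carrier H. \<Sum>i\<in>I. c i * f i x) x)"
    using insert.hyps by (intro restrict_ext) simp
  then have "L (\<lambda>x\<in>carrier H. \<Sum>i\<in>insert i I. c i * f i x) = c i * L (f i) + L (\<lambda>x\<in>carrier H. \<Sum>i\<in>I. c i * f i x)"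
    by (simp only: dual_add[OF L i(2) I] dual_scale[OF L i(1)])
  also have "L (\<lambda>x\<in>carrier H. \<Sum>i\<in>I. c i * f i x) = (\<Sum>i\<in>I. c i * L (f i))"
    by (rule insert.IH) (simp add: insert.prems)
  finally show ?case using insert.hyps by simp
qed

lemma sup_norm_le: "(\<And>x. x \<in> carrier H \<Longrightarrow> norm (f x) \<le> C) \<Longrightarrow> sup_norm (carrier H) f \<le> C"
  unfolding sup_norm_def by (rule cSUP_least) (use id_in in blast)+

lemma norm_le_sup_norm: assumes "f \<in> Cb T" "x \<in> carrier H" shows "norm (f x) \<le> sup_norm (carrier H) f"
  unfolding sup_norm_def
proof (rule cSUP_upper[OF assms(2)])
  obtain C where "\<forall>g\<in>carrier H. norm (f g) \<le> C" using assms(1) unfolding Cb_iff by blast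
  then show "bdd_above ((\<lambda>x. norm (f x)) ` carrier H)" by (intro bdd_aboveI[of _ C]) auto
qed

lemma dual_bound:
  assumes "L \<in> dual_Cb T"
  obtains K where "K > 0" "\<And>f C. f \<in> Cb T \<Longrightarrow> (\<And>x. x \<in> carrier H \<Longrightarrow> norm (f x) \<le> C) \<Longrightarrow> norm (L f) \<le> K * C"
proof -
  obtain K where K: "\<forall>f\<in>Cb T. norm (L f) \<le> K * sup_norm (carrier H) f" using assms by (auto simp: dual_Cb_def)
  have "norm (L f) \<le> (\<bar>K\<bar> + 1) * C" if f: "f \<in> Cb T" "\<And>x. x \<in> carrier H \<Longrightarrow> norm (f x) \<le> C" for f C
  proof -
    have "0 \<le> sup_norm (carrier H) f" using norm_le_sup_norm[OF f(1) id_in] norm_ge_zero order_trans by blast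
    moreover have "sup_norm (carrier H) f \<le> C" using f(2) by (rule sup_norm_le)
    ultimately have "K * sup_norm (carrier H) f \<le> (\<bar>K\<bar> + 1) * C" by (intro mult_mono) auto
    then show ?thesis using K f(1) by fastforce
  qed
  then show thesis by (intro that[of "\<bar>K\<bar> + 1"]) auto
qed

text \<open>Limits along ultrafilters are bounded functionals; evaluations are the case of principal ultrafilters.\<close>

lemma ultralimit_dual:
  assumes q: "on_group q" shows "(\<lambda>f. Lim q f) \<in> dual_Cb T"
proof -
  have lim: "(f \<longlongrightarrow> Lim q f) q" if f: "f \<in> Cb T" for f
  proof -
    obtain C where C: "\<forall>g\<in>carrier H. norm (f g) \<le> C" using f unfolding Cb_iff by blast
    show ?thesis
      using on_groupD[OF q] C by (intro ultrafilter_tendsto_Lim[of _ _ C]) (auto elim: eventually_mono)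
  qed
  have restr: "Lim q (\<lambda>x\<in>carrier H. f x) = Lim q f" for f :: "_ \<Rightarrow> complex"
    using on_groupD(2)[OF q] by (intro Lim_eventually_cong) (auto elim: eventually_mono)
  have "linear_functional_on (carrier H) (Cb T) (\<lambda>f. Lim q f)"
    unfolding linear_functional_on_def restr
    using on_groupD(1)[OF q] by (auto intro!: Lim_eqI tendsto_add tendsto_mult lim)
  moreover have "norm (Lim q f) \<le> 1 * sup_norm (carrier H) f" if "f \<in> Cb T" for f
    using on_groupD[OF q] norm_le_sup_norm[OF that] by (auto intro!: Lim_norm_le elim: eventually_mono)
  ultimately show ?thesis unfolding dual_Cb_def topspace_T by blast
qed

lemma evaluation_dual: assumes "g \<in> carrier H" shows "(\<lambda>f. f g) \<in> dual_Cb T"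
  using ultralimit_dual[OF on_group_pt[OF assms]] by (simp add: Lim_principal)

abbreviation weak where "weak \<equiv> weak_topology_Cb T"

lemma openin_weak: "L \<in> dual_Cb T \<Longrightarrow> open U \<Longrightarrow> openin weak {f \<in> Cb T. L f \<in> U}"
  unfolding weak_topology_Cb_def by (rule topology_generated_by_Basis) auto

lemma topspace_weak [simp]: "topspace weak = Cb T"
proof -
  have "Cb T \<in> {{f \<in> Cb T. L f \<in> U} | L U. L \<in> dual_Cb T \<and> open U}"
    using evaluation_dual[OF id_in] by (auto intro!: exI[of _ "\<lambda>f. f id"] exI[of _ UNIV])
  then show ?thesis unfolding weak_topology_Cb_def topology_generated_by_topspace by auto
qed

lemma Hausdorff_weak: "Hausdorff_space weak"
  unfolding Hausdorff_space_def
proof (intro allI impI)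
  fix f f' assume "f \<in> topspace weak \<and> f' \<in> topspace weak \<and> f \<noteq> f'"
  then have f: "f \<in> Cb T" "f' \<in> Cb T" "f \<noteq> f'" by auto
  then obtain x where x: "x \<in> carrier H" "f x \<noteq> f' x"
    unfolding Cb_iff by (metis extensionalityI)
  obtain U V where UV: "open U" "open V" "f x \<in> U" "f' x \<in> V" "U \<inter> V = {}" using hausdorff[OF x(2)] by blast
  have "openin weak {f \<in> Cb T. f x \<in> U}" "openin weak {f \<in> Cb T. f x \<in> V}"
    using openin_weak[OF evaluation_dual[OF x(1)]] UV by auto
  then show "\<exists>U V. openin weak U \<and> openin weak V \<and> f \<in> U \<and> f' \<in> V \<and> disjnt U V"
    by (intro exI[of _ "{f \<in> Cb T. f x \<in> U}"] exI[of _ "{f \<in> Cb T. f x \<in> V}"] conjI)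
      (use UV f in \<open>auto simp: disjnt_def\<close>)
qed

lemma translate_eq: "translate H g \<phi> = (\<lambda>h\<in>carrier H. \<phi> (g \<circ> h))"
  by (simp add: translate_def mult_H)

lemma WAP_Cb: "\<phi> \<in> WAP H T \<Longrightarrow> \<phi> \<in> Cb T" by (simp add: WAP_def)

lemma Cb_continuous:
  assumes "\<phi> \<in> Cb T" "g \<in> carrier H" "e > 0"
  shows "\<exists>F. finite F \<and> (\<forall>g'\<in>carrier H. (\<forall>x\<in>F. g' x = g x) \<longrightarrow> norm (\<phi> g' - \<phi> g) < e)"
proof -
  have "continuous_map T euclidean \<phi>" using assms(1) by (simp add: Cb_iff)
  then have "openin T {h \<in> topspace T. \<phi> h \<in> ball (\<phi> g) e}" by (rule openin_continuous_map_preimage) simp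
  moreover have "g \<in> {h \<in> topspace T. \<phi> h \<in> ball (\<phi> g) e}" using assms by simp
  ultimately obtain F where "finite F"
    "\<forall>g'\<in>carrier H. (\<forall>x\<in>F. g' x = g x) \<longrightarrow> g' \<in> {h \<in> topspace T. \<phi> h \<in> ball (\<phi> g) e}"
    unfolding openin_T_iff by blast
  then show ?thesis by (intro exI[of _ F]) (auto simp: dist_norm norm_minus_commute)
qed

lemma translate_Cb: assumes "\<phi> \<in> Cb T" "g \<in> carrier H" shows "translate H g \<phi> \<in> Cb T"
proof -
  have "continuous_map T T (\<lambda>h. g \<circ> h)"
    unfolding continuous_map_def
  proof (intro conjI allI impI)
    show "(\<lambda>h. g \<circ> h) \<in> topspace T \<rightarrow> topspace T" using assms(2) comp_in by auto
    fix W assume W: "openin T W"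
    show "openin T {h \<in> topspace T. g \<circ> h \<in> W}"
      unfolding openin_T_iff
    proof (intro conjI ballI)
      fix h assume "h \<in> {h \<in> topspace T. g \<circ> h \<in> W}"
      then obtain F where F: "finite F" "\<forall>g'\<in>carrier H. (\<forall>x\<in>F. g' x = (g \<circ> h) x) \<longrightarrow> g' \<in> W"
        using W unfolding openin_T_iff by blast
      then show "\<exists>F. finite F \<and> (\<forall>g'\<in>carrier H. (\<forall>x\<in>F. g' x = h x) \<longrightarrow> g' \<in> {h \<in> topspace T. g \<circ> h \<in> W})"
        using assms(2) comp_in by (intro exI[of _ F]) auto
    qed auto
  qed
  moreover have "continuous_map T euclidean \<phi>" using assms by (simp add: Cb_iff)
  ultimately have "continuous_map T euclidean (\<lambda>h. \<phi> (g \<circ> h))"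
    using continuous_map_compose[of T T "\<lambda>h. g \<circ> h" euclidean \<phi>] by (simp add: comp_def)
  moreover obtain C where "\<forall>g\<in>carrier H. norm (\<phi> g) \<le> C" using assms(1) unfolding Cb_iff by blast
  then have "\<forall>h\<in>carrier H. norm (\<phi> (g \<circ> h)) \<le> C" using assms(2) comp_in by auto
  ultimately show ?thesis unfolding translate_eq Cb_iff using continuous_map_restrict_T by auto
qed

text \<open>Along \<open>p\<close>, the translates of \<open>\<phi>\<close> converge weakly to some \<open>f\<close>. Testing this convergence
  with evaluations identifies \<open>f\<close> with the pointwise limit; testing it with the limit along \<open>q\<close>
  exchanges the two limits.\<close>

lemma WAP_double_limit:
  assumes \<phi>: "\<phi> \<in> WAP H T" shows "double_limit (carrier H) \<phi>"
  unfolding double_limit_def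
proof (intro allI impI)
  fix p q assume "ultrafilter p" "ultrafilter q" "eventually (\<lambda>g. g \<in> carrier H) p" "eventually (\<lambda>g. g \<in> carrier H) q"
  then have p: "on_group p" and q: "on_group q" by (simp_all add: on_group_def)
  let ?O = "(\<lambda>g. translate H g \<phi>) ` carrier H"
  let ?K = "Abstract_Topology.closure_of weak ?O"
  have K: "compactin weak ?K" using \<phi> by (simp add: WAP_def)
  have "?O \<subseteq> topspace weak" using translate_Cb[OF WAP_Cb[OF \<phi>]] by auto
  then have sub: "?O \<subseteq> ?K" by (rule closure_of_subset)
  have "eventually (\<lambda>a. translate H a \<phi> \<in> ?K) p"
    using on_groupD(2)[OF p] by eventually_elim (use sub in auto)
  from compactin_ultrafilter_limit[OF K on_groupD(1)[OF p] this] obtain f where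
    f: "f \<in> ?K" "\<And>U. openin weak U \<Longrightarrow> f \<in> U \<Longrightarrow> eventually (\<lambda>a. translate H a \<phi> \<in> U) p" by blast
  have "f \<in> topspace weak" using f(1) closure_of_subset_topspace by fastforce
  then have fC: "f \<in> Cb T" by simp
  have lim: "Lim p (\<lambda>a. L (translate H a \<phi>)) = L f" if L: "L \<in> dual_Cb T" for L
  proof (rule Lim_eqI[OF on_groupD(1)[OF p]], rule topological_tendstoI)
    fix S assume "open S" "L f \<in> S"
    then have "eventually (\<lambda>a. translate H a \<phi> \<in> {f \<in> Cb T. L f \<in> S}) p"
      using fC by (intro f(2) openin_weak L) auto
    then show "eventually (\<lambda>a. L (translate H a \<phi>) \<in> S) p" by eventually_elim simp
  qed
  have point: "Lim p (\<lambda>a. \<phi> (a \<circ> b)) = f b" if "b \<in> carrier H" for b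
    using lim[OF evaluation_dual[OF that]] that by (simp add: translate_eq)
  have "Lim p (\<lambda>a. Lim q (\<lambda>b. \<phi> (a \<circ> b))) = Lim p (\<lambda>a. Lim q (translate H a \<phi>))"
  proof (rule Lim_eventually_cong, intro always_eventually allI)
    fix a show "Lim q (\<lambda>b. \<phi> (a \<circ> b)) = Lim q (translate H a \<phi>)"
    proof (rule Lim_eventually_cong)
      show "eventually (\<lambda>b. \<phi> (a \<circ> b) = translate H a \<phi> b) q"
        using on_groupD(2)[OF q] by eventually_elim (simp add: translate_eq)
    qed
  qed
  also have "\<dots> = Lim q f" by (rule lim[OF ultralimit_dual[OF q]])
  also have "\<dots> = Lim q (\<lambda>b. Lim p (\<lambda>a. \<phi> (a \<circ> b)))"
  proof (rule Lim_eventually_cong)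
    show "eventually (\<lambda>b. f b = Lim p (\<lambda>a. \<phi> (a \<circ> b))) q"
      using on_groupD(2)[OF q] by eventually_elim (simp add: point)
  qed
  finally show "Lim p (\<lambda>a. Lim q (\<lambda>b. \<phi> (a \<circ> b))) = Lim q (\<lambda>b. Lim p (\<lambda>a. \<phi> (a \<circ> b)))" .
qed

lemma WAP_stable:
  assumes "\<phi> \<in> WAP H T" obtains M where "stable_function (carrier H) \<phi> M"
proof -
  note C = WAP_Cb[OF assms]
  obtain M where M: "\<forall>g\<in>carrier H. norm (\<phi> g) \<le> M" using C unfolding Cb_iff by blast
  have "stable_function (carrier H) \<phi> M"
  proof
    show "\<And>g. g \<in> carrier H \<Longrightarrow> norm (\<phi> g) \<le> M" using M by blast
    show "double_limit (carrier H) \<phi>" by (rule WAP_double_limit[OF assms])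
    show "\<And>g e. g \<in> carrier H \<Longrightarrow> e > 0 \<Longrightarrow>
      \<exists>F. finite F \<and> (\<forall>g'\<in>carrier H. (\<forall>x\<in>F. g' x = g x) \<longrightarrow> norm (\<phi> g' - \<phi> g) < e)" by (rule Cb_continuous[OF C])
  qed
  then show thesis by (rule that)
qed

end

section \<open>Functions on the graph compactification are weakly almost periodic\<close>

context permutation_monoid begin

text \<open>For the graph of a group element \<open>g\<close>, this is the translate by \<open>g\<close> of the restriction of \<open>F\<close> to
  the group; for other relations it is a limit of such translates.\<close>

definition orbit :: "(('a \<times> 'a) set \<Rightarrow> complex) \<Rightarrow> ('a \<times> 'a) set \<Rightarrow> ('a \<Rightarrow> 'a) \<Rightarrow> complex" where
  "orbit F p = (\<lambda>h\<in>carrier H. F (act p h))"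

lemma continuous_KT_bounded:
  fixes F :: "('a \<times> 'a) set \<Rightarrow> complex"
  assumes "continuous_map KT euclidean F" obtains C where "\<And>p. p \<in> limits \<Longrightarrow> norm (F p) \<le> C"
proof -
  have "compactin euclidean (F ` topspace KT)"
    using compact_KT assms by (intro image_compactin[of KT]) (auto simp: compact_space_def)
  then have "bounded (F ` limits)" by (simp add: compact_imp_bounded)
  then show thesis using that unfolding bounded_iff by blast
qed

lemma orbit_Cb:
  assumes F: "continuous_map KT euclidean F" and p: "p \<in> limits"
  shows "orbit F p \<in> Cb T"
proof -
  obtain C where C: "\<And>p. p \<in> limits \<Longrightarrow> norm (F p) \<le> C" using continuous_KT_bounded[OF F] by blast
  have "continuous_map T euclidean (\<lambda>h. F (act p h))"
    using continuous_map_compose[OF continuous_act[OF p] F] by (simp add: comp_def)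
  then show ?thesis
    using C act_in_limits[OF p] continuous_map_restrict_T unfolding orbit_def Cb_iff by auto
qed

definition weakly_continuous :: "(('a \<times> 'a) set \<Rightarrow> complex) \<Rightarrow> bool" where
  "weakly_continuous F \<longleftrightarrow> continuous_map KT euclidean F \<and>
     (\<forall>L\<in>dual_Cb T. continuous_map KT euclidean (\<lambda>p. L (orbit F p)))"

lemma weakly_continuousD:
  assumes "weakly_continuous F"
  shows "continuous_map KT euclidean F"
    and "L \<in> dual_Cb T \<Longrightarrow> continuous_map KT euclidean (\<lambda>p. L (orbit F p))"
  using assms unfolding weakly_continuous_def by blast+

lemma weakly_continuous_cong:
  assumes "weakly_continuous F" "\<And>p. p \<in> limits \<Longrightarrow> F p = F' p"
  shows "weakly_continuous F'"
proof -
  have orb: "orbit F p = orbit F' p" if "p \<in> limits" for p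
    using assms(2) act_in_limits[OF that] by (auto simp: orbit_def)
  show ?thesis
    unfolding weakly_continuous_def
  proof (intro conjI ballI)
    show "continuous_map KT euclidean F'"
      by (rule continuous_map_eq[OF weakly_continuousD(1)[OF assms(1)]]) (simp add: assms(2))
    show "continuous_map KT euclidean (\<lambda>p. L (orbit F' p))" if "L \<in> dual_Cb T" for L
      by (rule continuous_map_eq[OF weakly_continuousD(2)[OF assms(1) that]]) (simp add: orb)
  qed
qed

lemma weakly_continuous_add:
  assumes F: "weakly_continuous F" and F': "weakly_continuous F'" shows "weakly_continuous (\<lambda>p. F p + F' p)"
  unfolding weakly_continuous_def
proof (intro conjI ballI)
  have c: "continuous_map KT euclidean F" "continuous_map KT euclidean F'"
    by (rule weakly_continuousD(1)[OF F], rule weakly_continuousD(1)[OF F'])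
  then show "continuous_map KT euclidean (\<lambda>p. F p + F' p)" by (rule continuous_map_add)
  fix L assume L: "L \<in> dual_Cb T"
  have eq: "L (orbit F p) + L (orbit F' p) = L (orbit (\<lambda>p. F p + F' p) p)"
    if "p \<in> limits" for p
  proof -
    have "orbit (\<lambda>p. F p + F' p) p = (\<lambda>x\<in>carrier H. orbit F p x + orbit F' p x)"
      by (auto simp: orbit_def)
    then show ?thesis using dual_add[OF L orbit_Cb[OF c(1) that] orbit_Cb[OF c(2) that]] by simp
  qed
  have "continuous_map KT euclidean (\<lambda>p. L (orbit F p) + L (orbit F' p))"
    by (rule continuous_map_add[OF weakly_continuousD(2)[OF F L] weakly_continuousD(2)[OF F' L]])
  then show "continuous_map KT euclidean (\<lambda>p. L (orbit (\<lambda>p. F p + F' p) p))"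
    by (rule continuous_map_eq) (simp add: eq)
qed

lemma weakly_continuous_scale:
  assumes F: "weakly_continuous F" shows "weakly_continuous (\<lambda>p. c * F p)"
  unfolding weakly_continuous_def
proof (intro conjI ballI)
  note c = weakly_continuousD(1)[OF F]
  then show "continuous_map KT euclidean (\<lambda>p. c * F p)" by (simp add: continuous_map_atin tendsto_mult)
  fix L assume L: "L \<in> dual_Cb T"
  have eq: "c * L (orbit F p) = L (orbit (\<lambda>p. c * F p) p)"
    if "p \<in> limits" for p
  proof -
    have "orbit (\<lambda>p. c * F p) p = (\<lambda>x\<in>carrier H. c * orbit F p x)"
      by (auto simp: orbit_def)
    then show ?thesis using dual_scale[OF L orbit_Cb[OF c that]] by simp
  qed
  from weakly_continuousD(2)[OF F L] have "continuous_map KT euclidean (\<lambda>p. c * L (orbit F p))"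
    by (simp add: continuous_map_atin tendsto_mult)
  then show "continuous_map KT euclidean (\<lambda>p. L (orbit (\<lambda>p. c * F p) p))"
    by (rule continuous_map_eq) (simp add: eq)
qed

lemma continuous_KT_finite_support:
  fixes F :: "('a \<times> 'a) set \<Rightarrow> complex"
  assumes "finite S" "\<And>p q. p \<in> limits \<Longrightarrow> q \<in> limits \<Longrightarrow> p \<inter> S = q \<inter> S \<Longrightarrow> F p = F q"
  shows "continuous_map KT euclidean F"
  unfolding continuous_KT_iff
proof (intro ballI allI impI)
  fix p and e :: real assume p: "p \<in> limits" and e: "e > 0"
  have "norm (F q - F p) < e" if "q \<in> limits" "q \<inter> S = p \<inter> S" for q
    using assms(2)[OF that(1) p that(2)] e by simp
  then show "\<exists>S. finite S \<and> (\<forall>q\<in>limits. q \<inter> S = p \<inter> S \<longrightarrow> norm (F q - F p) < e)"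
    using assms(1) by blast
qed

text \<open>The values of a bounded functional on disjointly supported functions are absolutely summable: a linear
  combination with unimodular coefficients has norm at most one, and suitable coefficients add up the
  absolute values.\<close>

lemma finite_large_indicators:
  assumes L: "L \<in> dual_Cb T" and e: "e > 0"
    and \<Psi>: "\<Psi> \<subseteq> Cb T" "\<And>\<psi> h. \<psi> \<in> \<Psi> \<Longrightarrow> h \<in> carrier H \<Longrightarrow> \<psi> h \<in> {0, 1}"
    "\<And>\<psi> \<psi>' h. \<psi> \<in> \<Psi> \<Longrightarrow> \<psi>' \<in> \<Psi> \<Longrightarrow> h \<in> carrier H \<Longrightarrow> \<psi> h = 1 \<Longrightarrow> \<psi>' h = 1 \<Longrightarrow> \<psi> = \<psi>'"
  shows "finite {\<psi> \<in> \<Psi>. e \<le> norm (L \<psi>)}"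
proof (rule ccontr)
  assume inf: "infinite {\<psi> \<in> \<Psi>. e \<le> norm (L \<psi>)}"
  obtain K where K: "K > 0" "\<And>f C. f \<in> Cb T \<Longrightarrow> (\<And>x. x \<in> carrier H \<Longrightarrow> norm (f x) \<le> C) \<Longrightarrow> norm (L f) \<le> K * C"
    using dual_bound[OF L] by blast
  obtain n :: nat where n: "K / e < of_nat n" using reals_Archimedean2 by blast
  obtain S where S: "S \<subseteq> {\<psi> \<in> \<Psi>. e \<le> norm (L \<psi>)}" "finite S" "card S = n"
    using infinite_arbitrarily_large[OF inf] by blast
  define f where "f = (\<lambda>x\<in>carrier H. \<Sum>\<psi>\<in>S. cnj (sgn (L \<psi>)) * \<psi> x)"
  have SC: "\<psi> \<in> Cb T" if "\<psi> \<in> S" for \<psi> using that S \<Psi>(1) by auto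
  have fC: "f \<in> Cb T" unfolding f_def using S(2) SC by (intro Cb_sum)
  have "norm (f x) \<le> 1" if x: "x \<in> carrier H" for x
  proof (cases "\<exists>\<psi>\<in>S. \<psi> x = 1")
    case True
    then obtain \<psi> where \<psi>: "\<psi> \<in> S" "\<psi> x = 1" by blast
    have "\<psi>' x = 0" if "\<psi>' \<in> S - {\<psi>}" for \<psi>'
    proof -
      have "\<psi>' \<in> \<Psi>" "\<psi> \<in> \<Psi>" using that S(1) \<psi>(1) by auto
      then show ?thesis using \<Psi>(2)[of \<psi>' x] \<Psi>(3)[of \<psi>' \<psi> x] x \<psi>(2) that by auto
    qed
    then have "(\<Sum>\<psi>'\<in>S - {\<psi>}. cnj (sgn (L \<psi>')) * \<psi>' x) = 0" by (intro sum.neutral) simp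
    then have "f x = cnj (sgn (L \<psi>))"
      using x S(2) \<psi> by (simp add: f_def sum.remove[of S \<psi>])
    then show ?thesis by (simp add: norm_sgn)
  next
    case False
    have "\<psi> x = 0" if "\<psi> \<in> S" for \<psi> using \<Psi>(2)[of \<psi> x] x False that S(1) by auto
    then have "(\<Sum>\<psi>\<in>S. cnj (sgn (L \<psi>)) * \<psi> x) = 0" by (intro sum.neutral) simp
    then show ?thesis using x by (simp add: f_def)
  qed
  then have "norm (L f) \<le> K" using K(2)[OF fC, of 1] by simp
  moreover have "L f = (\<Sum>\<psi>\<in>S. cnj (sgn (L \<psi>)) * L \<psi>)"
    unfolding f_def using L S(2) SC by (rule dual_sum)
  moreover have "cnj (sgn (L \<psi>)) * L \<psi> = of_real (norm (L \<psi>))" for \<psi>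
  proof (cases "L \<psi> = 0")
    case False
    have "cnj (sgn (L \<psi>)) * L \<psi> = (L \<psi> * cnj (L \<psi>)) / of_real (norm (L \<psi>))"
      by (simp add: sgn_eq mult.commute)
    also have "\<dots> = of_real ((norm (L \<psi>))\<^sup>2) / of_real (norm (L \<psi>))"
      by (simp only: complex_norm_square)
    also have "\<dots> = of_real (norm (L \<psi>))" using False by (simp add: power2_eq_square)
    finally show ?thesis .
  qed simp
  ultimately have "norm (complex_of_real (\<Sum>\<psi>\<in>S. norm (L \<psi>))) \<le> K" by simp
  then have "(\<Sum>\<psi>\<in>S. norm (L \<psi>)) \<le> K" unfolding norm_of_real by linarith
  moreover have "of_nat (card S) * e \<le> (\<Sum>\<psi>\<in>S. norm (L \<psi>))"
    using S(1) by (intro sum_bounded_below) auto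
  ultimately have "of_nat n * e \<le> K" using S(3) by simp
  then show False using n e by (simp add: field_simps)
qed

text \<open>The relation \<open>act p h\<close> contains \<open>B\<close> iff \<open>h\<close> takes prescribed values, namely the preimages
  under \<open>p\<close> of the second coordinates. These are unique, so that different functions in the orbit have
  disjoint supports. Continuity is clear near \<open>p\<close> with a nonzero function. Near the other \<open>p\<close>,
  a functional can be large on finitely many functions only, and each of them can be avoided.\<close>

lemma weakly_continuous_cylinder:
  assumes B: "finite B" shows "weakly_continuous (\<lambda>p. of_bool (B \<subseteq> p))"
proof -
  define F :: "('a \<times> 'a) set \<Rightarrow> complex" where "F p = of_bool (B \<subseteq> p)" for p
  have F: "continuous_map KT euclidean F"
  proof (rule continuous_KT_finite_support[OF B])
    fix p q assume "p \<inter> B = q \<inter> B"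
    then have "B \<subseteq> p \<longleftrightarrow> B \<subseteq> q" by blast
    then show "F p = F q" by (simp add: F_def)
  qed
  define shift where "shift h = (\<lambda>(x, y). (h x, y)) ` B" for h :: "'a \<Rightarrow> 'a"
  have orb: "orbit F p h = of_bool (shift h \<subseteq> p)" if "h \<in> carrier H" for p h
    using that by (auto simp: orbit_def F_def shift_def act_def)
  have same: "orbit F p = orbit F q"
    if pq: "p \<in> limits" "q \<in> limits" and h: "shift h \<subseteq> p" "shift h \<subseteq> q" for p q h
  proof -
    have "shift k \<subseteq> r \<longleftrightarrow> (\<forall>(x, y)\<in>B. k x = h x)" if r: "r \<in> limits" "shift h \<subseteq> r" for r k
    proof
      assume k: "shift k \<subseteq> r"
      show "\<forall>(x, y)\<in>B. k x = h x"
      proof clarify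
        fix x y assume "(x, y) \<in> B"
        then have "(k x, y) \<in> r" "(h x, y) \<in> r" using k r(2) by (auto simp: shift_def)
        then show "k x = h x" by (rule limits_injective[OF r(1)])
      qed
    next
      assume "\<forall>(x, y)\<in>B. k x = h x"
      then have "shift k = shift h" unfolding shift_def by (intro image_cong) auto
      then show "shift k \<subseteq> r" using r(2) by simp
    qed
    then have "shift k \<subseteq> p \<longleftrightarrow> shift k \<subseteq> q" for k using pq h by simp
    then have "orbit F p k = orbit F q k" if "k \<in> carrier H" for k using that by (simp add: orb)
    then show ?thesis by (auto simp: orbit_def)
  qed
  have "continuous_map KT euclidean (\<lambda>p. L (orbit F p))" if L: "L \<in> dual_Cb T" for L
    unfolding continuous_KT_iff
  proof (intro ballI allI impI)
    fix p and e :: real assume p: "p \<in> limits" and e: "e > 0"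
    show "\<exists>S. finite S \<and> (\<forall>q\<in>limits. q \<inter> S = p \<inter> S \<longrightarrow> norm (L (orbit F q) - L (orbit F p)) < e)"
    proof (cases "\<exists>h\<in>carrier H. shift h \<subseteq> p")
      case True
      then obtain h where h: "shift h \<subseteq> p" by blast
      have "norm (L (orbit F q) - L (orbit F p)) < e"
        if q: "q \<in> limits" "q \<inter> shift h = p \<inter> shift h" for q
      proof -
        have "shift h \<subseteq> q" using q(2) h by blast
        then show ?thesis using same[OF q(1) p _ h] e by simp
      qed
      moreover have "finite (shift h)" using B by (simp add: shift_def)
      ultimately show ?thesis by blast
    next
      case False
      have L0: "L (\<lambda>x\<in>carrier H. 0) = 0" by (rule dual_zero[OF L])
      have zero: "orbit F p = (\<lambda>x\<in>carrier H. 0)"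
      proof
        fix h show "orbit F p h = (\<lambda>x\<in>carrier H. 0) h"
          using False orb[of h p] by (cases "h \<in> carrier H") (auto simp: orbit_def)
      qed
      let ?E = "{\<psi> \<in> orbit F ` limits. e \<le> norm (L \<psi>)}"
      have fin: "finite ?E"
      proof (rule finite_large_indicators[OF L e])
        show "orbit F ` limits \<subseteq> Cb T" using orbit_Cb[OF F] by auto
        fix \<psi> h assume \<psi>: "\<psi> \<in> orbit F ` limits" and h: "h \<in> carrier H"
        then show "\<psi> h \<in> {0, 1}" using orb by auto
        fix \<psi>' assume \<psi>': "\<psi>' \<in> orbit F ` limits" "\<psi> h = 1" "\<psi>' h = 1"
        obtain q q' where "q \<in> limits" "\<psi> = orbit F q" "q' \<in> limits" "\<psi>' = orbit F q'"
          using \<psi> \<psi>' by blast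
        moreover from this have "shift h \<subseteq> q" "shift h \<subseteq> q'" using \<psi>' orb[OF h] by (auto simp: of_bool_def split: if_splits)
        ultimately show "\<psi> = \<psi>'" using same by blast
      qed
      have ex: "\<exists>h. h \<in> carrier H \<and> \<psi> h = 1" if \<psi>: "\<psi> \<in> ?E" for \<psi>
      proof (rule ccontr)
        assume no: "\<not> ?thesis"
        obtain q where q: "\<psi> = orbit F q" using \<psi> by blast
        have "\<psi> = (\<lambda>x\<in>carrier H. 0)"
        proof
          fix h show "\<psi> h = (\<lambda>x\<in>carrier H. 0) h"
            using no orb[of h q] unfolding q by (cases "h \<in> carrier H") (auto simp: orbit_def)
        qed
        then have "L \<psi> = 0" using L0 by simp
        then show False using \<psi> e by simp
      qed
      have "\<forall>\<psi>\<in>?E. \<exists>h. h \<in> carrier H \<and> \<psi> h = 1" by (intro ballI ex)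
      from bchoice[OF this] obtain w where w: "\<forall>\<psi>\<in>?E. w \<psi> \<in> carrier H \<and> \<psi> (w \<psi>) = 1" ..
      \<comment> \<open>A relation that agrees with \<open>p\<close> on \<open>S\<close> has none of the functions in \<open>?E\<close> as its orbit function.\<close>
      define S where "S = (\<Union>\<psi>\<in>?E. shift (w \<psi>))"
      have "finite S" unfolding S_def using fin B by (auto simp: shift_def)
      moreover have "norm (L (orbit F q) - L (orbit F p)) < e"
        if q: "q \<in> limits" "q \<inter> S = p \<inter> S" for q
      proof (rule ccontr)
        assume "\<not> ?thesis"
        then have "e \<le> norm (L (orbit F q))" using L0 zero by simp
        then have E: "orbit F q \<in> ?E" using q(1) by blast
        let ?h = "w (orbit F q)"
        have h: "?h \<in> carrier H" "orbit F q ?h = 1" using bspec[OF w E] by auto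
        then have "shift ?h \<subseteq> q" using orb[OF h(1), of q] by (auto simp: of_bool_def split: if_splits)
        moreover have "shift ?h \<subseteq> S" unfolding S_def using E by blast
        ultimately have "shift ?h \<subseteq> p" using q(2) by blast
        then show False using False h(1) by blast
      qed
      ultimately show ?thesis by blast
    qed
  qed
  then have "weakly_continuous F" using F by (simp add: weakly_continuous_def)
  then show ?thesis by (simp add: F_def[abs_def])
qed

text \<open>Inclusion and exclusion, one forbidden pair at a time.\<close>

lemma weakly_continuous_pattern:
  assumes "finite C" "finite B" shows "weakly_continuous (\<lambda>p. of_bool (B \<subseteq> p \<and> C \<inter> p = {}))"
  using assms
proof (induction C arbitrary: B)
  case empty then show ?case using weakly_continuous_cylinder by simp
next
  case (insert x C)
  have "weakly_continuous (\<lambda>p. of_bool (B \<subseteq> p \<and> C \<inter> p = {}) + (- 1) * of_bool (insert x B \<subseteq> p \<and> C \<inter> p = {}))"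
    using insert.prems by (intro weakly_continuous_add weakly_continuous_scale insert.IH) simp_all
  then show ?case by (rule weakly_continuous_cong) auto
qed

lemma weakly_continuous_sum:
  assumes "finite I" "\<And>i. i \<in> I \<Longrightarrow> weakly_continuous (F i)"
  shows "weakly_continuous (\<lambda>p. \<Sum>i\<in>I. c i * F i p)"
  using assms
proof (induction I)
  case empty
  have "weakly_continuous (\<lambda>p. 0 * of_bool ({} \<subseteq> p))" by (intro weakly_continuous_scale weakly_continuous_cylinder) simp
  then show ?case by simp
next
  case (insert i I)
  then show ?case by (simp add: weakly_continuous_add weakly_continuous_scale)
qed

lemma uniform_finite_support:
  assumes F: "continuous_map KT euclidean (F :: _ \<Rightarrow> complex)" and e: "e > 0"
  obtains S where "finite S"
    "\<And>p q. p \<in> limits \<Longrightarrow> q \<in> limits \<Longrightarrow> p \<inter> S = q \<inter> S \<Longrightarrow> norm (F p - F q) < e"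
proof -
  have "e / 2 > 0" using e by simp
  then have "\<forall>p\<in>limits. \<exists>S. finite S \<and> (\<forall>q\<in>limits. q \<inter> S = p \<inter> S \<longrightarrow> norm (F q - F p) < e / 2)"
    using F[unfolded continuous_KT_iff, rule_format, of _ "e / 2"] by simp
  from bchoice[OF this] obtain S where S0: "\<forall>p\<in>limits. finite (S p) \<and>
    (\<forall>q\<in>limits. q \<inter> S p = p \<inter> S p \<longrightarrow> norm (F q - F p) < e / 2)" ..
  then have S: "\<And>p. p \<in> limits \<Longrightarrow> finite (S p)"
    "\<And>p q. p \<in> limits \<Longrightarrow> q \<in> limits \<Longrightarrow> q \<inter> S p = p \<inter> S p \<Longrightarrow> norm (F q - F p) < e / 2"
    by simp_all
  define N where "N p = {q \<in> limits. q \<inter> S p = p \<inter> S p}" for p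
  have "openin KT (N p)" if "p \<in> limits" for p
    unfolding openin_KT_iff
  proof (intro conjI ballI)
    fix q assume "q \<in> N p"
    then show "\<exists>S. finite S \<and> (\<forall>r\<in>limits. r \<inter> S = q \<inter> S \<longrightarrow> r \<in> N p)"
      using S(1)[OF that] by (intro exI[of _ "S p"]) (auto simp: N_def)
  qed (auto simp: N_def)
  moreover have "limits \<subseteq> \<Union>(N ` limits)" by (auto simp: N_def)
  moreover have "compactin KT limits" using compact_KT by (simp add: compact_space_def)
  ultimately obtain \<F> where \<F>: "finite \<F>" "\<F> \<subseteq> N ` limits" "limits \<subseteq> \<Union>\<F>"
    using compactinD[of KT limits "N ` limits"] by auto
  then obtain P where P: "finite P" "P \<subseteq> limits" "\<F> = N ` P" by (metis finite_subset_image)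
  show thesis
  proof (rule that)
    show "finite (\<Union>p\<in>P. S p)" using P S(1) by auto
    fix p q assume p: "p \<in> limits" and q: "q \<in> limits" and pq: "p \<inter> (\<Union>p\<in>P. S p) = q \<inter> (\<Union>p\<in>P. S p)"
    obtain r where r: "r \<in> P" "p \<in> N r" using \<F>(3) P(3) p by auto
    have "p \<inter> S r = q \<inter> S r" using pq r(1) by blast
    then have "q \<inter> S r = r \<inter> S r" "p \<inter> S r = r \<inter> S r" using r(2) by (auto simp: N_def)
    then have "norm (F q - F r) < e / 2" "norm (F p - F r) < e / 2" using S(2) p q r(1) P(2) by auto
    then show "norm (F p - F q) < e"
      using norm_triangle_lt[of "F p - F r" "F r - F q" e] by (simp add: norm_minus_commute)
  qed
qed

text \<open>By compactness \<open>F\<close> almost depends on finitely many pairs only; a function that depends on finitely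
  many pairs is a linear combination of indicators of patterns.\<close>

lemma weakly_continuous_approximation:
  assumes F: "continuous_map KT euclidean F" and e: "e > 0"
  obtains F' where "weakly_continuous F'" "\<And>p. p \<in> limits \<Longrightarrow> norm (F p - F' p) < e"
proof -
  obtain S where S: "finite S"
    "\<And>p q. p \<in> limits \<Longrightarrow> q \<in> limits \<Longrightarrow> p \<inter> S = q \<inter> S \<Longrightarrow> norm (F p - F q) < e"
    using uniform_finite_support[OF F e] by blast
  define rep where "rep B = (SOME p. p \<in> limits \<and> p \<inter> S = B)" for B
  have rep: "rep (p \<inter> S) \<in> limits \<and> rep (p \<inter> S) \<inter> S = p \<inter> S" if "p \<in> limits" for p
    unfolding rep_def by (rule someI[of _ p]) (use that in simp)
  define F' where "F' p = (\<Sum>B\<in>Pow S. F (rep B) * of_bool (B \<subseteq> p \<and> (S - B) \<inter> p = {}))" for p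
  have "weakly_continuous F'"
    unfolding F'_def[abs_def] using S(1)
    by (intro weakly_continuous_sum weakly_continuous_pattern) (auto intro: finite_subset)
  moreover have "norm (F p - F' p) < e" if p: "p \<in> limits" for p
  proof -
    have "(B \<subseteq> p \<and> (S - B) \<inter> p = {}) \<longleftrightarrow> B = p \<inter> S" if "B \<in> Pow S" for B using that by blast
    then have "F' p = (\<Sum>B\<in>Pow S. if B = p \<inter> S then F (rep B) else 0)"
      unfolding F'_def by (intro sum.cong) auto
    also have "\<dots> = F (rep (p \<inter> S))" using S(1) by (subst sum.delta) auto
    finally show ?thesis using S(2)[of p "rep (p \<inter> S)"] p rep[OF p] by simp
  qed
  ultimately show thesis using that by blast
qed

lemma continuous_imp_weakly_continuous:
  assumes F: "continuous_map KT euclidean F" shows "weakly_continuous F"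
  unfolding weakly_continuous_def
proof (intro conjI F ballI)
  fix L assume L: "L \<in> dual_Cb T"
  obtain K where K: "K > 0" "\<And>f C. f \<in> Cb T \<Longrightarrow> (\<And>x. x \<in> carrier H \<Longrightarrow> norm (f x) \<le> C) \<Longrightarrow> norm (L f) \<le> K * C"
    using dual_bound[OF L] by blast
  show "continuous_map KT euclidean (\<lambda>p. L (orbit F p))"
    unfolding continuous_KT_iff
  proof (intro ballI allI impI)
    fix p and e :: real assume p: "p \<in> limits" and e: "e > 0"
    define d where "d = e / (4 * K)"
    have d: "d > 0" using e K(1) by (simp add: d_def)
    obtain F' where F': "weakly_continuous F'" "\<And>p. p \<in> limits \<Longrightarrow> norm (F p - F' p) < d"
      using weakly_continuous_approximation[OF F d] by blast
    note F'c = weakly_continuousD(1)[OF F'(1)]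
    have close: "norm (L (orbit F q) - L (orbit F' q)) \<le> e / 4" if q: "q \<in> limits" for q
    proof -
      note C = orbit_Cb[OF F q] orbit_Cb[OF F'c q]
      have sC: "(\<lambda>x\<in>carrier H. (- 1) * orbit F' q x) \<in> Cb T" by (rule Cb_scale[OF C(2)])
      let ?D = "\<lambda>x\<in>carrier H. orbit F q x + (\<lambda>x\<in>carrier H. (- 1) * orbit F' q x) x"
      have "L ?D = L (orbit F q) + (- 1) * L (orbit F' q)"
        unfolding dual_add[OF L C(1) sC] dual_scale[OF L C(2)] ..
      moreover have "norm (L ?D) \<le> K * d"
      proof (rule K(2))
        show "?D \<in> Cb T" by (rule Cb_add[OF C(1) sC])
        show "norm (?D x) \<le> d" if "x \<in> carrier H" for x
          using that F'(2)[OF act_in_limits[OF q that]] by (simp add: orbit_def)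
      qed
      ultimately show ?thesis using K(1) by (simp add: d_def)
    qed
    have "e / 4 > 0" using e by simp
    from weakly_continuousD(2)[OF F'(1) L, unfolded continuous_KT_iff, rule_format, OF p this]
    obtain S where S: "finite S"
      "\<forall>q\<in>limits. q \<inter> S = p \<inter> S \<longrightarrow> norm (L (orbit F' q) - L (orbit F' p)) < e / 4"
      by blast
    have "norm (L (orbit F q) - L (orbit F p)) < e" if q: "q \<in> limits" "q \<inter> S = p \<inter> S" for q
    proof -
      have "norm (L (orbit F' q) - L (orbit F' p)) < e / 4" using S(2) q by blast
      moreover have "norm (L (orbit F q) - L (orbit F p)) \<le>
          norm (L (orbit F q) - L (orbit F' q)) +
          norm (L (orbit F' q) - L (orbit F' p)) +
          norm (L (orbit F p) - L (orbit F' p))" by norm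
      ultimately show ?thesis using close[OF q(1)] close[OF p] e by linarith
    qed
    with S(1) show "\<exists>S. finite S \<and> (\<forall>q\<in>limits. q \<inter> S = p \<inter> S \<longrightarrow>
        norm (L (orbit F q) - L (orbit F p)) < e)" by blast
  qed
qed

lemma continuous_orbit:
  assumes F: "continuous_map KT euclidean F" shows "continuous_map KT weak (orbit F)"
  unfolding weak_topology_Cb_def
proof (rule continuous_on_generated_topo)
  fix W assume "W \<in> {{f \<in> Cb T. L f \<in> U} | L U. L \<in> dual_Cb T \<and> open U}"
  then obtain L U where W: "W = {f \<in> Cb T. L f \<in> U}" "L \<in> dual_Cb T" "open U" by blast
  have "continuous_map KT euclidean (\<lambda>p. L (orbit F p))"
    by (rule weakly_continuousD(2)[OF continuous_imp_weakly_continuous[OF F] W(2)])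
  then have "openin KT {p \<in> topspace KT. L (orbit F p) \<in> U}"
    by (rule openin_continuous_map_preimage) (use W(3) in simp)
  moreover have "orbit F -` W \<inter> topspace KT = {p \<in> topspace KT. L (orbit F p) \<in> U}"
    unfolding W(1) using orbit_Cb[OF F] by auto
  ultimately show "openin KT (orbit F -` W \<inter> topspace KT)" by simp
next
  show "orbit F ` topspace KT \<subseteq> \<Union>{{f \<in> Cb T. L f \<in> U} | L U. L \<in> dual_Cb T \<and> open U}"
    using topspace_weak orbit_Cb[OF F] unfolding weak_topology_Cb_def topology_generated_by_topspace by auto
qed

lemma orbit_graph:
  "g \<in> carrier H \<Longrightarrow> orbit F (function_graph g) = translate H g (\<lambda>g\<in>carrier H. F (function_graph g))"
  by (auto simp: orbit_def translate_eq act_graph comp_in)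

text \<open>The orbit of the restricted function is contained in the image of a compact space under a weakly
  continuous map.\<close>

lemma limits_function_WAP:
  assumes F: "continuous_map KT euclidean F"
  shows "(\<lambda>g\<in>carrier H. F (function_graph g)) \<in> WAP H T"
proof -
  let ?\<phi> = "\<lambda>g\<in>carrier H. F (function_graph g)"
  have "?\<phi> = orbit F (function_graph id)" by (auto simp: orbit_def act_graph_id)
  then have C: "?\<phi> \<in> Cb T" using orbit_Cb[OF F graph_in_limits[OF id_in]] by simp
  let ?I = "orbit F ` limits" and ?O = "(\<lambda>g. translate H g ?\<phi>) ` carrier H"
  have "compactin KT limits" using compact_KT by (simp add: compact_space_def)
  then have I: "compactin weak ?I" using continuous_orbit[OF F] by (rule image_compactin)
  then have cl: "closedin weak ?I" using Hausdorff_weak compactin_imp_closedin by blast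
  have "?O \<subseteq> ?I" using orbit_graph[of _ F] graph_in_limits by force
  then have "Abstract_Topology.closure_of weak ?O \<subseteq> ?I" using cl by (rule closure_of_minimal)
  from closed_compactin[OF I this closedin_closure_of]
  have "compactin weak (Abstract_Topology.closure_of weak ?O)" .
  with C show ?thesis by (simp add: WAP_def)
qed

end

section \<open>Comparison of the compactifications\<close>

lemma continuous_map_complex:
  fixes F F' :: "'b \<Rightarrow> complex"
  assumes "continuous_map X euclidean F" "continuous_map X euclidean F'"
  shows "continuous_map X euclidean (\<lambda>x. F x * F' x)" "continuous_map X euclidean (\<lambda>x. F x + F' x)"
  using assms by (simp_all add: continuous_map_atin tendsto_mult tendsto_add)

lemma continuous_map_cnj:
  "continuous_map X euclidean F \<Longrightarrow> continuous_map X euclidean (\<lambda>x. cnj (F x))"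
  by (simp add: continuous_map_atin tendsto_cnj)

text \<open>Otherwise, by compactness, finitely many functions in the kernel of \<open>\<Xi>\<close> have no common zero. The
  sum of their squared absolute values lies in the kernel as well, and it is invertible.\<close>

lemma character_is_evaluation:
  fixes X :: "'b topology" and \<Xi> :: "('b \<Rightarrow> complex) \<Rightarrow> complex"
  defines "C \<equiv> {F. continuous_map X euclidean F}"
  assumes X: "compact_space X"
    and cong: "\<And>F F'. F \<in> C \<Longrightarrow> F' \<in> C \<Longrightarrow> (\<And>x. x \<in> topspace X \<Longrightarrow> F x = F' x) \<Longrightarrow> \<Xi> F = \<Xi> F'"
    and add: "\<And>F F'. F \<in> C \<Longrightarrow> F' \<in> C \<Longrightarrow> \<Xi> (\<lambda>x. F x + F' x) = \<Xi> F + \<Xi> F'"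
    and mult: "\<And>F F'. F \<in> C \<Longrightarrow> F' \<in> C \<Longrightarrow> \<Xi> (\<lambda>x. F x * F' x) = \<Xi> F * \<Xi> F'"
    and const: "\<And>c. \<Xi> (\<lambda>x. c) = c"
  obtains p where "p \<in> topspace X" "\<And>F. F \<in> C \<Longrightarrow> \<Xi> F = F p"
proof (rule ccontr)
  assume contra: "\<not> thesis"
  note witness = that
  have "\<exists>F. F \<in> C \<and> F p \<noteq> \<Xi> F" if p: "p \<in> topspace X" for p
  proof (rule ccontr)
    assume *: "\<not> ?thesis"
    have thesis by (rule witness[OF p]) (use * in force)
    with contra show False ..
  qed
  then have "\<forall>p\<in>topspace X. \<exists>F. F \<in> C \<and> F p \<noteq> \<Xi> F" by blast
  from bchoice[OF this] obtain f where f: "\<forall>p\<in>topspace X. f p \<in> C \<and> f p p \<noteq> \<Xi> (f p)" ..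
  define N where "N p = {x \<in> topspace X. f p x \<in> - {\<Xi> (f p)}}" for p
  have "openin X (N p)" if "p \<in> topspace X" for p
    unfolding N_def using f that by (intro openin_continuous_map_preimage[of X euclidean]) (auto simp: C_def)
  moreover have "p \<in> N p" if "p \<in> topspace X" for p
    using bspec[OF f that] that by (simp add: N_def)
  then have "topspace X \<subseteq> \<Union>(N ` topspace X)" by blast
  ultimately obtain \<F> where "finite \<F>" "\<F> \<subseteq> N ` topspace X" "topspace X \<subseteq> \<Union>\<F>"
    using compactinD[of X "topspace X" "N ` topspace X"] X by (auto simp: compact_space_def)
  then obtain P where P: "finite P" "P \<subseteq> topspace X" "topspace X \<subseteq> \<Union>(N ` P)" by (metis finite_subset_image)
  define d where "d p = (\<lambda>x. f p x + (- \<Xi> (f p)))" for p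
  have constC: "(\<lambda>x. c) \<in> C" for c by (simp add: C_def)
  have multC: "(\<lambda>x. F x * F' x) \<in> C" and addC: "(\<lambda>x. F x + F' x) \<in> C" and cnjC: "(\<lambda>x. cnj (F x)) \<in> C"
    if "F \<in> C" "F' \<in> C" for F F'
    using that continuous_map_complex[of X F F'] continuous_map_cnj[of X F] by (simp_all add: C_def)
  have d: "d p \<in> C" "(\<lambda>x. cnj (d p x)) \<in> C" "\<Xi> (d p) = 0" if "p \<in> P" for p
  proof -
    have fp: "f p \<in> C" using f that P(2) by auto
    show dp: "d p \<in> C" unfolding d_def by (rule addC[OF fp constC])
    show "(\<lambda>x. cnj (d p x)) \<in> C" by (rule cnjC[OF dp dp])
    show "\<Xi> (d p) = 0" unfolding d_def add[OF fp constC] const by simp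
  qed
  have "(\<lambda>x. \<Sum>p\<in>Q. d p x * cnj (d p x)) \<in> C \<and> \<Xi> (\<lambda>x. \<Sum>p\<in>Q. d p x * cnj (d p x)) = 0" if "finite Q" "Q \<subseteq> P" for Q
    using that
  proof (induction Q)
    case empty then show ?case using const[of 0] constC[of 0] by simp
  next
    case (insert p Q)
    have p: "p \<in> P" using insert.prems by simp
    have IH: "(\<lambda>x. \<Sum>p\<in>Q. d p x * cnj (d p x)) \<in> C" "\<Xi> (\<lambda>x. \<Sum>p\<in>Q. d p x * cnj (d p x)) = 0"
      using insert by auto
    have s: "(\<lambda>x. d p x * cnj (d p x)) \<in> C"
      by (rule multC[OF d(1,2)[OF p]])
    have "\<Xi> (\<lambda>x. d p x * cnj (d p x)) = 0" using mult[OF d(1,2)[OF p]] d(3)[OF p] by simp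
    then have "\<Xi> (\<lambda>x. d p x * cnj (d p x) + (\<Sum>p\<in>Q. d p x * cnj (d p x))) = 0"
      using add[OF s IH(1)] IH(2) by simp
    moreover have "(\<lambda>x. d p x * cnj (d p x) + (\<Sum>p\<in>Q. d p x * cnj (d p x))) \<in> C"
      by (rule addC[OF s IH(1)])
    ultimately show ?case using insert.hyps by simp
  qed
  from this[OF P(1) order_refl]
  have u: "(\<lambda>x. \<Sum>p\<in>P. d p x * cnj (d p x)) \<in> C" "\<Xi> (\<lambda>x. \<Sum>p\<in>P. d p x * cnj (d p x)) = 0" by auto
  have nz: "(\<Sum>p\<in>P. d p x * cnj (d p x)) \<noteq> 0" if x: "x \<in> topspace X" for x
  proof -
    obtain p where p: "p \<in> P" "x \<in> N p" using P(3) x by auto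
    then have "d p x \<noteq> 0" by (simp add: N_def d_def)
    then have "0 < (norm (d p x))\<^sup>2" by simp
    also have "\<dots> \<le> (\<Sum>p\<in>P. (norm (d p x))\<^sup>2)"
      using P(1) p(1) by (intro member_le_sum) auto
    finally have "complex_of_real (\<Sum>p\<in>P. (norm (d p x))\<^sup>2) \<noteq> 0" unfolding of_real_eq_0_iff by simp
    then show ?thesis unfolding of_real_sum complex_norm_square .
  qed
  let ?v = "\<lambda>x. inverse (\<Sum>p\<in>P. d p x * cnj (d p x))"
  have v: "?v \<in> C"
    using u(1) nz unfolding C_def by (simp add: continuous_map_atin tendsto_inverse)
  have uv: "(\<lambda>x. (\<Sum>p\<in>P. d p x * cnj (d p x)) * ?v x) \<in> C"
    by (rule multC[OF u(1) v])
  have "\<Xi> (\<lambda>x. (\<Sum>p\<in>P. d p x * cnj (d p x)) * ?v x) = \<Xi> (\<lambda>x. 1)"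
    by (rule cong[OF uv constC]) (use nz in simp)
  then show False using mult[OF u(1) v] u(2) const[of 1] by simp
qed

text \<open>The converse, that continuous functions restrict to weakly almost periodic ones, holds for every
  permutation group. So in this locale the weakly almost periodic functions are exactly the continuous
  functions on the graph compactification.\<close>

locale extendible_WAP = permutation_monoid +
  assumes extends: "\<phi> \<in> WAP H T \<Longrightarrow>
    \<exists>F. continuous_map KT euclidean F \<and> (\<forall>g\<in>carrier H. F (function_graph g) = \<phi> g)"
begin

definition extension :: "(('a \<Rightarrow> 'a) \<Rightarrow> complex) \<Rightarrow> ('a \<times> 'a) set \<Rightarrow> complex" where
  "extension \<phi> = (SOME F. continuous_map KT euclidean F \<and> (\<forall>g\<in>carrier H. F (function_graph g) = \<phi> g))"

definition restriction :: "(('a \<times> 'a) set \<Rightarrow> complex) \<Rightarrow> ('a \<Rightarrow> 'a) \<Rightarrow> complex" where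
  "restriction F = (\<lambda>g\<in>carrier H. F (function_graph g))"

lemma extension_spec:
  assumes "\<phi> \<in> WAP H T"
  shows "continuous_map KT euclidean (extension \<phi>)" "\<And>g. g \<in> carrier H \<Longrightarrow> extension \<phi> (function_graph g) = \<phi> g"
  using someI_ex[OF extends[OF assms]] unfolding extension_def[symmetric] by blast+

lemma restriction_WAP: "continuous_map KT euclidean F \<Longrightarrow> restriction F \<in> WAP H T"
  unfolding restriction_def by (rule limits_function_WAP)

lemma restriction_extension: assumes "\<phi> \<in> WAP H T" shows "restriction (extension \<phi>) = \<phi>"
proof
  fix g show "restriction (extension \<phi>) g = \<phi> g"
    using extension_spec(2)[OF assms] WAP_Cb[OF assms]
    by (cases "g \<in> carrier H") (auto simp: restriction_def Cb_iff extensional_def)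
qed

lemma continuous_KT_unique:
  assumes F: "continuous_map KT euclidean F" "continuous_map KT euclidean (F' :: _ \<Rightarrow> complex)"
    and eq: "\<And>g. g \<in> carrier H \<Longrightarrow> F (function_graph g) = F' (function_graph g)" and p: "p \<in> limits"
  shows "F p = F' p"
proof -
  have "norm (F p - F' p) \<le> e" if e: "e > 0" for e
  proof -
    have "e / 2 > 0" using e by simp
    note cont = F[unfolded continuous_KT_iff, rule_format, OF p this]
    obtain S where S: "finite S" "\<forall>q\<in>limits. q \<inter> S = p \<inter> S \<longrightarrow> norm (F q - F p) < e / 2" using cont(1) by blast
    obtain S' where S': "finite S'" "\<forall>q\<in>limits. q \<inter> S' = p \<inter> S' \<longrightarrow> norm (F' q - F' p) < e / 2" using cont(2) by blast
    obtain g where g: "g \<in> carrier H" "function_graph g \<inter> (S \<union> S') = p \<inter> (S \<union> S')"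
      using graph_agreeing[OF p, of "S \<union> S'"] S(1) S'(1) by auto
    have "function_graph g \<inter> S = p \<inter> S" "function_graph g \<inter> S' = p \<inter> S'" using g(2) by auto
    then have "norm (F (function_graph g) - F p) < e / 2" "norm (F' (function_graph g) - F' p) < e / 2"
      using S(2) S'(2) graph_in_limits[OF g(1)] by auto
    then show ?thesis
      using eq[OF g(1)] norm_triangle_le[of "F p - F (function_graph g)" "F' (function_graph g) - F' p" e]
      by (simp add: norm_minus_commute)
  qed
  then have "norm (F p - F' p) \<le> 0" by (rule field_le_epsilon[of _ 0, simplified])
  then show ?thesis by simp
qed

lemma extension_restriction:
  assumes "continuous_map KT euclidean F" "p \<in> limits" shows "extension (restriction F) p = F p"
proof (rule continuous_KT_unique[OF _ assms(1) _ assms(2)])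
  note W = restriction_WAP[OF assms(1)]
  show "continuous_map KT euclidean (extension (restriction F))" by (rule extension_spec(1)[OF W])
  show "extension (restriction F) (function_graph g) = F (function_graph g)" if "g \<in> carrier H" for g
    using extension_spec(2)[OF W that] that by (simp add: restriction_def)
qed

abbreviation gelfand where "gelfand \<equiv> gelfand_space (carrier H) (WAP H T)"

definition evaluation_at :: "('a \<times> 'a) set \<Rightarrow> (('a \<Rightarrow> 'a) \<Rightarrow> complex) \<Rightarrow> complex" where
  "evaluation_at p = (\<lambda>\<phi>\<in>WAP H T. extension \<phi> p)"

lemma restriction_operations:
  assumes "\<phi> \<in> WAP H T" "\<psi> \<in> WAP H T"
  shows "(\<lambda>x\<in>carrier H. \<phi> x + \<psi> x) = restriction (\<lambda>p. extension \<phi> p + extension \<psi> p)"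
    "(\<lambda>x\<in>carrier H. \<phi> x * \<psi> x) = restriction (\<lambda>p. extension \<phi> p * extension \<psi> p)"
    "(\<lambda>x\<in>carrier H. c * \<phi> x) = restriction (\<lambda>p. c * extension \<phi> p)"
  unfolding restriction_def using extension_spec(2) assms by (auto intro!: restrict_ext)

lemma evaluation_at_operation:
  assumes "continuous_map KT euclidean F" "p \<in> limits" shows "evaluation_at p (restriction F) = F p"
  using restriction_WAP[OF assms(1)] extension_restriction[OF assms] by (simp add: evaluation_at_def)

lemma evaluation_at_character:
  assumes p: "p \<in> limits" shows "evaluation_at p \<in> characters (carrier H) (WAP H T)"
proof -
  have "evaluation_at p (\<lambda>x\<in>carrier H. \<phi> x + \<psi> x) = evaluation_at p \<phi> + evaluation_at p \<psi>" "evaluation_at p (\<lambda>x\<in>carrier H. \<phi> x * \<psi> x) = evaluation_at p \<phi> * evaluation_at p \<psi>"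
    "evaluation_at p (\<lambda>x\<in>carrier H. c * \<phi> x) = c * evaluation_at p \<phi>" if W: "\<phi> \<in> WAP H T" "\<psi> \<in> WAP H T" for \<phi> \<psi> c
  proof -
    note c = continuous_map_complex[OF extension_spec(1)[OF W(1)] extension_spec(1)[OF W(2)]]
    have "continuous_map KT euclidean (\<lambda>p. c)" by simp
    note c' = continuous_map_complex(1)[OF this extension_spec(1)[OF W(1)]]
    show "evaluation_at p (\<lambda>x\<in>carrier H. \<phi> x + \<psi> x) = evaluation_at p \<phi> + evaluation_at p \<psi>" "evaluation_at p (\<lambda>x\<in>carrier H. \<phi> x * \<psi> x) = evaluation_at p \<phi> * evaluation_at p \<psi>"
      "evaluation_at p (\<lambda>x\<in>carrier H. c * \<phi> x) = c * evaluation_at p \<phi>"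
      unfolding restriction_operations[OF W] evaluation_at_operation[OF c(1) p] evaluation_at_operation[OF c(2) p] evaluation_at_operation[OF c' p]
      using W by (simp_all add: evaluation_at_def)
  qed
  moreover have "continuous_map KT euclidean (\<lambda>p. 1 :: complex)" by simp
  then have "restriction (\<lambda>p. 1) \<in> WAP H T" "evaluation_at p (restriction (\<lambda>p. 1)) = 1"
    by (rule restriction_WAP, rule evaluation_at_operation[OF _ p])
  then have "\<exists>f\<in>WAP H T. evaluation_at p f \<noteq> 0" by (intro bexI[of _ "restriction (\<lambda>p. 1)"]) simp_all
  moreover have "evaluation_at p \<in> extensional (WAP H T)" by (simp add: evaluation_at_def)
  ultimately show ?thesis unfolding characters_def linear_functional_on_def by blast
qed

lemma topspace_gelfand: "topspace gelfand = characters (carrier H) (WAP H T)"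
  by (auto simp: gelfand_space_def characters_def PiE_def)

lemma continuous_evaluation_at: "continuous_map KT gelfand evaluation_at"
  unfolding gelfand_space_def continuous_map_in_subtopology continuous_map_componentwise
proof (intro conjI ballI)
  show "evaluation_at ` topspace KT \<subseteq> extensional (WAP H T)" by (auto simp: evaluation_at_def)
  show "continuous_map KT euclidean (\<lambda>p. evaluation_at p \<phi>)" if "\<phi> \<in> WAP H T" for \<phi>
    using extension_spec(1)[OF that] that by (simp add: evaluation_at_def)
  show "evaluation_at \<in> topspace KT \<rightarrow> characters (carrier H) (WAP H T)" using evaluation_at_character by simp
qed

lemma inj_evaluation_at: "inj_on evaluation_at (topspace KT)"
proof (rule inj_onI)
  fix p q assume "p \<in> topspace KT" "q \<in> topspace KT" and eq: "evaluation_at p = evaluation_at q"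
  then have pq: "p \<in> limits" "q \<in> limits" by simp_all
  have "z \<in> p \<longleftrightarrow> z \<in> q" for z
  proof -
    let ?F = "\<lambda>p. of_bool ({z} \<subseteq> p) :: complex"
    have "continuous_map KT euclidean ?F"
      by (rule weakly_continuousD(1)[OF weakly_continuous_cylinder]) simp
    from evaluation_at_operation[OF this pq(1)] evaluation_at_operation[OF this pq(2)] eq
    have "?F p = ?F q" by simp
    then show ?thesis by (simp add: of_bool_def split: if_splits)
  qed
  then show "p = q" by blast
qed

lemma surj_evaluation_at: "evaluation_at ` topspace KT = topspace gelfand"
proof
  show "evaluation_at ` topspace KT \<subseteq> topspace gelfand" using evaluation_at_character by (auto simp: topspace_gelfand)
  show "topspace gelfand \<subseteq> evaluation_at ` topspace KT"
  proof
    fix \<xi> assume "\<xi> \<in> topspace gelfand"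
    then have \<xi>: "\<xi> \<in> extensional (WAP H T)" "linear_functional_on (carrier H) (WAP H T) \<xi>"
      "\<And>f g. f \<in> WAP H T \<Longrightarrow> g \<in> WAP H T \<Longrightarrow> \<xi> (\<lambda>x\<in>carrier H. f x * g x) = \<xi> f * \<xi> g"
      "\<exists>f\<in>WAP H T. \<xi> f \<noteq> 0"
      unfolding topspace_gelfand characters_def by auto
    have lin: "\<And>f g. f \<in> WAP H T \<Longrightarrow> g \<in> WAP H T \<Longrightarrow> \<xi> (\<lambda>x\<in>carrier H. f x + g x) = \<xi> f + \<xi> g"
      "\<And>c f. f \<in> WAP H T \<Longrightarrow> \<xi> (\<lambda>x\<in>carrier H. c * f x) = c * \<xi> f"
      using \<xi>(2) unfolding linear_functional_on_def by auto
    define \<Xi> where "\<Xi> F = \<xi> (restriction F)" for F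
    have oneW: "restriction (\<lambda>p. 1) \<in> WAP H T" by (rule restriction_WAP) simp
    have one: "\<Xi> (\<lambda>p. 1) = 1"
    proof -
      obtain f where f: "f \<in> WAP H T" "\<xi> f \<noteq> 0" using \<xi>(4) by blast
      have "(\<lambda>x\<in>carrier H. f x * restriction (\<lambda>p. 1) x) = restriction (extension f)"
        unfolding restriction_def using extension_spec(2)[OF f(1)] by (intro restrict_ext) simp
      then have "\<xi> f * \<xi> (restriction (\<lambda>p. 1)) = \<xi> f"
        using \<xi>(3)[OF f(1) oneW] restriction_extension[OF f(1)] by simp
      then show ?thesis using f(2) by (simp add: \<Xi>_def)
    qed
    obtain p where p: "p \<in> topspace KT" "\<And>F. F \<in> {F. continuous_map KT euclidean F} \<Longrightarrow> \<Xi> F = F p"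
    proof (rule character_is_evaluation[OF compact_KT, of \<Xi>])
      fix F F' :: "('a \<times> 'a) set \<Rightarrow> complex"
      assume F: "F \<in> {F. continuous_map KT euclidean F}" "F' \<in> {F. continuous_map KT euclidean F}"
      note W = restriction_WAP[OF F(1)[unfolded mem_Collect_eq]] restriction_WAP[OF F(2)[unfolded mem_Collect_eq]]
      have "restriction (\<lambda>x. F x + F' x) = (\<lambda>x\<in>carrier H. restriction F x + restriction F' x)"
        "restriction (\<lambda>x. F x * F' x) = (\<lambda>x\<in>carrier H. restriction F x * restriction F' x)"
        unfolding restriction_def by (auto intro!: restrict_ext)
      then show "\<Xi> (\<lambda>x. F x + F' x) = \<Xi> F + \<Xi> F'" "\<Xi> (\<lambda>x. F x * F' x) = \<Xi> F * \<Xi> F'"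
        using lin(1)[OF W] \<xi>(3)[OF W] by (simp_all only: \<Xi>_def)
      assume "\<And>x. x \<in> topspace KT \<Longrightarrow> F x = F' x"
      then have "restriction F = restriction F'"
        unfolding restriction_def using graph_in_limits by (intro restrict_ext) simp
      then show "\<Xi> F = \<Xi> F'" by (simp add: \<Xi>_def)
    next
      fix c
      have "restriction (\<lambda>x. c) = (\<lambda>x\<in>carrier H. c * restriction (\<lambda>p. 1) x)"
        unfolding restriction_def by (intro restrict_ext) simp
      then show "\<Xi> (\<lambda>x. c) = c" using lin(2)[OF oneW, of c] one by (simp only: \<Xi>_def mult_1_right)
    qed blast
    have "\<xi> = evaluation_at p"
    proof
      fix \<phi> show "\<xi> \<phi> = evaluation_at p \<phi>"
      proof (cases "\<phi> \<in> WAP H T")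
        case True
        have "\<xi> \<phi> = \<Xi> (extension \<phi>)" by (simp add: \<Xi>_def restriction_extension[OF True])
        also have "\<dots> = extension \<phi> p" using extension_spec(1)[OF True] by (intro p(2)) simp
        finally show ?thesis using True by (simp add: evaluation_at_def)
      next
        case False
        then show ?thesis using \<xi>(1) by (simp add: evaluation_at_def extensional_def)
      qed
    qed
    then show "\<xi> \<in> evaluation_at ` topspace KT" using p(1) by blast
  qed
qed

lemma Hausdorff_gelfand: "Hausdorff_space gelfand"
  unfolding gelfand_space_def
  by (intro Hausdorff_space_subtopology) (simp add: Hausdorff_space_product_topology)

lemma homeomorphic_evaluation_at: "homeomorphic_map KT gelfand evaluation_at"
  by (intro continuous_imp_homeomorphic_map continuous_evaluation_at compact_KT Hausdorff_gelfand surj_evaluation_at inj_evaluation_at)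

lemma WAP_compactification_eq: "WAP_compactification H T = (gelfand, \<lambda>g. \<lambda>\<phi>\<in>WAP H T. \<phi> g)"
  by (simp add: WAP_compactification_def)

lemma evaluation_at_graph: assumes "g \<in> carrier H" shows "evaluation_at (function_graph g) = (\<lambda>\<phi>\<in>WAP H T. \<phi> g)"
  unfolding evaluation_at_def using extension_spec(2) assms by (intro restrict_ext) simp

theorem WAP_graph_equivalent:
  "compactification T (WAP_compactification H T) \<and> compactification T (graph_compactification H) \<and>
   equivalent_compactifications T (WAP_compactification H T) (graph_compactification H)"
proof (intro conjI compactification_graph)
  obtain k where k: "homeomorphic_maps KT gelfand evaluation_at k"
    using homeomorphic_evaluation_at by (auto simp: homeomorphic_map_maps)
  have "homeomorphic_map gelfand KT k"
    using k homeomorphic_maps_sym homeomorphic_maps_map by blast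
  moreover have "k (\<lambda>\<phi>\<in>WAP H T. \<phi> g) = function_graph g" if "g \<in> carrier H" for g
    using k graph_in_limits[OF that] evaluation_at_graph[OF that] by (auto simp: homeomorphic_maps_def)
  ultimately show "equivalent_compactifications T (WAP_compactification H T) (graph_compactification H)"
    unfolding WAP_compactification_eq graph_compactification_eq equivalent_compactifications_def by auto
  have cont: "continuous_map T gelfand (\<lambda>g. \<lambda>\<phi>\<in>WAP H T. \<phi> g)"
    by (rule continuous_map_eq[OF continuous_map_compose[OF continuous_graph continuous_evaluation_at]])
      (simp add: evaluation_at_graph)
  have "compact_space gelfand"
    using homeomorphic_evaluation_at compact_KT homeomorphic_compact_space homeomorphic_map_imp_homeomorphic_space by blast
  moreover have "Abstract_Topology.closure_of gelfand ((\<lambda>g. \<lambda>\<phi>\<in>WAP H T. \<phi> g) ` topspace T) = topspace gelfand"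
  proof -
    have im: "(\<lambda>g. \<lambda>\<phi>\<in>WAP H T. \<phi> g) ` topspace T = evaluation_at ` function_graph ` carrier H"
      using evaluation_at_graph by (auto simp: image_iff)
    have "Abstract_Topology.closure_of gelfand (evaluation_at ` function_graph ` carrier H)
        = evaluation_at ` (Abstract_Topology.closure_of KT (function_graph ` carrier H))"
      using graph_in_limits by (intro homeomorphic_map_closure_of[OF homeomorphic_evaluation_at]) auto
    also have "Abstract_Topology.closure_of KT (function_graph ` carrier H) = topspace KT"
      using compactification_graph by (simp add: compactification_def graph_compactification_eq)
    finally show ?thesis using surj_evaluation_at im by simp
  qed
  ultimately show "compactification T (WAP_compactification H T)"
    using Hausdorff_gelfand cont by (simp add: WAP_compactification_eq compactification_def)
qed

end

text \<open>Pattern continuity is uniform continuity for the uniformity of the graph compactification.\<close>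

lemma (in homogeneous_cyclic_order) extendible_WAP_Aut: "extendible_WAP (aut_group R)"
proof -
  interpret permutation_monoid "aut_group R"
  proof
    show "id \<in> Aut" by (simp add: Aut_iff)
    show "g \<circ> h \<in> Aut" if "g \<in> Aut" "h \<in> Aut" for g h
      using that by (auto simp: Aut_iff bij_comp)
    show "inv_map g \<in> Aut" if "g \<in> Aut" for g
      unfolding Aut_iff
    proof (intro conjI allI)
      have g: "bij g" "\<And>a b c. R a b c \<longleftrightarrow> R (g a) (g b) (g c)" using that by (simp_all add: Aut_iff)
      then show "bij (inv_map g)" by (simp add: bij_imp_bij_inv)
      fix a b c show "R a b c \<longleftrightarrow> R (inv_map g a) (inv_map g b) (inv_map g c)"
        using g(2)[of "inv_map g a" "inv_map g b" "inv_map g c"] g(1) by (simp add: bij_is_surj surj_f_inv_f)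
    qed
    show "bij g" if "g \<in> Aut" for g using that by (simp add: Aut_iff)
    show "monoid.mult (aut_group R) = (\<circ>)" by (simp add: aut_group_def)
  qed
  show ?thesis
  proof
    fix \<phi> assume "\<phi> \<in> WAP (aut_group R) T"
    from WAP_stable[OF this] obtain M where st: "stable_function Aut \<phi> M" by blast
    interpret cyclic_stable_function R Aut \<phi> M
      by (intro cyclic_stable_function.intro homogeneous_cyclic_order_axioms st cyclic_stable_function_axioms.intro refl)
    have "\<exists>S. finite S \<and> (\<forall>g\<in>Aut. \<forall>g'\<in>Aut. function_graph g \<inter> S = function_graph g' \<inter> S \<longrightarrow> norm (\<phi> g - \<phi> g') \<le> e)"
      if e: "e > 0" for e :: real
    proof -
      obtain A where A: "finite A" "\<And>g g'. g \<in> Aut \<Longrightarrow> g' \<in> Aut \<Longrightarrow>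
        \<forall>x\<in>A. \<forall>y\<in>A. g x = y \<longleftrightarrow> g' x = y \<Longrightarrow> norm (\<phi> g - \<phi> g') \<le> e"
        using absorbers.pattern_continuous[OF e] by blast
      have "norm (\<phi> g - \<phi> g') \<le> e"
        if g: "g \<in> Aut" "g' \<in> Aut" and eq: "function_graph g \<inter> A \<times> A = function_graph g' \<inter> A \<times> A" for g g'
      proof (rule A(2)[OF g], intro ballI)
        fix x y assume "x \<in> A" "y \<in> A"
        then have "(x, y) \<in> function_graph g \<longleftrightarrow> (x, y) \<in> function_graph g'" using eq by blast
        then show "g x = y \<longleftrightarrow> g' x = y" by simp
      qed
      with A(1) show ?thesis by (intro exI[of _ "A \<times> A"]) simp
    qed
    from extend_to_limits[OF bounded this] obtain F where
      "continuous_map KT euclidean F" "\<And>g. g \<in> Aut \<Longrightarrow> F (function_graph g) = \<phi> g" by blast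
    then show "\<exists>F. continuous_map KT euclidean F \<and> (\<forall>g\<in>Aut. F (function_graph g) = \<phi> g)" by blast
  qed
qed

theorem theorem3:
  fixes R :: "'a \<Rightarrow> 'a \<Rightarrow> 'a \<Rightarrow> bool"
  defines "G \<equiv> aut_group R"
  defines "T \<equiv> permutation_topology G"
  assumes "cyclic_order R"
    and "infinite (UNIV :: 'a set)"
    and "ultrahomogeneous R"
  shows "compactification T (WAP_compactification G T) \<and>
         compactification T (graph_compactification G) \<and>
         equivalent_compactifications T (WAP_compactification G T) (graph_compactification G)"
proof -
  interpret homogeneous_cyclic_order R
    using assms(3-5) by (simp add: homogeneous_cyclic_order_def homogeneous_cyclic_order_axioms_def)
  interpret extendible_WAP "aut_group R" by (rule extendible_WAP_Aut)
  show ?thesis unfolding T_def G_def by (rule WAP_graph_equivalent)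
qed

end
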